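(* Suppose that there exists a pseudorandom quantum states generator which, on input $k\in\{0,1\}^n$, outputs an $m$-qubit state, where $m=m(n)\ge cn$ for some constant $c>1$. Then there exists a one-time secure digital signature scheme with quantum public keys (with message space $\{0,1\}$ and perfect correctness).
   Context: Conventions. QPT means (uniform) quantum polynomial time and PPT classical probabilistic polynomial time. A function $f$ is negligible if for every constant $c>0$, $f(\lambda)<\lambda^{-c}$ for all large enough $\lambda$; $\mathsf{negl}$ denotes a negligible function. $k\leftarrow\{0,1\}^n$ means $k$ is sampled uniformly at random. Pseudorandom quantum states generator (PRSG). A PRSG is a QPT algorithm $\mathsf{StateGen}$ that, on input $k\in\{0,1\}^n$, outputs an $m$-qubit quantum state $|\phi_k\rangle$, such that for every polynomial $t$ and every non-uniform QPT adversary $\mathcal{A}$ there is a negligible function $\mathsf{negl}$ such that for all $n$, $$\Big|\Pr_{k\leftarrow\{0,1\}^n}[\mathcal{A}(|\phi_k\rangle^{\otimes t(n)})\to1]-\Pr_{|\psi\rangle\leftarrow\mu_m}[\mathcal{A}(|\psi\rangle^{\otimes t(n)})\to1]\Big|\le\mathsf{negl}(n),$$ where $\mu_m$ is the Haar measure on $m$-qubit pure states. Standing convention: the output is pure and no ancilla is left over, i.e. on input $k$, $\mathsf{StateGen}$ computes in classical polynomial time a description of a unitary quantum circuit $U_k$ and outputs $|\phi_k\rangle=U_k|0\ldots0\rangle$. Digital signature scheme with quantum public keys. A tuple $(\mathsf{Gen}_1,\mathsf{Gen}_2,\mathsf{Sign},\mathsf{Verify})$ where: $\mathsf{Gen}_1(1^\lambda)$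 is a classical PPT algorithm that outputs a classical secret key $sk$; $\mathsf{Gen}_2(sk)$ is a QPT algorithm that outputs a quantum public key $pk$ (a quantum state); $\mathsf{Sign}(sk,m)$ is a classical deterministic polynomial-time algorithm that outputs a classical signature $\sigma$ on message $m$; $\mathsf{Verify}(pk,m,\sigma)$ is a QPT algorithm that outputs $\top$ or $\bot$. Perfect correctness: for all messages $m$, $\Pr[\top\leftarrow\mathsf{Verify}(pk,m,\sigma): sk\leftarrow\mathsf{Gen}_1(1^\lambda),\,pk\leftarrow\mathsf{Gen}_2(sk),\,\sigma\leftarrow\mathsf{Sign}(sk,m)]=1$. One-time security. Consider the game $\mathsf{Exp}$ between a challenger $\mathcal{C}$ and an adversary $\mathcal{A}$: (1) $\mathcal{C}$ runs $sk\leftarrow\mathsf{Gen}_1(1^\lambda)$. (2) $\mathcal{A}$ can query $pk\leftarrow\mathsf{Gen}_2(sk)$ polynomially many (in $\lambda$) times, i.e. receives polynomially many copies of the public key. (3) $\mathcal{A}$ sends a message $m$ to $\mathcal{C}$. (4) $\mathcal{C}$ runs $\sigma\leftarrow\mathsf{Sign}(sk,m)$ and sends $\sigma$ to $\mathcal{A}$. (5) $\mathcal{A}$ sends $\sigma'$ and $m'$ to $\mathcal{C}$. (6) $\mathcal{C}$ runs $v\leftarrow\mathsf{Verify}(pk,m',\sigma')$ (with $pk\leftarrow\mathsf{Gen}_2(sk)$); the output of the game is 1 if $m'\ne m$ and $v=\top$, and 0 otherwise. The scheme is one-time secure if for every QPT $\mathcal{A}$ there is a negligible function with $\Pr[\mathsf{Exp}=1]\le\mathsf{negl}(\lambda)$.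 *)

theory Defs
  imports
    "HOL-Computational_Algebra.Polynomial"
    "HOL-Probability.Probability"
begin

section \<open>Quantum memory\<close>

text \<open>
  A quantum memory has qubits 0, 1, 2, ...  The computational basis state in which exactly the
  qubits in a finite set I are 1 is represented by the natural number with bit set I, so that
  amplitude vectors are functions on the naturals.  All vectors and operators that arise have
  finite support: an m-qubit vector is supported on the numbers below 2 ^ m, and all further qubits
  are in state 0.
\<close>

type_synonym qvec = "nat \<Rightarrow> complex"
type_synonym qop = "nat \<Rightarrow> nat \<Rightarrow> complex"

definition pure_state :: "nat \<Rightarrow> qvec \<Rightarrow> bool" where
  "pure_state m \<psi> \<longleftrightarrow> (\<forall>x\<ge>2 ^ m. \<psi> x = 0) \<and> (\<Sum>x<2 ^ m. (cmod (\<psi> x))\<^sup>2) = 1"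

definition ket_zero :: qvec where
  "ket_zero x = (if x = 0 then 1 else 0)"

definition proj :: "qvec \<Rightarrow> qop" where
  "proj \<psi> x y = \<psi> x * cnj (\<psi> y)"

definition qtrace :: "qop \<Rightarrow> complex" where
  "qtrace \<rho> = (\<Sum>x | \<rho> x x \<noteq> 0. \<rho> x x)"

text \<open>The operator \<rho> occupies qubits 0, ..., m - 1, and \<tau> is shifted to the qubits from m on.\<close>

definition tensor :: "nat \<Rightarrow> qop \<Rightarrow> qop \<Rightarrow> qop" where
  "tensor m \<rho> \<tau> x y = \<rho> (x mod 2 ^ m) (y mod 2 ^ m) * \<tau> (x div 2 ^ m) (y div 2 ^ m)"

primrec copies :: "nat \<Rightarrow> nat \<Rightarrow> qop \<Rightarrow> qop" where
  "copies m 0 \<rho> = proj ket_zero"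
| "copies m (Suc t) \<rho> = tensor m \<rho> (copies m t \<rho>)"

text \<open>Partial trace over all qubits except the first m.\<close>

definition keep_qubits :: "nat \<Rightarrow> qop \<Rightarrow> qop" where
  "keep_qubits m \<rho> x y =
     (if x < 2 ^ m \<and> y < 2 ^ m then
        (\<Sum>z | \<rho> (x + 2 ^ m * z) (y + 2 ^ m * z) \<noteq> 0. \<rho> (x + 2 ^ m * z) (y + 2 ^ m * z))
      else 0)"


section \<open>Gates and circuits\<close>

text \<open>The universal gate set consisting of the Hadamard gate, the T gate and CNOT.\<close>

datatype 'q gate = Had 'q | TGate 'q | CNOT 'q 'q

primrec gate_vec :: "nat gate \<Rightarrow> qvec \<Rightarrow> qvec" where
  "gate_vec (Had i) \<psi> =
     (\<lambda>x. ((if bit x i then - \<psi> x else \<psi> x) + \<psi> (flip_bit i x)) / complex_of_real (sqrt 2))"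
| "gate_vec (TGate i) \<psi> = (\<lambda>x. if bit x i then cis (pi / 4) * \<psi> x else \<psi> x)"
| "gate_vec (CNOT i j) \<psi> = (\<lambda>x. if i \<noteq> j \<and> bit x i then \<psi> (flip_bit j x) else \<psi> x)"

text \<open>The operator G \<rho> G* for a gate G: G is applied to the columns and its conjugate to the rows.\<close>

definition gate_op :: "nat gate \<Rightarrow> qop \<Rightarrow> qop" where
  "gate_op g \<rho> x y = cnj (gate_vec g (\<lambda>y'. cnj (gate_vec g (\<lambda>x'. \<rho> x' y') x)) y)"

definition project_qubit :: "nat \<Rightarrow> bool \<Rightarrow> qop \<Rightarrow> qop" where
  "project_qubit i b \<rho> x y = (if bit x i = b \<and> bit y i = b then \<rho> x y else 0)"

primrec gate_on :: "nat \<Rightarrow> nat gate \<Rightarrow> bool" where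
  "gate_on m (Had i) \<longleftrightarrow> i < m"
| "gate_on m (TGate i) \<longleftrightarrow> i < m"
| "gate_on m (CNOT i j) \<longleftrightarrow> i < m \<and> j < m \<and> i \<noteq> j"

definition circuit_output :: "nat gate list \<Rightarrow> qvec" where
  "circuit_output gs = fold gate_vec gs ket_zero"

definition unary :: "nat \<Rightarrow> bool list" where
  "unary n = replicate n True"

text \<open>A self-delimiting binary description of a circuit: its number of qubits, then its gates.\<close>

primrec encode_gate :: "nat gate \<Rightarrow> bool list" where
  "encode_gate (Had i) = [False, False] @ unary i @ [False]"
| "encode_gate (TGate i) = [False, True] @ unary i @ [False]"
| "encode_gate (CNOT i j) = [True] @ unary i @ [False] @ unary j @ [False]"

definition encode_circuit :: "nat \<Rightarrow> nat gate list \<Rightarrow> bool list" where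
  "encode_circuit m gs = unary m @ [False] @ concat (map encode_gate gs)"


section \<open>Algorithms\<close>

text \<open>
  The machine model: a program controls finitely many classical registers, each a stack of bits,
  and a quantum memory.  Classical instructions alone simulate, and are simulated by, multi-tape
  Turing machines with polynomial overhead.  Quantum instructions address a qubit by the length of a
  register, so that a machine running for T steps on an input of length n reaches only qubits with
  index at most n + T.
\<close>

datatype com =
    Skip
  | Push nat bool
  | Pop nat
  | Seq com com
  | IfTop nat com com
  | IfEmpty nat com com
  | While nat com          \<comment> \<open>iterate as long as the register is nonempty\<close>
  | Flip nat               \<comment> \<open>push a uniformly random bit\<close>
  | Apply "nat gate"       \<comment> \<open>the gate is given by the registers holding the qubit addresses\<close>
  | Meas nat nat           \<comment> \<open>measure the qubit addressed by the first register in the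
                                computational basis, push the outcome on the second\<close>

primrec quantum_free :: "com \<Rightarrow> bool" where
  "quantum_free Skip \<longleftrightarrow> True"
| "quantum_free (Push r b) \<longleftrightarrow> True"
| "quantum_free (Pop r) \<longleftrightarrow> True"
| "quantum_free (Seq c d) \<longleftrightarrow> quantum_free c \<and> quantum_free d"
| "quantum_free (IfTop r c d) \<longleftrightarrow> quantum_free c \<and> quantum_free d"
| "quantum_free (IfEmpty r c d) \<longleftrightarrow> quantum_free c \<and> quantum_free d"
| "quantum_free (While r c) \<longleftrightarrow> quantum_free c"
| "quantum_free (Flip r) \<longleftrightarrow> True"
| "quantum_free (Apply g) \<longleftrightarrow> False"
| "quantum_free (Meas q r) \<longleftrightarrow> False"

primrec coin_free :: "com \<Rightarrow> bool" where
  "coin_free Skip \<longleftrightarrow> True"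
| "coin_free (Push r b) \<longleftrightarrow> True"
| "coin_free (Pop r) \<longleftrightarrow> True"
| "coin_free (Seq c d) \<longleftrightarrow> coin_free c \<and> coin_free d"
| "coin_free (IfTop r c d) \<longleftrightarrow> coin_free c \<and> coin_free d"
| "coin_free (IfEmpty r c d) \<longleftrightarrow> coin_free c \<and> coin_free d"
| "coin_free (While r c) \<longleftrightarrow> coin_free c"
| "coin_free (Flip r) \<longleftrightarrow> False"
| "coin_free (Apply g) \<longleftrightarrow> True"
| "coin_free (Meas q r) \<longleftrightarrow> True"

type_synonym store = "nat \<Rightarrow> bool list"

text \<open>
  A configuration is a control stack of programs still to be executed (the empty one means
  that the machine has halted), a classical store, and the state of the quantum memory.  A step
  yields the list of its possible successors.  Quantum states are not renormalised: along a branch,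
  the trace of the state is multiplied by the probability of taking that branch.
\<close>

type_synonym config = "com list \<times> store \<times> qop"

definition top_bit :: "bool list \<Rightarrow> bool" where
  "top_bit xs \<longleftrightarrow> xs \<noteq> [] \<and> hd xs"

fun step :: "config \<Rightarrow> config list" where
  "step ([], s, \<rho>) = [([], s, \<rho>)]"
| "step (Skip # K, s, \<rho>) = [(K, s, \<rho>)]"
| "step (Push r b # K, s, \<rho>) = [(K, s(r := b # s r), \<rho>)]"
| "step (Pop r # K, s, \<rho>) = [(K, s(r := tl (s r)), \<rho>)]"
| "step (Seq c d # K, s, \<rho>) = [(c # d # K, s, \<rho>)]"
| "step (IfTop r c d # K, s, \<rho>) = [((if top_bit (s r) then c else d) # K, s, \<rho>)]"
| "step (IfEmpty r c d # K, s, \<rho>) = [((if s r = [] then c else d) # K, s, \<rho>)]"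
| "step (While r c # K, s, \<rho>) = [(if s r = [] then K else c # While r c # K, s, \<rho>)]"
| "step (Flip r # K, s, \<rho>) =
     [(K, s(r := b # s r), \<lambda>x y. \<rho> x y / 2). b \<leftarrow> [False, True]]"
| "step (Apply g # K, s, \<rho>) = [(K, s, gate_op (map_gate (\<lambda>r. length (s r)) g) \<rho>)]"
| "step (Meas q r # K, s, \<rho>) =
     [(K, s(r := b # s r), project_qubit (length (s q)) b \<rho>). b \<leftarrow> [False, True]]"

definition run :: "nat \<Rightarrow> com \<Rightarrow> store \<Rightarrow> qop \<Rightarrow> config list" where
  "run T c s \<rho> = ((\<lambda>cfgs. concat (map step cfgs)) ^^ T) [([c], s, \<rho>)]"

definition halted :: "config list \<Rightarrow> bool" where
  "halted cfgs \<longleftrightarrow> (\<forall>cfg \<in> set cfgs. fst cfg = [])"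

text \<open>The control flow depends on the quantum state only through the weights of the branches, so
  whether all branches halt within T steps can be tested with any initial quantum state.\<close>

definition halts_within :: "nat \<Rightarrow> com \<Rightarrow> store \<Rightarrow> bool" where
  "halts_within T c s \<longleftrightarrow> halted (run T c s (proj ket_zero))"

definition branches :: "com \<Rightarrow> store \<Rightarrow> qop \<Rightarrow> (store \<times> qop) list" where
  "branches c s \<rho> = map snd (run (LEAST T. halts_within T c s) c s \<rho>)"

text \<open>Classical inputs are placed in the registers 0, 1, 2, ...; output is read from register 0.\<close>

definition input :: "bool list list \<Rightarrow> store" where
  "input xs r = (if r < length xs then xs ! r else [])"

definition poly_time :: "com \<Rightarrow> bool list list set \<Rightarrow> bool" where
  "poly_time c X \<longleftrightarrow>
     (\<exists>p :: nat poly. \<forall>xs\<in>X. halts_within (poly p (\<Sum>x\<leftarrow>xs. length x)) c (input xs))"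

definition accept_prob :: "com \<Rightarrow> bool list list \<Rightarrow> qop \<Rightarrow> real" where
  "accept_prob c xs \<rho> =
     (\<Sum>(s, \<rho>') \<leftarrow> branches c (input xs) \<rho>. if top_bit (s 0) then Re (qtrace \<rho>') else 0)"

text \<open>Meaningful for deterministic classical programs, which have a single branch.\<close>

definition classical_output :: "com \<Rightarrow> bool list list \<Rightarrow> bool list" where
  "classical_output c xs = fst (hd (branches c (input xs) (proj ket_zero))) 0"

definition negligible :: "(nat \<Rightarrow> real) \<Rightarrow> bool" where
  "negligible f \<longleftrightarrow> (\<forall>c>0. eventually (\<lambda>n. f n < real n powr (- c)) sequentially)"


section \<open>The Haar measure on pure states\<close>

definition unitary_matrix :: "nat \<Rightarrow> (nat \<Rightarrow> nat \<Rightarrow> complex) \<Rightarrow> bool" where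
  "unitary_matrix d U \<longleftrightarrow>
     (\<forall>x<d. \<forall>y<d. (\<Sum>z<d. cnj (U z x) * U z y) = (if x = y then 1 else 0))"

definition apply_matrix :: "nat \<Rightarrow> (nat \<Rightarrow> nat \<Rightarrow> complex) \<Rightarrow> qvec \<Rightarrow> qvec" where
  "apply_matrix d U \<psi> x = (if x < d then \<Sum>y<d. U x y * \<psi> y else 0)"

text \<open>The Haar measure is the unique unitarily invariant Borel probability measure on the pure
  m-qubit states.\<close>

definition haar_measure :: "nat \<Rightarrow> qvec measure \<Rightarrow> bool" where
  "haar_measure m \<mu> \<longleftrightarrow>
     prob_space \<mu> \<and> sets \<mu> = sets borel \<and> (AE \<psi> in \<mu>. pure_state m \<psi>) \<and>
     (\<forall>U. unitary_matrix (2 ^ m) U \<longrightarrow> distr \<mu> borel (apply_matrix (2 ^ m) U) = \<mu>)"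


section \<open>Pseudorandom quantum state generators\<close>

text \<open>Non-uniformity is a classical advice string of polynomial length.\<close>

definition nonuniform_qpt :: "com \<Rightarrow> (nat \<Rightarrow> bool list) \<Rightarrow> bool" where
  "nonuniform_qpt A advice \<longleftrightarrow>
     (\<exists>p :: nat poly. \<forall>n. length (advice n) \<le> poly p n) \<and>
     poly_time A {[unary n, advice n] | n. True}"

definition circuit_generator :: "com \<Rightarrow> (nat \<Rightarrow> nat) \<Rightarrow> (bool list \<Rightarrow> nat gate list) \<Rightarrow> bool" where
  "circuit_generator G m U \<longleftrightarrow>
     quantum_free G \<and> coin_free G \<and> poly_time G {[k] | k. True} \<and>
     (\<forall>k. (\<forall>g \<in> set (U k). gate_on (m (length k)) g) \<and>
          classical_output G [k] = encode_circuit (m (length k)) (U k))"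

text \<open>Since the Haar measure exists and is unique, the quantifier over \<mu> merely names it.\<close>

definition prsg :: "com \<Rightarrow> (nat \<Rightarrow> nat) \<Rightarrow> bool" where
  "prsg G m \<longleftrightarrow> (\<exists>U. circuit_generator G m U \<and>
     (\<forall>t :: nat poly. \<forall>A advice. nonuniform_qpt A advice \<longrightarrow>
        (\<exists>negl. negligible negl \<and>
          (\<forall>n. \<exists>\<mu>. haar_measure (m n) \<mu> \<and>
             \<bar>(\<Sum>k | length k = n. accept_prob A [unary n, advice n]
                   (copies (m n) (poly t n) (proj (circuit_output (U k))))) / 2 ^ n
              - (LINT \<psi>|\<mu>. accept_prob A [unary n, advice n]
                   (copies (m n) (poly t n) (proj \<psi>)))\<bar>
             \<le> negl n))))"


section \<open>Digital signatures with quantum public keys\<close>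

text \<open>
  The message space is {0, 1}.  For security parameter n, the public key has pk_qubits n qubits.
\<close>

record signature_scheme =
  gen1 :: com
  gen2 :: com
  sign :: com
  verify :: com
  pk_qubits :: "nat \<Rightarrow> nat"

definition secret_keys :: "signature_scheme \<Rightarrow> nat \<Rightarrow> (bool list \<times> real) list" where
  "secret_keys S n =
     [(s 0, Re (qtrace \<rho>)). (s, \<rho>) \<leftarrow> branches (gen1 S) (input [unary n]) (proj ket_zero)]"

text \<open>The output of Gen2 as a density operator: the first l qubits, averaged over all branches.\<close>

definition public_key :: "signature_scheme \<Rightarrow> nat \<Rightarrow> bool list \<Rightarrow> qop" where
  "public_key S l sk x y =
     (\<Sum>(s, \<rho>) \<leftarrow> branches (gen2 S) (input [sk]) (proj ket_zero). keep_qubits l \<rho> x y)"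

definition signature :: "signature_scheme \<Rightarrow> bool list \<Rightarrow> bool \<Rightarrow> bool list" where
  "signature S sk b = classical_output (sign S) [sk, [b]]"

definition verify_prob ::
  "signature_scheme \<Rightarrow> nat \<Rightarrow> qop \<Rightarrow> bool \<Rightarrow> bool list \<Rightarrow> real" where
  "verify_prob S n pk b \<sigma> = accept_prob (verify S) [unary n, [b], \<sigma>] pk"

text \<open>
  Gen2 announces the number of output qubits as the length of register 0.  This makes the length of
  the public key polynomially bounded and efficiently computable.
\<close>

definition efficient_scheme :: "signature_scheme \<Rightarrow> bool" where
  "efficient_scheme S \<longleftrightarrow>
     quantum_free (gen1 S) \<and> poly_time (gen1 S) {[unary n] | n. True} \<and>
     poly_time (gen2 S) {[sk] | sk. True} \<and>
     quantum_free (sign S) \<and> coin_free (sign S) \<and> poly_time (sign S) {[sk, [b]] | sk b. True} \<and>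
     poly_time (verify S) {[unary n, [b], \<sigma>] | n b \<sigma>. True} \<and>
     (\<forall>n. \<forall>(sk, w) \<in> set (secret_keys S n).
        \<forall>(s, \<rho>) \<in> set (branches (gen2 S) (input [sk]) (proj ket_zero)).
          length (s 0) = pk_qubits S n)"

definition perfectly_correct :: "signature_scheme \<Rightarrow> bool" where
  "perfectly_correct S \<longleftrightarrow>
     (\<forall>n b. (\<Sum>(sk, w) \<leftarrow> secret_keys S n.
        w * verify_prob S n (public_key S (pk_qubits S n) sk) b (signature S sk b)) = 1)"

text \<open>
  The adversary consists of two programs and a polynomial t.  The first program receives t n copies
  of the public key and leaves its message in register 0.  The second one continues on the
  resulting classical and quantum memory, with the signature placed in register 0, and leaves
  the forgery in registers 0 (message) and 1 (signature).
\<close>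

definition adversary_start ::
  "signature_scheme \<Rightarrow> com \<Rightarrow> nat poly \<Rightarrow> nat \<Rightarrow> bool list \<Rightarrow> (store \<times> qop) list" where
  "adversary_start S A1 t n sk =
     (let l = pk_qubits S n in
      branches A1 (input [unary n, unary l]) (copies l (poly t n) (public_key S l sk)))"

definition qpt_adversary :: "signature_scheme \<Rightarrow> com \<Rightarrow> com \<Rightarrow> nat poly \<Rightarrow> bool" where
  "qpt_adversary S A1 A2 t \<longleftrightarrow>
     poly_time A1 {[unary n, unary (pk_qubits S n)] | n. True} \<and>
     (\<exists>p :: nat poly. \<forall>n sk \<sigma>. \<forall>(s, \<rho>) \<in> set (adversary_start S A1 t n sk).
        halts_within (poly p (n + length \<sigma>)) A2 (s(0 := \<sigma>)))"

definition forgery_prob ::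
  "signature_scheme \<Rightarrow> com \<Rightarrow> com \<Rightarrow> nat poly \<Rightarrow> nat \<Rightarrow> real" where
  "forgery_prob S A1 A2 t n =
     (\<Sum>(sk, w) \<leftarrow> secret_keys S n. w *
        (\<Sum>(s1, \<rho>1) \<leftarrow> adversary_start S A1 t n sk.
          (let b = top_bit (s1 0) in
           \<Sum>(s2, \<rho>2) \<leftarrow> branches A2 (s1(0 := signature S sk b)) \<rho>1.
             (let b' = top_bit (s2 0); \<sigma>' = s2 1 in
              if b' \<noteq> b
              then Re (qtrace \<rho>2) * verify_prob S n (public_key S (pk_qubits S n) sk) b' \<sigma>'
              else 0))))"

definition one_time_secure :: "signature_scheme \<Rightarrow> bool" where
  "one_time_secure S \<longleftrightarrow>
     (\<forall>A1 A2 t. qpt_adversary S A1 A2 t \<longrightarrow>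
        (\<exists>negl. negligible negl \<and> (\<forall>n. forgery_prob S A1 A2 t n \<le> negl n)))"

end

theory Submission
  imports Defs "HOL-Real_Asymp.Real_Asymp"
begin

text \<open>
  The secret key interleaves two keys k0 and k1 of the generator, the public key consists of the
  states of k0 and k1, and kb is the signature of the bit b.  To verify a signature, run the circuit
  of the claimed key backwards on part b of the public key and accept if all qubits are measured
  to be 0; this accepts with probability the squared overlap of the two states.

  For security, fix the message b that the adversary asks for, and let k' be the key that is not
  revealed.  Fix kb to the value that is best for the adversary.  Advice can then contain kb and a
  circuit that turns t + 1 copies of the state of k' into t public keys and one spare copy, which is
  moved beyond all qubits that the adversary is able to address and later serves to verify the
  forgery.  So forging is an experiment on t + 1 copies of the state of k', and that state may be
  replaced by a Haar random state \<psi>.  No signature can then be accepted with probability more than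
  the sum of the squared overlaps of \<psi> with the states of all 2^n keys, whose expectation is
  2^n / 2^m.
\<close>

section \<open>Executions\<close>

text \<open>The copies must be put in place before the adversary speaks, but the slot to fill
  depends on the message it asks for. So there is one reduction for each \<open>b\<close>, which
  rejects if the other message is asked for; the forgery probability is exactly the sum of the two
  resulting averages, without a guessing loss. Hiding the spare copy works because addresses are
  register lengths and grow by at most one per step: a run cannot touch qubits beyond its time
  bound, so it commutes with tensoring the copy on. The best key is merely known to exist and may be
  hard to compute; advice can supply it all the same. On the Haar side the joint state of the t + 1
  copies is never analysed: the branch weights of a run sum to 1 and each single overlap is at most
  the sum of all overlaps, so the moment E |psi_x|^2 = 2^-m suffices, and m >= c n with c > 1 bounds
  2^n / 2^m by 2^(-(c - 1) n). The rest is programming: the scheme and the reduction are explicit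
  programs, whose results and polynomial running times are proved together.\<close>

primrec ev :: "nat \<Rightarrow> config \<Rightarrow> config list" where
  "ev 0 cfg = [cfg]"
| "ev (Suc T) cfg = concat (map (ev T) (step cfg))"

text \<open>\<open>run\<close> iterates a step on the whole list of configurations. Branches never
  interact, so each entry can be evolved on its own, and the recursion of \<open>ev\<close> unfolds
  the first step, which is the form that inductions over executions need.\<close>

lemma funpow_step_eq_ev:
  "((\<lambda>cfgs. concat (map step cfgs)) ^^ T) cfgs = concat (map (ev T) cfgs)"
proof (induction T arbitrary: cfgs)
  case 0
  then show ?case by (induction cfgs) auto
next
  case (Suc T)
  have "((\<lambda>cfgs. concat (map step cfgs)) ^^ Suc T) cfgs
      = ((\<lambda>cfgs. concat (map step cfgs)) ^^ T) (concat (map step cfgs))"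
    by (simp only: funpow_Suc_right comp_apply)
  also have "\<dots> = concat (map (ev T) (concat (map step cfgs)))"
    by (rule Suc)
  also have "\<dots> = concat (map (ev (Suc T)) cfgs)"
    by (induction cfgs) auto
  finally show ?case .
qed

lemma run_eq_ev: "run T c s \<rho> = ev T ([c], s, \<rho>)"
  by (simp add: run_def funpow_step_eq_ev)

lemma ev_halted [simp]: "ev T ([], s, \<rho>) = [([], s, \<rho>)]"
  by (induction T) auto

lemma ev_add: "ev (N + T) cfg = concat (map (ev T) (ev N cfg))"
proof (induction N arbitrary: cfg)
  case (Suc N)
  have "concat (map (ev T) (concat (map (ev N) xs))) = concat (map (ev (N + T)) xs)" for xs
    by (induction xs) (simp_all add: Suc)
  then show ?case by simp
qed simp

lemma concat_map_ev_halted: "concat (map (ev T) (map (Pair []) L)) = map (Pair []) L"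
  by (induction L) auto

lemma halted_iff_map_Pair: "halted cfgs \<longleftrightarrow> cfgs = map (Pair []) (map snd cfgs)"
proof (induction cfgs)
  case (Cons a cfgs)
  then show ?case by (cases a) (auto simp: halted_def)
qed (simp add: halted_def)

text \<open>\<open>N\<close> is only an upper bound on the running time, since a halted
  configuration steps to itself. Time bounds may be enlarged freely, and \<open>L\<close> is unique
  although \<open>N\<close> is not.\<close>

definition execs :: "com list \<Rightarrow> store \<Rightarrow> qop \<Rightarrow> nat \<Rightarrow> (store \<times> qop) list \<Rightarrow> bool" where
  "execs K s \<rho> N L \<longleftrightarrow> ev N (K, s, \<rho>) = map (Pair []) L"

abbreviation exec :: "com \<Rightarrow> store \<Rightarrow> qop \<Rightarrow> nat \<Rightarrow> (store \<times> qop) list \<Rightarrow> bool" where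
  "exec c \<equiv> execs [c]"

lemma execs_halted: "execs K s \<rho> N L \<Longrightarrow> halted (ev N (K, s, \<rho>))"
  by (auto simp: execs_def halted_def)

lemma halted_execs: "halted (ev N (K, s, \<rho>)) \<Longrightarrow> execs K s \<rho> N (map snd (ev N (K, s, \<rho>)))"
  using halted_iff_map_Pair unfolding execs_def by blast

lemma execs_mono: "execs K s \<rho> N L \<Longrightarrow> N \<le> N' \<Longrightarrow> execs K s \<rho> N' L"
  using ev_add[of N "N' - N" "(K, s, \<rho>)"] concat_map_ev_halted[of "N' - N" L]
  by (simp add: execs_def)

lemma execs_unique: "execs K s \<rho> N L \<Longrightarrow> execs K s \<rho> N' L' \<Longrightarrow> L = L'"
  using execs_mono[of K s \<rho> N L "max N N'"] execs_mono[of K s \<rho> N' L' "max N N'"]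
  map_injective[of "Pair []" L L']
  by (simp add: execs_def inj_def)

lemma step_fst_snd_indep:
  "map (\<lambda>(K, s, \<rho>). (K, s)) (step (K, s, \<rho>)) = map (\<lambda>(K, s, \<rho>). (K, s)) (step (K, s, \<rho>'))"
proof (cases K)
  case (Cons c K')
  then show ?thesis by (cases c) auto
qed auto

text \<open>A coin or a measurement always yields both successors, even one of weight 0, so the
  quantum state never influences which control stacks and stores occur.\<close>

lemma ev_fst_snd_indep:
  "map (\<lambda>(K, s, \<rho>). (K, s)) (ev N (K, s, \<rho>)) = map (\<lambda>(K, s, \<rho>). (K, s)) (ev N (K, s, \<rho>'))"
proof (induction N arbitrary: K s \<rho> \<rho>')
  case (Suc N)
  let ?g = "\<lambda>(K, s, \<rho> :: qop). (K, s)"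
  have "map ?g (concat (map (ev N) xs)) = map ?g (concat (map (ev N) ys))"
    if "map ?g xs = map ?g ys" for xs ys
    using that
  proof (induction xs arbitrary: ys)
    case (Cons x xs)
    then obtain y ys' where ys: "ys = y # ys'" "?g x = ?g y" "map ?g xs = map ?g ys'"
      by (cases ys) auto
    obtain K s \<rho>1 \<rho>2 where "x = (K, s, \<rho>1)" "y = (K, s, \<rho>2)"
      using ys(2) by (cases x; cases y) auto
    then show ?case
      using Cons.IH[OF ys(3)] ys(1) Suc[of K s \<rho>1 \<rho>2] by simp
  qed simp
  from this[OF step_fst_snd_indep[of K s \<rho> \<rho>']] show ?case by simp
qed simp

lemma halted_indep:
  assumes "halted (ev N (K, s, \<rho>))"
  shows "halted (ev N (K, s, \<rho>'))"
proof -
  have *: "halted cfgs \<longleftrightarrow> (\<forall>x\<in>set (map (\<lambda>(K, s, \<rho>). (K, s)) cfgs). fst x = [])" for cfgs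
    by (auto simp: halted_def)
  show ?thesis
    using assms unfolding * ev_fst_snd_indep[of N K s \<rho> \<rho>'] .
qed

lemma exec_halts_within: "exec c s \<rho> N L \<Longrightarrow> halts_within N c s"
  unfolding halts_within_def run_eq_ev using execs_halted halted_indep by blast

text \<open>This removes the \<open>LEAST\<close> from \<open>branches\<close>: every halting time
  gives the same list, because halted branches stay put.\<close>

lemma exec_branches_eq:
  assumes "exec c s \<rho> N L"
  shows "branches c s \<rho> = L"
proof -
  define T where "T = (LEAST T. halts_within T c s)"
  have "halts_within T c s"
    unfolding T_def using exec_halts_within[OF assms] by (rule LeastI)
  then have "halted (ev T ([c], s, \<rho>))"
    unfolding halts_within_def run_eq_ev by (rule halted_indep)
  then have "exec c s \<rho> T (map snd (ev T ([c], s, \<rho>)))"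
    by (rule halted_execs)
  then show ?thesis
    using execs_unique[OF assms] by (simp add: branches_def T_def run_eq_ev)
qed

lemma halts_within_exec:
  assumes "halts_within N c s"
  shows "exec c s \<rho> N (branches c s \<rho>)"
proof -
  have "halted (ev N ([c], s, \<rho>))"
    using assms unfolding halts_within_def run_eq_ev by (rule halted_indep)
  then have "exec c s \<rho> N (map snd (ev N ([c], s, \<rho>)))"
    by (rule halted_execs)
  then show ?thesis using exec_branches_eq by metis
qed

lemma execs_Nil [simp]: "execs [] s \<rho> N [(s, \<rho>)]"
  by (simp add: execs_def)

lemma execs_step1:
  assumes "step (K, s, \<rho>) = [(K', s', \<rho>')]" and "execs K' s' \<rho>' N L"
  shows "execs K s \<rho> (Suc N) L"
  using assms by (simp add: execs_def)

lemma step_append: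
  "K \<noteq> [] \<Longrightarrow> step (K @ K', s, \<rho>) = map (\<lambda>(K1, s1, \<rho>1). (K1 @ K', s1, \<rho>1)) (step (K, s, \<rho>))"
proof (cases K)
  case (Cons c K1)
  then show ?thesis by (cases c) auto
qed auto

text \<open>A step looks only at the top of the control stack, so \<open>K'\<close> waits untouched
  below \<open>K\<close>. The function \<open>f\<close> gives the outcomes of \<open>K'\<close> on
  each final branch of \<open>K\<close>, and \<open>N'\<close> is a common time bound for all of
  them.\<close>

lemma execs_append:
  assumes "execs K s \<rho> N L"
    and "\<And>s' \<rho>'. (s', \<rho>') \<in> set L \<Longrightarrow> execs K' s' \<rho>' N' (f (s', \<rho>'))"
  shows "execs (K @ K') s \<rho> (N + N') (concat (map f L))"
  using assms
proof (induction N arbitrary: K s \<rho> L)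
  case 0
  then show ?case by (cases L) (auto simp: execs_def)
next
  case (Suc N)
  show ?case
  proof (cases "K = []")
    case True
    then have L: "L = [(s, \<rho>)]"
      using Suc.prems(1) by (auto simp: execs_def map_eq_Cons_conv)
    then have "execs K' s \<rho> (Suc N + N') (f (s, \<rho>))"
      by (intro execs_mono[OF Suc.prems(2)]) auto
    then show ?thesis using True L by simp
  next
    case False
    have L: "concat (map (ev N) (step (K, s, \<rho>))) = map (Pair []) L"
      using Suc.prems(1) by (simp add: execs_def)
    have "concat (map (ev (N + N')) (map (\<lambda>(K1, s1, \<rho>1). (K1 @ K', s1, \<rho>1)) xs))
        = map (Pair []) (concat (map f L))"
      if "concat (map (ev N) xs) = map (Pair []) L"
        "\<And>s' \<rho>'. (s', \<rho>') \<in> set L \<Longrightarrow> execs K' s' \<rho>' N' (f (s', \<rho>'))" for xs L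
      using that
    proof (induction xs arbitrary: L)
      case (Cons x xs)
      obtain K1 s1 \<rho>1 where x: "x = (K1, s1, \<rho>1)" by (cases x) auto
      obtain La Lb where Lab: "L = La @ Lb" "ev N x = map (Pair []) La"
        "concat (map (ev N) xs) = map (Pair []) Lb"
        using Cons.prems(1) by (auto simp: append_eq_map_conv)
      have "execs (K1 @ K') s1 \<rho>1 (N + N') (concat (map f La))"
        using Lab Cons.prems(2) x by (intro Suc.IH) (auto simp: execs_def)
      then show ?case
        using Cons.IH[of Lb] Lab Cons.prems x by (auto simp: execs_def)
    qed simp
    from this[OF L Suc.prems(2)] show ?thesis
      using False by (simp add: execs_def step_append)
  qed
qed

lemma exec_Seq:
  assumes "exec c s \<rho> N1 L"
    and "\<And>s' \<rho>'. (s', \<rho>') \<in> set L \<Longrightarrow> exec d s' \<rho>' N2 (f (s', \<rho>'))"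
  shows "exec (Seq c d) s \<rho> (Suc (N1 + N2)) (concat (map f L))"
  using execs_append[OF assms] by (auto intro!: execs_step1)

lemma exec_Seq_det:
  assumes "exec c s \<rho> N1 [(s1, \<rho>1)]" and "exec d s1 \<rho>1 N2 L"
  shows "exec (Seq c d) s \<rho> (Suc (N1 + N2)) L"
  using exec_Seq[OF assms(1), of d N2 "\<lambda>_. L"] assms(2) by simp

lemma exec_Skip: "exec Skip s \<rho> 1 [(s, \<rho>)]"
  by (simp add: execs_def)

lemma exec_Push: "exec (Push r b) s \<rho> 1 [(s(r := b # s r), \<rho>)]"
  by (simp add: execs_def)

lemma exec_Pop: "exec (Pop r) s \<rho> 1 [(s(r := tl (s r)), \<rho>)]"
  by (simp add: execs_def)

lemma exec_Apply:
  "exec (Apply g) s \<rho> 1 [(s, gate_op (map_gate (\<lambda>r. length (s r)) g) \<rho>)]"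
  by (simp add: execs_def)

lemma exec_Meas:
  "exec (Meas q r) s \<rho> 1
     [(s(r := b # s r), project_qubit (length (s q)) b \<rho>). b \<leftarrow> [False, True]]"
  by (simp add: execs_def)

lemma exec_IfTop:
  "exec (if top_bit (s r) then c else d) s \<rho> N L \<Longrightarrow> exec (IfTop r c d) s \<rho> (Suc N) L"
  by (rule execs_step1) auto

lemma exec_IfEmpty:
  "exec (if s r = [] then c else d) s \<rho> N L \<Longrightarrow> exec (IfEmpty r c d) s \<rho> (Suc N) L"
  by (rule execs_step1) auto

lemma exec_While_done: "s r = [] \<Longrightarrow> exec (While r c) s \<rho> 1 [(s, \<rho>)]"
  by (simp add: execs_def)

lemma exec_While_step:
  assumes "s r \<noteq> []" and "exec c s \<rho> N1 L"
    and "\<And>s' \<rho>'. (s', \<rho>') \<in> set L \<Longrightarrow> exec (While r c) s' \<rho>' N2 (f (s', \<rho>'))"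
  shows "exec (While r c) s \<rho> (Suc (N1 + N2)) (concat (map f L))"
  using execs_append[OF assms(2,3)] assms(1) by (auto intro!: execs_step1)

lemma exec_While_step_det:
  assumes "s r \<noteq> []" and "exec c s \<rho> N1 [(s1, \<rho>1)]" and "exec (While r c) s1 \<rho>1 N2 L"
  shows "exec (While r c) s \<rho> (Suc (N1 + N2)) L"
  using exec_While_step[OF assms(1,2), of N2 "\<lambda>_. L"] assms(3) by simp


section \<open>Registers\<close>

primrec regs_below :: "nat \<Rightarrow> com \<Rightarrow> bool" where
  "regs_below H Skip \<longleftrightarrow> True"
| "regs_below H (Push r b) \<longleftrightarrow> r < H"
| "regs_below H (Pop r) \<longleftrightarrow> r < H"
| "regs_below H (Seq c d) \<longleftrightarrow> regs_below H c \<and> regs_below H d"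
| "regs_below H (IfTop r c d) \<longleftrightarrow> r < H \<and> regs_below H c \<and> regs_below H d"
| "regs_below H (IfEmpty r c d) \<longleftrightarrow> r < H \<and> regs_below H c \<and> regs_below H d"
| "regs_below H (While r c) \<longleftrightarrow> r < H \<and> regs_below H c"
| "regs_below H (Flip r) \<longleftrightarrow> r < H"
| "regs_below H (Apply g) \<longleftrightarrow> (\<forall>r\<in>set_gate g. r < H)"
| "regs_below H (Meas q r) \<longleftrightarrow> q < H \<and> r < H"

lemma regs_below_mono: "regs_below H c \<Longrightarrow> H \<le> H' \<Longrightarrow> regs_below H' c"
  by (induction c) auto

text \<open>Stated with \<open>eventually\<close> so that the bounds of subprograms combine by
  conjunction instead of by explicit maxima.\<close>

lemma eventually_regs_below: "eventually (\<lambda>H. regs_below H c) sequentially"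
proof (induction c)
  case (Apply g)
  then show ?case by (cases g) (auto intro: eventually_conj eventually_gt_at_top)
qed (auto intro: eventually_conj eventually_gt_at_top)

lemma ex_regs_below: "\<exists>H. regs_below H c"
  using eventually_regs_below[of c] by (auto simp: eventually_sequentially)

definition overlay :: "nat \<Rightarrow> store \<Rightarrow> store \<Rightarrow> store" where
  "overlay H s s' = (\<lambda>r. if r < H then s r else s' r)"

lemma step_overlay:
  assumes "\<forall>c\<in>set K. regs_below H c"
  shows "step (K, overlay H s s', \<rho>) = map (\<lambda>(K, t, \<rho>). (K, overlay H t s', \<rho>)) (step (K, s, \<rho>))"
proof (cases K)
  case (Cons c K')
  show ?thesis
  proof (cases c)
    case (Apply g)
    then have "map_gate (\<lambda>r. length (overlay H s s' r)) g = map_gate (\<lambda>r. length (s r)) g"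
      using assms Cons by (intro gate.map_cong) (auto simp: overlay_def)
    then show ?thesis using Apply Cons by simp
  qed (use assms Cons in \<open>auto simp: overlay_def fun_eq_iff\<close>)
qed simp

lemma step_regs_below:
  assumes "\<forall>c\<in>set K. regs_below H c" "(K', s', \<rho>') \<in> set (step (K, s, \<rho>))"
  shows "\<forall>c\<in>set K'. regs_below H c"
proof (cases K)
  case (Cons c K1)
  then show ?thesis using assms by (cases c) (auto split: if_splits)
qed (use assms in auto)

text \<open>A program with registers below \<open>H\<close> neither reads nor changes those from
  \<open>H\<close> on. So the generator and the adversary can run as black boxes inside larger
  programs that keep their own data above.\<close>

lemma ev_overlay:
  assumes "\<forall>c\<in>set K. regs_below H c"
  shows "ev N (K, overlay H s s', \<rho>) = map (\<lambda>(K, t, \<rho>). (K, overlay H t s', \<rho>)) (ev N (K, s, \<rho>))"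
  using assms
proof (induction N arbitrary: K s \<rho>)
  case (Suc N)
  have "map (ev N) (step (K, overlay H s s', \<rho>))
      = map (map (\<lambda>(K, t, \<rho>). (K, overlay H t s', \<rho>)) \<circ> ev N) (step (K, s, \<rho>))"
    unfolding step_overlay[OF Suc.prems] map_map
    by (rule map_cong[OF refl]) (auto simp: Suc.IH step_regs_below[OF Suc.prems])
  then show ?case by (simp add: map_concat comp_def)
qed simp

lemma exec_overlay:
  assumes "exec c s \<rho> N L" "regs_below H c"
  shows "exec c (overlay H s s') \<rho> N (map (\<lambda>(t, \<rho>). (overlay H t s', \<rho>)) L)"
  using assms ev_overlay[of "[c]" H N s s' \<rho>] by (auto simp: execs_def)

lemma step_length:
  assumes "\<And>r. length (s r) \<le> B" "(K', s', \<rho>') \<in> set (step (K, s, \<rho>))"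
  shows "length (s' r) \<le> Suc B"
proof (cases K)
  case Nil
  then show ?thesis using assms by (auto simp: le_SucI)
next
  case (Cons c K1)
  have "length (tl (s r)) \<le> Suc B" for r
    using assms(1)[of r] by auto
  then show ?thesis
    using assms Cons by (cases c) (auto simp: le_SucI split: if_splits)
qed

text \<open>A step pushes at most one bit. As qubits are addressed by register lengths, this bounds
  both the classical output and the reachable qubits in terms of the running time.\<close>

lemma ev_length:
  assumes "\<And>r. length (s r) \<le> B" "(K', s', \<rho>') \<in> set (ev N (K, s, \<rho>))"
  shows "length (s' r) \<le> B + N"
  using assms
proof (induction N arbitrary: B K s \<rho>)
  case 0
  then show ?case by simp
next
  case (Suc N)
  then obtain K1 s1 \<rho>1 where 1: "(K1, s1, \<rho>1) \<in> set (step (K, s, \<rho>))"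
    "(K', s', \<rho>') \<in> set (ev N (K1, s1, \<rho>1))"
    by auto
  then show ?case
    using Suc.IH[OF step_length[OF Suc.prems(1) 1(1)] 1(2)] by simp
qed

lemma exec_length:
  fixes r :: nat
  assumes "exec c s \<rho> N L" "\<And>r. length (s r) \<le> B" "(s', \<rho>') \<in> set L"
  shows "length (s' r) \<le> B + N"
proof -
  have "([], s', \<rho>') \<in> set (ev N ([c], s, \<rho>))"
    using assms(1,3) by (auto simp: execs_def)
  with assms(2) show ?thesis by (rule ev_length)
qed

lemma step_classical:
  assumes "\<forall>c\<in>set K. quantum_free c \<and> coin_free c"
  shows "\<exists>K' s'. (\<forall>\<rho>. step (K, s, \<rho>) = [(K', s', \<rho>)]) \<and> (\<forall>c\<in>set K'. quantum_free c \<and> coin_free c)"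
proof (cases K)
  case (Cons c K1)
  then show ?thesis using assms by (cases c) auto
qed auto

lemma ev_classical:
  assumes "\<forall>c\<in>set K. quantum_free c \<and> coin_free c"
  shows "\<exists>K' s'. \<forall>\<rho>. ev N (K, s, \<rho>) = [(K', s', \<rho>)]"
  using assms
proof (induction N arbitrary: K s)
  case (Suc N)
  obtain K' s' where 1: "\<And>\<rho>. step (K, s, \<rho>) = [(K', s', \<rho>)]"
    "\<forall>c\<in>set K'. quantum_free c \<and> coin_free c"
    using step_classical[OF Suc.prems] by blast
  then show ?case using Suc.IH[OF 1(2)] by simp
qed simp

text \<open>Without coins and quantum instructions each step has a single successor and leaves the
  quantum state alone, so one final store serves for all \<open>\<rho>\<close>.\<close>

lemma exec_classical:
  assumes "quantum_free c" "coin_free c" "halts_within N c s"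
  obtains s' where "\<And>\<rho>. exec c s \<rho> N [(s', \<rho>)]"
proof -
  obtain K' s' where 1: "\<And>\<rho>. ev N ([c], s, \<rho>) = [(K', s', \<rho>)]"
    using ev_classical[of "[c]" N s] assms by auto
  then have "K' = []"
    using assms(3) by (simp add: halts_within_def halted_def run_eq_ev)
  with 1 show ?thesis by (intro that[of s']) (auto simp: execs_def)
qed


section \<open>Polynomial bounds\<close>

text \<open>The polynomial stays hidden under the quantifier: bounds over a family \<open>I\<close>
  of inputs of size \<open>sz\<close> follow from closure rules, and no polynomial is ever
  computed.\<close>

definition pbd :: "'i set \<Rightarrow> ('i \<Rightarrow> nat) \<Rightarrow> ('i \<Rightarrow> nat) \<Rightarrow> bool" where
  "pbd I sz f \<longleftrightarrow> (\<exists>p :: nat poly. \<forall>i\<in>I. f i \<le> poly p (sz i))"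

lemma poly_nat_mono: "x \<le> y \<Longrightarrow> poly (p :: nat poly) x \<le> poly p y"
  by (induction p) (auto intro!: add_mono mult_mono)

lemma pbdI: "(\<And>i. i \<in> I \<Longrightarrow> f i \<le> poly p (sz i)) \<Longrightarrow> pbd I sz f"
  unfolding pbd_def by blast

lemma pbd_const: "pbd I sz (\<lambda>_. c)"
  by (rule pbdI[of _ _ "[:c:]"]) simp

lemma pbd_sz: "pbd I sz sz"
  by (rule pbdI[of _ _ "[:0, 1:]"]) simp

lemma pbd_le: "pbd I sz g \<Longrightarrow> (\<And>i. i \<in> I \<Longrightarrow> f i \<le> g i) \<Longrightarrow> pbd I sz f"
  unfolding pbd_def by (meson order_trans)

lemma pbd_add:
  assumes "pbd I sz f" "pbd I sz g"
  shows "pbd I sz (\<lambda>i. f i + g i)"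
proof -
  obtain p q where "\<forall>i\<in>I. f i \<le> poly p (sz i)" "\<forall>i\<in>I. g i \<le> poly q (sz i)"
    using assms unfolding pbd_def by blast
  then show ?thesis by (intro pbdI[of _ _ "p + q"]) (auto intro: add_mono)
qed

lemma pbd_mult:
  assumes "pbd I sz f" "pbd I sz g"
  shows "pbd I sz (\<lambda>i. f i * g i)"
proof -
  obtain p q where "\<forall>i\<in>I. f i \<le> poly p (sz i)" "\<forall>i\<in>I. g i \<le> poly q (sz i)"
    using assms unfolding pbd_def by blast
  then show ?thesis by (intro pbdI[of _ _ "p * q"]) (auto intro: mult_mono)
qed

lemma pbd_Suc: "pbd I sz f \<Longrightarrow> pbd I sz (\<lambda>i. Suc (f i))"
  using pbd_add[OF _ pbd_const, of I sz f 1] by simp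

lemma pbd_poly:
  assumes "pbd I sz f"
  shows "pbd I sz (\<lambda>i. poly p (f i))"
proof -
  obtain q where "\<forall>i\<in>I. f i \<le> poly q (sz i)"
    using assms unfolding pbd_def by blast
  then show ?thesis
    by (intro pbdI[of _ _ "pcompose p q"]) (auto simp: poly_pcompose intro: poly_nat_mono)
qed

lemma pbd_max: "pbd I sz f \<Longrightarrow> pbd I sz g \<Longrightarrow> pbd I sz (\<lambda>i. max (f i) (g i))"
  by (rule pbd_le[OF pbd_add[of I sz f g]]) auto

lemma pbd_if: "pbd I sz f \<Longrightarrow> pbd I sz g \<Longrightarrow> pbd I sz (\<lambda>i. if P i then f i else g i)"
  by (rule pbd_le[OF pbd_add[of I sz f g]]) auto

lemma pbd_trans:
  assumes "pbd I f g" "pbd I sz f"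
  shows "pbd I sz g"
proof -
  obtain p where "\<forall>i\<in>I. g i \<le> poly p (f i)"
    using assms(1) unfolding pbd_def by blast
  then show ?thesis by (intro pbd_le[OF pbd_poly[OF assms(2), of p]]) auto
qed

lemma pbd_reindex: "pbd I sz f \<Longrightarrow> h ` J \<subseteq> I \<Longrightarrow> pbd J (\<lambda>j. sz (h j)) (\<lambda>j. f (h j))"
  unfolding pbd_def by blast

lemmas pbd_intros = pbd_const pbd_sz pbd_add pbd_mult pbd_Suc pbd_poly pbd_max pbd_if

text \<open>One judgement tracks the result and the polynomial running time over a whole family of
  inputs, so a chain of such facts for the parts of a program gives both for the whole.\<close>

definition pexec ::
  "'i set \<Rightarrow> ('i \<Rightarrow> nat) \<Rightarrow> com \<Rightarrow> ('i \<Rightarrow> store) \<Rightarrow> ('i \<Rightarrow> qop) \<Rightarrow> ('i \<Rightarrow> (store \<times> qop) list) \<Rightarrow> bool"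
  where "pexec I sz c s \<rho> L \<longleftrightarrow> (\<exists>N. pbd I sz N \<and> (\<forall>i\<in>I. exec c (s i) (\<rho> i) (N i) (L i)))"

lemma pexecI:
  "(\<And>i. i \<in> I \<Longrightarrow> exec c (s i) (\<rho> i) (N i) (L i)) \<Longrightarrow> pbd I sz N \<Longrightarrow> pexec I sz c s \<rho> L"
  unfolding pexec_def by blast

lemma pexec_branches: "pexec I sz c s \<rho> L \<Longrightarrow> i \<in> I \<Longrightarrow> branches c (s i) (\<rho> i) = L i"
  unfolding pexec_def using exec_branches_eq by blast

lemma pexec_poly_time:
  assumes "pexec I (\<lambda>i. \<Sum>x\<leftarrow>xs i. length x) c (\<lambda>i. input (xs i)) \<rho> L" "X = xs ` I"
  shows "poly_time c X"
proof -
  obtain N p where N: "\<forall>i\<in>I. exec c (input (xs i)) (\<rho> i) (N i) (L i)"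
    "\<forall>i\<in>I. N i \<le> poly p (\<Sum>x\<leftarrow>xs i. length x)"
    using assms(1) unfolding pexec_def pbd_def by blast
  have "halts_within (poly p (\<Sum>x\<leftarrow>xs i. length x)) c (input (xs i))" if "i \<in> I" for i
    using N that execs_mono exec_halts_within by blast
  then show ?thesis unfolding poly_time_def assms(2) by blast
qed

lemma pexec_Seq_det:
  assumes "pexec I sz c s \<rho> (\<lambda>i. [(s1 i, \<rho>1 i)])" and "pexec I sz d s1 \<rho>1 L"
  shows "pexec I sz (Seq c d) s \<rho> L"
proof -
  obtain N1 where "pbd I sz N1" "\<And>i. i \<in> I \<Longrightarrow> exec c (s i) (\<rho> i) (N1 i) [(s1 i, \<rho>1 i)]"
    using assms(1) unfolding pexec_def by blast
  moreover obtain N2 where "pbd I sz N2" "\<And>i. i \<in> I \<Longrightarrow> exec d (s1 i) (\<rho>1 i) (N2 i) (L i)"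
    using assms(2) unfolding pexec_def by blast
  ultimately show ?thesis
    by (intro pexecI[where N = "\<lambda>i. Suc (N1 i + N2 i)"] exec_Seq_det pbd_Suc pbd_add)
qed

definition accepts :: "com \<Rightarrow> store \<Rightarrow> qop \<Rightarrow> nat \<Rightarrow> real \<Rightarrow> bool" where
  "accepts c s \<rho> N p \<longleftrightarrow>
     (\<exists>L. exec c s \<rho> N L \<and> (\<Sum>(s', \<rho>')\<leftarrow>L. if top_bit (s' 0) then Re (qtrace \<rho>') else 0) = p)"

definition paccepts ::
  "'i set \<Rightarrow> ('i \<Rightarrow> nat) \<Rightarrow> com \<Rightarrow> ('i \<Rightarrow> store) \<Rightarrow> ('i \<Rightarrow> qop) \<Rightarrow> ('i \<Rightarrow> real) \<Rightarrow> bool" where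
  "paccepts I sz c s \<rho> p \<longleftrightarrow> (\<exists>N. pbd I sz N \<and> (\<forall>i\<in>I. accepts c (s i) (\<rho> i) (N i) (p i)))"

lemma acceptsD: "accepts c (input xs) \<rho> N p \<Longrightarrow> accept_prob c xs \<rho> = p"
  unfolding accepts_def accept_prob_def using exec_branches_eq by blast

lemma accepts_mono: "accepts c s \<rho> N p \<Longrightarrow> N \<le> N' \<Longrightarrow> accepts c s \<rho> N' p"
  unfolding accepts_def using execs_mono by blast

text \<open>The law of total probability: branch states are not normalised, so the acceptance
  weights of \<open>d\<close> on the branches left by \<open>c\<close> just add up. Writing these
  branches as \<open>map h M\<close> lets \<open>f\<close> speak of the plain branches of a black
  box even when it runs under an overlay.\<close>

lemma accepts_Seq:
  assumes "exec c s \<rho> N1 (map h M)"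
    and "\<And>x. x \<in> set M \<Longrightarrow> accepts d (fst (h x)) (snd (h x)) N2 (f x)"
  shows "accepts (Seq c d) s \<rho> (Suc (N1 + N2)) (\<Sum>x\<leftarrow>M. f x)"
proof -
  let ?w = "\<lambda>L. \<Sum>(s', \<rho>')\<leftarrow>L. if top_bit (s' 0) then Re (qtrace \<rho>') else 0"
  let ?g = "\<lambda>(s', \<rho>'). branches d s' \<rho>'"
  have d: "exec d (fst (h x)) (snd (h x)) N2 (?g (h x)) \<and> ?w (?g (h x)) = f x" if "x \<in> set M" for x
    using assms(2)[OF that] exec_branches_eq unfolding accepts_def by (auto simp: case_prod_unfold)
  have "exec (Seq c d) s \<rho> (Suc (N1 + N2)) (concat (map ?g (map h M)))"
  proof (rule exec_Seq[OF assms(1)])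
    fix s' \<rho>' assume "(s', \<rho>') \<in> set (map h M)"
    then obtain x where "x \<in> set M" "h x = (s', \<rho>')" by auto
    then show "exec d s' \<rho>' N2 (?g (s', \<rho>'))" using d[of x] by simp
  qed
  moreover have "?w (concat (map ?g (map h M))) = (\<Sum>x\<leftarrow>M. ?w (?g (h x)))"
    by (induction M) auto
  moreover have "(\<Sum>x\<leftarrow>M. ?w (?g (h x))) = (\<Sum>x\<leftarrow>M. f x)"
    using d by (intro arg_cong[where f = sum_list] map_cong) auto
  ultimately show ?thesis unfolding accepts_def by metis
qed

text \<open>The second program runs on a larger family, indexed by an input together with a branch;
  the size of such a pair is that of the input.\<close>

lemma paccepts_Seq:
  assumes "pexec I sz c s \<rho> (\<lambda>i. map (h i) (M i))"
    and "paccepts {(i, x). i \<in> I \<and> x \<in> set (M i)} (\<lambda>j. sz (fst j)) d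
           (\<lambda>j. fst (h (fst j) (snd j))) (\<lambda>j. snd (h (fst j) (snd j))) f"
  shows "paccepts I sz (Seq c d) s \<rho> (\<lambda>i. \<Sum>x\<leftarrow>M i. f (i, x))"
proof -
  obtain N1 where N1: "pbd I sz N1" "\<And>i. i \<in> I \<Longrightarrow> exec c (s i) (\<rho> i) (N1 i) (map (h i) (M i))"
    using assms(1) unfolding pexec_def by blast
  let ?J = "{(i, x). i \<in> I \<and> x \<in> set (M i)}"
  obtain N2 where N2: "pbd ?J (\<lambda>j. sz (fst j)) N2"
    "\<forall>j\<in>?J. accepts d (fst (h (fst j) (snd j))) (snd (h (fst j) (snd j))) (N2 j) (f j)"
    using assms(2) unfolding paccepts_def by blast
  \<comment> \<open>The bounds \<open>N2\<close> may differ between the branches of one input. A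
    polynomial evaluated at the size of the input gives a single bound for all of them.\<close>
  obtain p where p: "\<forall>j\<in>?J. N2 j \<le> poly p (sz (fst j))"
    using N2(1) unfolding pbd_def by blast
  have d: "accepts d (fst (h i x)) (snd (h i x)) (poly p (sz i)) (f (i, x))" if "i \<in> I" "x \<in> set (M i)" for i x
  proof (rule accepts_mono)
    have "(i, x) \<in> ?J" using that by simp
    then show "accepts d (fst (h i x)) (snd (h i x)) (N2 (i, x)) (f (i, x))" "N2 (i, x) \<le> poly p (sz i)"
      using N2(2) p by (fastforce dest: bspec)+
  qed
  have "accepts (Seq c d) (s i) (\<rho> i) (Suc (N1 i + poly p (sz i))) (\<Sum>x\<leftarrow>M i. f (i, x))" if "i \<in> I" for i
    by (rule accepts_Seq[OF N1(2)[OF that] d[OF that]])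
  moreover have "pbd I sz (\<lambda>i. Suc (N1 i + poly p (sz i)))"
    by (intro pbd_intros N1(1))
  ultimately show ?thesis unfolding paccepts_def by blast
qed

lemma paccepts_Seq_det:
  assumes "pexec I sz c s \<rho> (\<lambda>i. [(s1 i, \<rho>1 i)])" and "paccepts I sz d s1 \<rho>1 p"
  shows "paccepts I sz (Seq c d) s \<rho> p"
proof -
  obtain N1 where N1: "pbd I sz N1" "\<And>i. i \<in> I \<Longrightarrow> exec c (s i) (\<rho> i) (N1 i) [(s1 i, \<rho>1 i)]"
    using assms(1) unfolding pexec_def by blast
  obtain N2 where N2: "pbd I sz N2" "\<And>i. i \<in> I \<Longrightarrow> accepts d (s1 i) (\<rho>1 i) (N2 i) (p i)"
    using assms(2) unfolding paccepts_def by blast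
  have "accepts (Seq c d) (s i) (\<rho> i) (Suc (N1 i + N2 i)) (p i)" if "i \<in> I" for i
    using accepts_Seq[of c "s i" "\<rho> i" "N1 i" id "[(s1 i, \<rho>1 i)]" d "N2 i" "\<lambda>_. p i"]
      N1(2)[OF that] N2(2)[OF that] by simp
  moreover have "pbd I sz (\<lambda>i. Suc (N1 i + N2 i))"
    by (intro pbd_intros N1(1) N2(1))
  ultimately show ?thesis unfolding paccepts_def by blast
qed

lemma paccepts_poly_time:
  assumes "paccepts I (\<lambda>i. \<Sum>x\<leftarrow>xs i. length x) c (\<lambda>i. input (xs i)) \<rho> p" "X = xs ` I"
  shows "poly_time c X"
proof -
  obtain N where "pbd I (\<lambda>i. \<Sum>x\<leftarrow>xs i. length x) N"
    "\<forall>i\<in>I. \<exists>L. exec c (input (xs i)) (\<rho> i) (N i) L"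
    using assms(1) unfolding paccepts_def accepts_def by blast
  then have "pexec I (\<lambda>i. \<Sum>x\<leftarrow>xs i. length x) c (\<lambda>i. input (xs i)) \<rho>
      (\<lambda>i. branches c (input (xs i)) (\<rho> i))"
    using exec_branches_eq by (intro pexecI) blast+
  then show ?thesis using assms(2) by (rule pexec_poly_time)
qed

lemma paccepts_cong:
  assumes "paccepts I sz c s \<rho> p" "\<And>i. i \<in> I \<Longrightarrow> s i = s' i" "\<And>i. i \<in> I \<Longrightarrow> p i = p' i"
  shows "paccepts I sz c s' \<rho> p'"
  using assms unfolding paccepts_def by metis

lemma paccepts_accept_prob:
  "paccepts I sz c (\<lambda>i. input (xs i)) \<rho> p \<Longrightarrow> i \<in> I \<Longrightarrow> accept_prob c (xs i) (\<rho> i) = p i"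
  unfolding paccepts_def using acceptsD by blast

section \<open>Vectors, tensor products and gates\<close>

definition supp :: "nat \<Rightarrow> qvec \<Rightarrow> bool" where
  "supp d v \<longleftrightarrow> (\<forall>x\<ge>2 ^ d. v x = 0)"

text \<open>The squared norm, phrased as a trace because acceptance probabilities are traces of
  branch states.\<close>

definition nsq :: "qvec \<Rightarrow> real" where
  "nsq v = Re (qtrace (proj v))"

definition tensorv :: "nat \<Rightarrow> qvec \<Rightarrow> qvec \<Rightarrow> qvec" where
  "tensorv m v w x = v (x mod 2 ^ m) * w (x div 2 ^ m)"

primrec copiesv :: "nat \<Rightarrow> nat \<Rightarrow> qvec \<Rightarrow> qvec" where
  "copiesv m 0 v = ket_zero"
| "copiesv m (Suc t) v = tensorv m v (copiesv m t v)"

lemma supp_mono: "supp d v \<Longrightarrow> d \<le> e \<Longrightarrow> supp e v"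
  unfolding supp_def by (meson order_trans power_increasing one_le_numeral)

lemma nsq_eq_sum:
  assumes "supp d v"
  shows "nsq v = (\<Sum>x<2 ^ d. (cmod (v x))\<^sup>2)"
proof -
  have "{x. proj v x x \<noteq> 0} = {x. v x \<noteq> 0}" by (auto simp: proj_def)
  moreover have "{x. v x \<noteq> 0} \<subseteq> {..<2 ^ d}"
    using assms by (force simp: supp_def not_le[symmetric])
  ultimately have "qtrace (proj v) = (\<Sum>x<2 ^ d. proj v x x)"
    unfolding qtrace_def by (intro sum.mono_neutral_left) (auto simp: proj_def)
  then show ?thesis
    unfolding nsq_def by (simp add: proj_def complex_mult_cnj cmod_def)
qed

lemma nsq_nonneg: "supp d v \<Longrightarrow> 0 \<le> nsq v"
  by (simp add: nsq_eq_sum sum_nonneg)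

lemma pure_state_iff: "pure_state m \<psi> \<longleftrightarrow> supp m \<psi> \<and> nsq \<psi> = 1"
  unfolding pure_state_def using nsq_eq_sum by (auto simp: supp_def)

lemma supp_ket_zero: "supp d ket_zero"
  by (auto simp: supp_def ket_zero_def)

lemma nsq_ket_zero: "nsq ket_zero = 1"
  using nsq_eq_sum[OF supp_ket_zero[of 0]] by (simp add: ket_zero_def)

lemma proj_tensorv: "proj (tensorv m v w) = tensor m (proj v) (proj w)"
  by (auto simp: fun_eq_iff proj_def tensorv_def tensor_def)

lemma copies_proj: "copies m t (proj v) = proj (copiesv m t v)"
  by (induction t) (simp_all add: proj_tensorv)

lemma supp_tensorv: "supp e w \<Longrightarrow> supp (d + e) (tensorv d v w)"
  unfolding supp_def tensorv_def by (auto simp: power_add less_eq_div_iff_mult_less_eq mult.commute)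

lemma supp_copiesv: "supp (m * t) (copiesv m t v)"
  by (induction t) (auto simp: supp_ket_zero supp_tensorv)

lemma sum_mod_div:
  fixes f :: "nat \<Rightarrow> nat \<Rightarrow> 'a :: comm_monoid_add"
  assumes "0 < a"
  shows "(\<Sum>x<a * b. f (x mod a) (x div a)) = (\<Sum>y<a. \<Sum>z<b. f y z)"
proof -
  have "(\<Sum>x<a * b. f (x mod a) (x div a)) = (\<Sum>(y, z)\<in>{..<a} \<times> {..<b}. f y z)"
  proof (rule sum.reindex_bij_witness[where i = "\<lambda>(y, z). y + a * z" and j = "\<lambda>x. (x mod a, x div a)"])
    fix p assume p: "p \<in> {..<a} \<times> {..<b}"
    have "y + a * z < a * b" if "y < a" "z < b" for y z
    proof -
      have "y + a * z < a * Suc z" using that by simp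
      also have "\<dots> \<le> a * b" using that by (intro mult_le_mono2) simp
      finally show ?thesis .
    qed
    with p show "(case p of (y, z) \<Rightarrow> y + a * z) \<in> {..<a * b}" by auto
  qed (use assms in \<open>auto simp: less_mult_imp_div_less mult.commute\<close>)
  then show ?thesis by (simp add: sum.cartesian_product)
qed

lemma nsq_tensorv:
  assumes "supp d v" "supp e w"
  shows "nsq (tensorv d v w) = nsq v * nsq w"
proof -
  have "nsq (tensorv d v w) = (\<Sum>x<2 ^ d * 2 ^ e. (cmod (v (x mod 2 ^ d)))\<^sup>2 * (cmod (w (x div 2 ^ d)))\<^sup>2)"
    using nsq_eq_sum[OF supp_tensorv[OF assms(2)]]
    by (simp add: tensorv_def norm_mult power_mult_distrib power_add)
  also have "\<dots> = nsq v * nsq w"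
    by (subst sum_mod_div) (simp_all add: nsq_eq_sum[OF assms(1)] nsq_eq_sum[OF assms(2)] sum_product)
  finally show ?thesis .
qed

lemma nsq_copiesv: "supp m v \<Longrightarrow> nsq v = 1 \<Longrightarrow> nsq (copiesv m t v) = 1"
  by (induction t) (auto simp: nsq_ket_zero nsq_tensorv[OF _ supp_copiesv])

lemma tensorv_assoc: "tensorv d a (tensorv e b c) = tensorv (d + e) (tensorv d a b) c"
proof
  fix x :: nat
  have "x mod 2 ^ (d + e) mod 2 ^ d = x mod 2 ^ d"
    by (simp add: mod_mod_cancel power_add)
  moreover have "x mod 2 ^ (d + e) div 2 ^ d = (x div 2 ^ d) mod 2 ^ e"
    using drop_bit_take_bit[of d "d + e" x] by (simp add: take_bit_eq_mod drop_bit_eq_div)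
  moreover have "x div 2 ^ d div 2 ^ e = x div 2 ^ (d + e)"
    by (simp add: power_add div_mult2_eq)
  ultimately show "tensorv d a (tensorv e b c) x = tensorv (d + e) (tensorv d a b) c x"
    by (simp add: tensorv_def)
qed

lemma tensorv_ket_zero: "supp m v \<Longrightarrow> tensorv m v ket_zero = v"
  by (auto simp: fun_eq_iff tensorv_def ket_zero_def supp_def div_eq_0_iff not_less)

lemma tensor_0_ket_zero: "tensor 0 (proj ket_zero) \<tau> = \<tau>"
  by (auto simp: fun_eq_iff tensor_def proj_def ket_zero_def)

section \<open>Gates acting on a low or a high block of qubits\<close>

lemma bit_mod_low: "i < d \<Longrightarrow> bit ((x :: nat) mod 2 ^ d) i \<longleftrightarrow> bit x i"
  by (simp add: bit_take_bit_iff flip: take_bit_eq_mod)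

lemma flip_bit_mod_low: "i < d \<Longrightarrow> flip_bit i (x :: nat) mod 2 ^ d = flip_bit i (x mod 2 ^ d)"
  by (simp add: take_bit_flip_bit_eq flip: take_bit_eq_mod)

lemma flip_bit_div_low: "i < d \<Longrightarrow> flip_bit i (x :: nat) div 2 ^ d = x div 2 ^ d"
  by (rule bit_eqI) (auto simp: bit_drop_bit_eq bit_flip_bit_iff simp flip: drop_bit_eq_div)

lemma bit_div_high: "bit ((x :: nat) div 2 ^ d) i \<longleftrightarrow> bit x (d + i)"
  by (simp add: bit_drop_bit_eq flip: drop_bit_eq_div)

lemma flip_bit_mod_high: "flip_bit (d + i) (x :: nat) mod 2 ^ d = x mod 2 ^ d"
  by (simp add: take_bit_flip_bit_eq flip: take_bit_eq_mod)

lemma flip_bit_div_high: "flip_bit (d + i) (x :: nat) div 2 ^ d = flip_bit i (x div 2 ^ d)"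
  by (rule bit_eqI) (auto simp: bit_drop_bit_eq bit_flip_bit_iff simp flip: drop_bit_eq_div)

lemma flip_bit_less: "i < d \<Longrightarrow> flip_bit i (x :: nat) < 2 ^ d \<longleftrightarrow> x < 2 ^ d"
  using flip_bit_div_low[of i d x] by (metis Euclidean_Rings.div_eq_0_iff power_not_zero zero_neq_numeral)

lemma flip_bit_twice [simp]: "flip_bit i (flip_bit i (x :: nat)) = x"
  by (rule bit_eqI) (auto simp: bit_flip_bit_iff)

lemma bit_flip_bit_nat: "bit (flip_bit i (x :: nat)) k \<longleftrightarrow> (if k = i then \<not> bit x k else bit x k)"
  by (auto simp: bit_flip_bit_iff)

abbreviation addrs_below :: "nat \<Rightarrow> nat gate \<Rightarrow> bool" where
  "addrs_below d g \<equiv> \<forall>i\<in>set_gate g. i < d"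

lemma gate_on_addrs_below: "gate_on d g \<Longrightarrow> addrs_below d g"
  by (cases g) auto

text \<open>Stated for products of functions rather than for \<open>tensorv\<close>, because it is
  applied to a single column of a tensor product of arbitrary operators, which has just this
  form.\<close>

lemma gate_vec_low:
  "addrs_below d g \<Longrightarrow>
    gate_vec g (\<lambda>x. a (x mod 2 ^ d) * b (x div 2 ^ d)) x = gate_vec g a (x mod 2 ^ d) * b (x div 2 ^ d)"
  by (cases g) (auto simp: bit_mod_low flip_bit_mod_low flip_bit_div_low algebra_simps add_divide_distrib diff_divide_distrib)

lemma gate_vec_high:
  "gate_vec (map_gate ((+) d) g) (\<lambda>x. a (x mod 2 ^ d) * b (x div 2 ^ d)) x
    = a (x mod 2 ^ d) * gate_vec g b (x div 2 ^ d)"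
  by (cases g) (simp_all add: bit_div_high flip_bit_mod_high flip_bit_div_high distrib_left)

lemma gate_op_tensor_low:
  assumes "addrs_below d g"
  shows "gate_op g (tensor d \<rho> \<tau>) = tensor d (gate_op g \<rho>) \<tau>"
proof (intro ext)
  fix x y
  have 1: "gate_vec g (\<lambda>x'. tensor d \<rho> \<tau> x' y') x
      = gate_vec g (\<lambda>x'. \<rho> x' (y' mod 2 ^ d)) (x mod 2 ^ d) * \<tau> (x div 2 ^ d) (y' div 2 ^ d)" for y'
    unfolding tensor_def by (rule gate_vec_low[OF assms])
  show "gate_op g (tensor d \<rho> \<tau>) x y = tensor d (gate_op g \<rho>) \<tau> x y"
    unfolding gate_op_def 1 complex_cnj_mult
    by (subst gate_vec_low[OF assms]) (simp add: tensor_def gate_op_def)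
qed

lemma gate_op_tensor_high:
  "gate_op (map_gate ((+) d) g) (tensor d \<rho> \<tau>) = tensor d \<rho> (gate_op g \<tau>)"
proof (intro ext)
  fix x y
  have 1: "gate_vec (map_gate ((+) d) g) (\<lambda>x'. tensor d \<rho> \<tau> x' y') x
      = \<rho> (x mod 2 ^ d) (y' mod 2 ^ d) * gate_vec g (\<lambda>x'. \<tau> x' (y' div 2 ^ d)) (x div 2 ^ d)" for y'
    unfolding tensor_def by (rule gate_vec_high)
  show "gate_op (map_gate ((+) d) g) (tensor d \<rho> \<tau>) x y = tensor d \<rho> (gate_op g \<tau>) x y"
    unfolding gate_op_def 1 complex_cnj_mult
    by (subst gate_vec_high) (simp add: tensor_def gate_op_def)
qed

lemma fold_gate_op_tensor_low:
  "\<forall>g\<in>set gs. addrs_below d g \<Longrightarrow>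
    fold gate_op gs (tensor d \<rho> \<tau>) = tensor d (fold gate_op gs \<rho>) \<tau>"
  by (induction gs arbitrary: \<rho>) (simp_all add: gate_op_tensor_low)

lemma fold_gate_op_tensor_high:
  "fold gate_op (map (map_gate ((+) d)) gs) (tensor d \<rho> \<tau>) = tensor d \<rho> (fold gate_op gs \<tau>)"
  by (induction gs arbitrary: \<tau>) (simp_all add: gate_op_tensor_high)

lemma gate_vec_scale: "gate_vec g (\<lambda>x. v x * c) x = gate_vec g v x * c"
  by (cases g) (auto simp: algebra_simps add_divide_distrib diff_divide_distrib)

lemma gate_op_proj: "gate_op g (proj v) = proj (gate_vec g v)"
proof (intro ext)
  fix x y
  have 1: "gate_vec g (\<lambda>x'. proj v x' y') x = gate_vec g v x * cnj (v y')" for y'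
    by (simp only: proj_def gate_vec_scale)
  have 2: "(\<lambda>y'. cnj (gate_vec g v x * cnj (v y'))) = (\<lambda>y'. v y' * cnj (gate_vec g v x))"
    by (simp add: mult.commute)
  have "gate_op g (proj v) x y = cnj (gate_vec g (\<lambda>y'. v y' * cnj (gate_vec g v x)) y)"
    unfolding gate_op_def 1 2 ..
  also have "\<dots> = cnj (gate_vec g v y * cnj (gate_vec g v x))"
    by (simp only: gate_vec_scale)
  finally show "gate_op g (proj v) x y = proj (gate_vec g v) x y"
    by (simp add: proj_def)
qed

lemma fold_gate_op_proj: "fold gate_op gs (proj v) = proj (fold gate_vec gs v)"
  by (induction gs arbitrary: v) (simp_all add: gate_op_proj)

lemma supp_gate_vec: "addrs_below d g \<Longrightarrow> supp d v \<Longrightarrow> supp d (gate_vec g v)"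
  by (cases g) (auto simp: supp_def flip_bit_less not_less[symmetric])

lemma supp_fold_gate_vec: "\<forall>g\<in>set gs. addrs_below d g \<Longrightarrow> supp d v \<Longrightarrow> supp d (fold gate_vec gs v)"
  by (induction gs arbitrary: v) (simp_all add: supp_gate_vec)

section \<open>Unitarity of the gates\<close>

definition inner_below :: "nat \<Rightarrow> qvec \<Rightarrow> qvec \<Rightarrow> complex" where
  "inner_below d v w = (\<Sum>z<2 ^ d. cnj (v z) * w z)"

lemma sum_flip_bit:
  assumes "i < d"
  shows "(\<Sum>z<2 ^ d. f (flip_bit i z)) = (\<Sum>z<(2 :: nat) ^ d. f z)"
  by (rule sum.reindex_bij_witness[where i = "flip_bit i" and j = "flip_bit i"])
    (auto simp: flip_bit_less assms)

lemma inner_below_gate_vec: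
  assumes "addrs_below d g"
  shows "inner_below d (gate_vec g v) (gate_vec g w) = inner_below d v w"
proof (cases g)
  case (Had i)
  let ?h = "\<lambda>z. cnj (gate_vec g v z) * gate_vec g w z"
  let ?k = "\<lambda>z. cnj (v z) * w z"
  have i: "i < d" using assms Had by auto
  have s: "complex_of_real (sqrt 2) * complex_of_real (sqrt 2) = 2"
    by (simp flip: of_real_mult)
  \<comment> \<open>A Hadamard gate preserves only the sum over two indices that differ in bit
    \<open>i\<close>. Adding to every index its partner counts each such pair twice on both
    sides.\<close>
  have "?h z + ?h (flip_bit i z) = ?k z + ?k (flip_bit i z)" for z
    using s by (simp add: Had bit_flip_bit_nat field_simps)
  then have "(\<Sum>z<2 ^ d. ?h z + ?h (flip_bit i z)) = (\<Sum>z<2 ^ d. ?k z + ?k (flip_bit i z))"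
    by simp
  then show ?thesis
    unfolding sum.distrib sum_flip_bit[OF i, of ?h] sum_flip_bit[OF i, of ?k] inner_below_def
    by simp
next
  case (TGate i)
  have "cnj (cis (pi / 4) * a) * (cis (pi / 4) * b) = cnj a * b" for a b
  proof -
    have "cnj (cis (pi / 4)) * cis (pi / 4) = 1"
      by (simp add: cis_cnj cis_mult)
    moreover have "cnj (cis (pi / 4) * a) * (cis (pi / 4) * b)
        = (cnj (cis (pi / 4)) * cis (pi / 4)) * (cnj a * b)"
      by (simp only: complex_cnj_mult mult.assoc mult.left_commute)
    ultimately show ?thesis by simp
  qed
  then have "cnj (gate_vec g v z) * gate_vec g w z = cnj (v z) * w z" for z
    by (simp add: TGate)
  then show ?thesis by (simp add: inner_below_def)
next
  case (CNOT i j)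
  \<comment> \<open>CNOT permutes the basis states by an involution, so the sum is merely
    reindexed.\<close>
  let ?c = "\<lambda>z. if i \<noteq> j \<and> bit z i then flip_bit j z else z"
  have "(\<Sum>z<2 ^ d. cnj (v (?c z)) * w (?c z)) = (\<Sum>z<2 ^ d. cnj (v z) * w z)"
    by (rule sum.reindex_bij_witness[where i = ?c and j = ?c])
      (use assms CNOT in \<open>auto simp: flip_bit_less bit_flip_bit_nat\<close>)
  moreover have "gate_vec g u z = u (?c z)" for u z
    by (simp add: CNOT)
  ultimately show ?thesis by (simp add: inner_below_def)
qed

lemma nsq_eq_inner: "supp d v \<Longrightarrow> nsq v = Re (inner_below d v v)"
  unfolding nsq_eq_sum inner_below_def Re_sum
  by (rule sum.cong) (auto simp: cmod_def power2_eq_square)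

lemma nsq_gate_vec: "addrs_below d g \<Longrightarrow> supp d v \<Longrightarrow> nsq (gate_vec g v) = nsq v"
  using nsq_eq_inner[OF supp_gate_vec] nsq_eq_inner inner_below_gate_vec by metis

lemma nsq_fold_gate_vec:
  "\<forall>g\<in>set gs. addrs_below d g \<Longrightarrow> supp d v \<Longrightarrow> nsq (fold gate_vec gs v) = nsq v"
proof (induction gs arbitrary: v)
  case (Cons g gs)
  then show ?case using nsq_gate_vec[of g d v] by (simp add: supp_gate_vec)
qed simp

text \<open>The T gate has order 8, and the gate set does not contain its inverse, so 7 repetitions
  stand in for it; the other two gates are their own inverses. The offset \<open>d\<close> moves the
  gate to the qubits from \<open>d\<close> on.\<close>

primrec expand :: "nat \<Rightarrow> nat \<Rightarrow> nat gate \<Rightarrow> nat gate list" where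
  "expand k d (Had i) = [Had (d + i)]"
| "expand k d (TGate i) = replicate k (TGate (d + i))"
| "expand k d (CNOT i j) = [CNOT (d + i) (d + j)]"

lemma expand_shift: "expand k d g = map (map_gate ((+) d)) (expand k 0 g)"
  by (cases g) auto

lemma concat_expand_shift:
  "concat (map (expand k d) gs) = map (map_gate ((+) d)) (concat (map (expand k 0) gs))"
  unfolding map_concat map_map by (rule arg_cong[where f = concat], rule map_cong[OF refl])
    (simp add: expand_shift[of k d])

lemma concat_expand_1: "concat (map (expand 1 0) gs) = gs"
proof (induction gs)
  case (Cons g gs)
  then show ?case by (cases g) auto
qed simp

definition inverse_circuit :: "nat gate list \<Rightarrow> nat gate list" where
  "inverse_circuit gs = concat (map (expand 7 0) (rev gs))"

lemma fold_TGate: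
  "fold gate_vec (replicate k (TGate i)) v = (\<lambda>x. if bit x i then cis (pi / 4) ^ k * v x else v x)"
  by (induction k arbitrary: v) (auto simp: fun_eq_iff)

lemma expand_inverse: "gate_on m g \<Longrightarrow> fold gate_vec (expand 7 0 g) (gate_vec g v) = v"
proof (cases g)
  case (Had i)
  have s: "complex_of_real (sqrt 2) * complex_of_real (sqrt 2) = 2"
    by (simp flip: of_real_mult)
  then show ?thesis
    by (auto simp: Had fun_eq_iff bit_flip_bit_nat field_simps)
next
  case (TGate i)
  have "cis (pi / 4) ^ 7 * (cis (pi / 4) * a) = a" for a
  proof -
    have "cis (pi / 4) ^ 7 * cis (pi / 4) = cis (pi / 4) ^ Suc 7"
      by (simp only: power_Suc mult.commute)
    also have "\<dots> = cis (real (Suc 7) * (pi / 4))"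
      by (rule Complex.DeMoivre)
    also have "real (Suc 7) * (pi / 4) = 2 * pi"
      by simp
    also have "cis (2 * pi) = 1"
      by simp
    finally show ?thesis by (simp flip: mult.assoc)
  qed
  then show ?thesis
    unfolding TGate expand.simps fold_TGate by (simp add: fun_eq_iff)
next
  case (CNOT i j)
  then show "gate_on m g \<Longrightarrow> ?thesis"
    by (auto simp: fun_eq_iff bit_flip_bit_nat)
qed

lemma fold_inverse_circuit:
  "\<forall>g\<in>set gs. gate_on m g \<Longrightarrow> fold gate_vec (inverse_circuit gs) (fold gate_vec gs v) = v"
proof (induction gs arbitrary: v)
  case (Cons g gs)
  then have "fold gate_vec (inverse_circuit gs) (fold gate_vec gs (gate_vec g v)) = gate_vec g v"
    by auto
  then show ?case
    using Cons.prems expand_inverse by (auto simp: inverse_circuit_def)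
qed (simp add: inverse_circuit_def)

lemma addrs_below_expand: "addrs_below m g \<Longrightarrow> h \<in> set (expand k d g) \<Longrightarrow> addrs_below (d + m) h"
  by (cases g) auto

lemma addrs_below_inverse_circuit:
  "\<forall>g\<in>set gs. addrs_below m g \<Longrightarrow> \<forall>h\<in>set (inverse_circuit gs). addrs_below m h"
  unfolding inverse_circuit_def using addrs_below_expand[where d = 0] by fastforce


section \<open>Measuring a block of qubits\<close>

lemma project_qubit_tensor_low:
  "i < d \<Longrightarrow> project_qubit i b (tensor d \<rho> \<tau>) = tensor d (project_qubit i b \<rho>) \<tau>"
  by (auto simp: fun_eq_iff project_qubit_def tensor_def bit_mod_low)

lemma project_qubit_tensor_high:
  "project_qubit (d + i) b (tensor d \<rho> \<tau>) = tensor d \<rho> (project_qubit i b \<tau>)"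
  by (auto simp: fun_eq_iff project_qubit_def tensor_def bit_div_high)

text \<open>The recursion takes the qubits of the block in the order in which the loop of
  \<open>measure_zeros\<close> measures them.\<close>

primrec project_zeros :: "nat \<Rightarrow> nat \<Rightarrow> qop \<Rightarrow> qop" where
  "project_zeros d 0 \<rho> = \<rho>"
| "project_zeros d (Suc m) \<rho> = project_zeros (Suc d) m (project_qubit d False \<rho>)"

lemma project_zeros_shift:
  "project_zeros (d + e) m (tensor d \<rho> \<tau>) = tensor d \<rho> (project_zeros e m \<tau>)"
proof (induction m arbitrary: e \<tau>)
  case (Suc m)
  show ?case
    using Suc[of "Suc e" "project_qubit e False \<tau>"]
    by (simp only: project_zeros.simps project_qubit_tensor_high add_Suc_right)
qed simp

lemma project_zeros_eq:
  "project_zeros d m \<rho> = (\<lambda>x y. if \<forall>i<m. \<not> bit x (d + i) \<and> \<not> bit y (d + i) then \<rho> x y else 0)"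
proof (induction m arbitrary: d \<rho>)
  case (Suc m)
  show ?case
  proof (intro ext)
    fix x y :: nat
    let ?Q = "\<lambda>i. \<not> bit x (d + i) \<and> \<not> bit y (d + i)"
    have "(\<forall>i<Suc m. ?Q i) \<longleftrightarrow> ?Q 0 \<and> (\<forall>i<m. ?Q (Suc i))"
      by (rule All_less_Suc2)
    then show "project_zeros d (Suc m) \<rho> x y = (if \<forall>i<Suc m. ?Q i then \<rho> x y else 0)"
      unfolding project_zeros.simps Suc project_qubit_def by auto
  qed
qed simp

lemma no_low_bits_iff: "(\<forall>i<m. \<not> bit x i) \<longleftrightarrow> (x :: nat) mod 2 ^ m = 0"
proof
  assume "\<forall>i<m. \<not> bit x i"
  then show "x mod 2 ^ m = 0"
    unfolding take_bit_eq_mod[symmetric] by (intro bit_eqI) (auto simp: bit_take_bit_iff)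
next
  assume "x mod 2 ^ m = 0"
  then show "\<forall>i<m. \<not> bit x i"
    by (metis bit_0_eq bit_mod_low bot_apply bot_bool_def)
qed

lemma project_zeros_tensor:
  "project_zeros 0 m (tensor m (proj v) \<tau>) = tensor m (proj (\<lambda>x. v 0 * ket_zero x)) \<tau>"
proof (intro ext)
  fix x y :: nat
  have "(\<forall>i<m. \<not> bit x i \<and> \<not> bit y i) \<longleftrightarrow> x mod 2 ^ m = 0 \<and> y mod 2 ^ m = 0"
    unfolding no_low_bits_iff[symmetric] by auto
  then show "project_zeros 0 m (tensor m (proj v) \<tau>) x y = tensor m (proj (\<lambda>x. v 0 * ket_zero x)) \<tau> x y"
    by (auto simp: project_zeros_eq tensor_def proj_def ket_zero_def)
qed

lemma nsq_scale_ket_zero: "nsq (\<lambda>x. c * ket_zero x) = (cmod c)\<^sup>2"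
proof -
  have "supp 0 (\<lambda>x. c * ket_zero x)" by (auto simp: supp_def ket_zero_def)
  then show ?thesis by (subst nsq_eq_sum) (auto simp: ket_zero_def)
qed

text \<open>Only the middle block of the product state is acted upon, and squared norms of tensor
  factors multiply. The middle factor is |<0| U^-1 v>|^2, the squared overlap of \<open>v\<close>
  with the state that \<open>gs\<close> prepares.\<close>

lemma inverse_circuit_weight:
  assumes "supp d u" "supp m v" "supp e w" "\<forall>g\<in>set gs. addrs_below m g"
  shows "Re (qtrace (project_zeros d m (fold gate_op (concat (map (expand 7 d) (rev gs)))
           (tensor d (proj u) (tensor m (proj v) (proj w))))))
    = nsq u * (cmod (fold gate_vec (inverse_circuit gs) v 0))\<^sup>2 * nsq w"
proof -
  let ?c = "fold gate_vec (inverse_circuit gs) v 0"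
  have low: "supp 0 (\<lambda>x. ?c * ket_zero x)" by (auto simp: supp_def ket_zero_def)
  have "fold gate_op (concat (map (expand 7 d) (rev gs))) (tensor d (proj u) (tensor m (proj v) (proj w)))
      = tensor d (proj u) (tensor m (proj (fold gate_vec (inverse_circuit gs) v)) (proj w))"
    unfolding concat_expand_shift[of 7 d] fold_gate_op_tensor_high inverse_circuit_def[symmetric]
    using fold_gate_op_tensor_low[OF addrs_below_inverse_circuit[OF assms(4)]]
    by (simp add: fold_gate_op_proj)
  moreover have "project_zeros d m (tensor d (proj u) \<tau>) = tensor d (proj u) (project_zeros 0 m \<tau>)" for \<tau>
    using project_zeros_shift[of d 0] by simp
  ultimately have "project_zeros d m (fold gate_op (concat (map (expand 7 d) (rev gs)))
        (tensor d (proj u) (tensor m (proj v) (proj w))))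
      = proj (tensorv d u (tensorv m (\<lambda>x. ?c * ket_zero x) w))"
    by (simp add: project_zeros_tensor proj_tensorv)
  then show ?thesis
    using nsq_tensorv[OF assms(1) supp_tensorv[OF assms(3)], of m "\<lambda>x. ?c * ket_zero x"]
      nsq_tensorv[OF supp_mono[OF low] assms(3), of m]
    by (simp add: nsq_scale_ket_zero nsq_def[symmetric])
qed

section \<open>Pure states and local evolution\<close>

text \<open>On a pure input every branch state stays of the form \<open>proj v\<close> with
  \<open>v\<close> not normalised. Hence branch weights are squared norms, so they are
  nonnegative.\<close>

definition pure_op :: "nat \<Rightarrow> qop \<Rightarrow> bool" where
  "pure_op d \<rho> \<longleftrightarrow> (\<exists>v. \<rho> = proj v \<and> supp d v)"

lemma trace_pure_op_nonneg: "pure_op d \<rho> \<Longrightarrow> 0 \<le> Re (qtrace \<rho>)"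
  unfolding pure_op_def using nsq_nonneg nsq_def by auto

lemma proj_half: "(\<lambda>x y. proj v x y / 2) = proj (\<lambda>x. v x / complex_of_real (sqrt 2))"
proof (intro ext)
  fix x y :: nat
  have "complex_of_real (sqrt 2) * complex_of_real (sqrt 2) = 2"
    by (simp flip: of_real_mult)
  then show "proj v x y / 2 = proj (\<lambda>x. v x / complex_of_real (sqrt 2)) x y"
    by (simp add: proj_def)
qed

lemma project_qubit_proj: "project_qubit i b (proj v) = proj (\<lambda>x. if bit x i = b then v x else 0)"
  by (auto simp: fun_eq_iff project_qubit_def proj_def)

lemma pure_op_half: "pure_op d \<rho> \<Longrightarrow> pure_op d (\<lambda>x y. \<rho> x y / 2)"
  unfolding pure_op_def using proj_half by (fastforce simp: supp_def)

lemma pure_op_project: "pure_op d \<rho> \<Longrightarrow> pure_op d (project_qubit i b \<rho>)"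
  unfolding pure_op_def using project_qubit_proj by (fastforce simp: supp_def)

lemma pure_op_gate: "addrs_below d g \<Longrightarrow> pure_op d \<rho> \<Longrightarrow> pure_op d (gate_op g \<rho>)"
  unfolding pure_op_def using gate_op_proj supp_gate_vec by blast

lemma trace_half: "pure_op d \<rho> \<Longrightarrow> Re (qtrace (\<lambda>x y. \<rho> x y / 2)) = Re (qtrace \<rho>) / 2"
proof -
  assume "pure_op d \<rho>"
  then obtain v where v: "\<rho> = proj v" "supp d v" unfolding pure_op_def by blast
  have "supp d (\<lambda>x. v x / complex_of_real (sqrt 2))" using v(2) by (auto simp: supp_def)
  then show ?thesis
    using v unfolding v(1) proj_half nsq_def[symmetric]
    by (simp add: nsq_eq_sum norm_divide power_divide sum_divide_distrib)
qed

lemma trace_gate: "addrs_below d g \<Longrightarrow> pure_op d \<rho> \<Longrightarrow> Re (qtrace (gate_op g \<rho>)) = Re (qtrace \<rho>)"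
  unfolding pure_op_def using gate_op_proj nsq_gate_vec nsq_def by metis

lemma trace_project:
  assumes "pure_op d \<rho>"
  shows "Re (qtrace (project_qubit i False \<rho>)) + Re (qtrace (project_qubit i True \<rho>)) = Re (qtrace \<rho>)"
proof -
  obtain v where v: "\<rho> = proj v" "supp d v" using assms unfolding pure_op_def by blast
  have s: "supp d (\<lambda>x. if bit x i = b then v x else 0)" for b
    using v(2) by (auto simp: supp_def)
  have "Re (qtrace (project_qubit i b \<rho>)) = (\<Sum>x<2 ^ d. if bit x i = b then (cmod (v x))\<^sup>2 else 0)" for b
    unfolding v(1) project_qubit_proj nsq_def[symmetric] nsq_eq_sum[OF s] by (rule sum.cong) auto
  moreover have "Re (qtrace \<rho>) = (\<Sum>x<2 ^ d. (cmod (v x))\<^sup>2)"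
    using nsq_eq_sum[OF v(2)] by (simp add: v(1) nsq_def)
  ultimately show ?thesis
    by (simp only: sum.distrib[symmetric]) (rule sum.cong, auto)
qed

lemma step_pure_op:
  assumes "\<And>r. length (s r) < d" "pure_op d \<rho>" "(K', s', \<rho>') \<in> set (step (K, s, \<rho>))"
  shows "pure_op d \<rho>'"
proof (cases K)
  case (Cons c K1)
  have "addrs_below d (map_gate (\<lambda>r. length (s r)) g)" for g
    using assms(1) by (auto simp: gate.set_map)
  then show ?thesis
    using assms Cons by (cases c) (auto simp: pure_op_half pure_op_project pure_op_gate)
qed (use assms in auto)

lemma step_trace:
  assumes "\<And>r. length (s r) < d" "pure_op d \<rho>"
  shows "(\<Sum>cfg\<leftarrow>step (K, s, \<rho>). Re (qtrace (snd (snd cfg)))) = Re (qtrace \<rho>)"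
proof (cases K)
  case (Cons c K1)
  have "addrs_below d (map_gate (\<lambda>r. length (s r)) g)" for g
    using assms(1) by (auto simp: gate.set_map)
  then have "Re (qtrace (gate_op (map_gate (\<lambda>r. length (s r)) g) \<rho>)) = Re (qtrace \<rho>)" for g
    using trace_gate[OF _ assms(2)] by blast
  then show ?thesis
    using Cons trace_half[OF assms(2)] trace_project[OF assms(2)] by (cases c) auto
qed simp

text \<open>Every qubit address used by the step is a register length, hence below \<open>d\<close>,
  so the factor from qubit \<open>d\<close> on is carried along untouched.\<close>

lemma step_tensor:
  assumes "\<And>r. length (s r) < d"
  shows "step (K, s, tensor d \<rho> \<tau>) = map (\<lambda>(K, s, \<rho>). (K, s, tensor d \<rho> \<tau>)) (step (K, s, \<rho>))"
proof (cases K)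
  case (Cons c K1)
  have 1: "addrs_below d (map_gate (\<lambda>r. length (s r)) g)" for g
    using assms by (auto simp: gate.set_map)
  have 2: "(\<lambda>x y. tensor d \<rho> \<tau> x y / 2) = tensor d (\<lambda>x y. \<rho> x y / 2) \<tau>"
    by (auto simp: tensor_def fun_eq_iff)
  show ?thesis
    using Cons assms by (cases c) (auto simp: gate_op_tensor_low[OF 1] 2 project_qubit_tensor_low)
qed simp

lemma ev_pure_op:
  assumes "\<And>r. length (s r) \<le> B" "B + N \<le> d" "0 < d" "pure_op d \<rho>"
    and "(K', s', \<rho>') \<in> set (ev N (K, s, \<rho>))"
  shows "pure_op d \<rho>'"
  using assms
proof (induction N arbitrary: B K s \<rho>)
  case (Suc N)
  then obtain K1 s1 \<rho>1 where 1: "(K1, s1, \<rho>1) \<in> set (step (K, s, \<rho>))"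
    "(K', s', \<rho>') \<in> set (ev N (K1, s1, \<rho>1))"
    by auto
  \<comment> \<open>The step about to be taken is counted in \<open>B + Suc N \<le> d\<close>, which
    makes the bound on the addresses strict.\<close>
  have "length (s r) < d" for r using Suc.prems(1)[of r] Suc.prems(2) by simp
  then have "pure_op d \<rho>1" using step_pure_op Suc.prems(4) 1(1) by blast
  then show ?case
    using Suc.IH[OF step_length[OF Suc.prems(1) 1(1)] _ Suc.prems(3) _ 1(2)] Suc.prems(2) by simp
qed simp

lemma ev_trace:
  assumes "\<And>r. length (s r) \<le> B" "B + N \<le> d" "0 < d" "pure_op d \<rho>"
  shows "(\<Sum>cfg\<leftarrow>ev N (K, s, \<rho>). Re (qtrace (snd (snd cfg)))) = Re (qtrace \<rho>)"
  using assms
proof (induction N arbitrary: B K s \<rho>)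
  case (Suc N)
  let ?t = "\<lambda>cfg :: config. Re (qtrace (snd (snd cfg)))"
  have l: "length (s r) < d" for r using Suc.prems(1)[of r] Suc.prems(2) by simp
  have "(\<Sum>x\<leftarrow>ev N cfg. ?t x) = ?t cfg" if "cfg \<in> set (step (K, s, \<rho>))" for cfg
  proof -
    obtain K1 s1 \<rho>1 where cfg: "cfg = (K1, s1, \<rho>1)" by (cases cfg)
    have "pure_op d \<rho>1" using step_pure_op l Suc.prems(4) that cfg by blast
    then show ?thesis
      using Suc.IH[of s1 "Suc B" \<rho>1 K1] step_length[OF Suc.prems(1) that[unfolded cfg]]
        Suc.prems(2,3) by (simp add: cfg)
  qed
  then have "(\<Sum>cfg\<leftarrow>step (K, s, \<rho>). \<Sum>x\<leftarrow>ev N cfg. ?t x) = (\<Sum>cfg\<leftarrow>step (K, s, \<rho>). ?t cfg)"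
    by (intro arg_cong[where f = sum_list] map_cong) auto
  moreover have "(\<Sum>x\<leftarrow>concat (map f xs). ?t x) = (\<Sum>y\<leftarrow>xs. \<Sum>x\<leftarrow>f y. ?t x)" for f and xs :: "config list"
    by (induction xs) auto
  ultimately show ?case
    using step_trace[OF l Suc.prems(4)] by simp
qed simp

lemma ev_tensor:
  assumes "\<And>r. length (s r) \<le> B" "B + N \<le> d" "0 < d"
  shows "ev N (K, s, tensor d \<rho> \<tau>) = map (\<lambda>(K, s, \<rho>). (K, s, tensor d \<rho> \<tau>)) (ev N (K, s, \<rho>))"
  using assms
proof (induction N arbitrary: B K s \<rho>)
  case (Suc N)
  let ?h = "\<lambda>(K, s, \<rho>). (K, s, tensor d \<rho> \<tau>)"
  have l: "length (s r) < d" for r using Suc.prems(1)[of r] Suc.prems(2) by simp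
  have "ev N (?h cfg) = map ?h (ev N cfg)" if "cfg \<in> set (step (K, s, \<rho>))" for cfg
  proof -
    obtain K1 s1 \<rho>1 where cfg: "cfg = (K1, s1, \<rho>1)" by (cases cfg)
    show ?thesis
      using Suc.IH[of s1 "Suc B" K1 \<rho>1] step_length[OF Suc.prems(1) that[unfolded cfg]]
        Suc.prems(2,3) by (simp add: cfg)
  qed
  then have "map (ev N) (map ?h (step (K, s, \<rho>))) = map (map ?h) (map (ev N) (step (K, s, \<rho>)))"
    by simp
  then show ?case
    unfolding ev.simps step_tensor[OF l] by (simp only: map_concat)
qed simp

text \<open>\<open>B + N\<close> exceeds every address that the run uses. These are the three
  properties of an adversary on which security rests: its branches stay pure, their weights are
  conserved in total, and a state stored from qubit \<open>d\<close> on is out of its reach.\<close>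

lemma exec_local:
  assumes "exec c s \<rho> N L" "\<And>r. length (s r) \<le> B" "B + N \<le> d" "0 < d" "pure_op d \<rho>"
  shows "(s', \<rho>') \<in> set L \<Longrightarrow> pure_op d \<rho>'"
    and "(\<Sum>(s', \<rho>')\<leftarrow>L. Re (qtrace \<rho>')) = Re (qtrace \<rho>)"
    and "exec c s (tensor d \<rho> \<tau>) N (map (\<lambda>(s', \<rho>'). (s', tensor d \<rho>' \<tau>)) L)"
proof -
  have L: "ev N ([c], s, \<rho>) = map (Pair []) L" using assms(1) by (simp add: execs_def)
  show "(s', \<rho>') \<in> set L \<Longrightarrow> pure_op d \<rho>'"
    using ev_pure_op[of s B N d \<rho>, OF assms(2-5), of "[]" s' \<rho>' "[c]"] L by auto
  show "(\<Sum>(s', \<rho>')\<leftarrow>L. Re (qtrace \<rho>')) = Re (qtrace \<rho>)"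
    using ev_trace[of s B N d \<rho>, OF assms(2-5), of "[c]"] L by (simp add: comp_def case_prod_unfold)
  show "exec c s (tensor d \<rho> \<tau>) N (map (\<lambda>(s', \<rho>'). (s', tensor d \<rho>' \<tau>)) L)"
    using ev_tensor[of s B N d, OF assms(2-4), of "[c]" \<rho> \<tau>] L
    by (simp add: execs_def comp_def case_prod_unfold)
qed


section \<open>Moving qubits\<close>

lemma image_plus_lessThan: "(\<lambda>i. a + i) ` {..<m} = {a..<a + m :: nat}"
  using image_add_atLeastLessThan[of a 0 m] by (simp add: lessThan_atLeast0 add.commute)

definition gather :: "nat \<Rightarrow> (nat \<Rightarrow> nat) \<Rightarrow> nat \<Rightarrow> nat" where
  "gather M loc x = horner_sum of_bool 2 (map (\<lambda>i. bit x (loc i)) [0..<M])"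

lemma bit_gather: "bit (gather M loc x) i \<longleftrightarrow> i < M \<and> bit x (loc i)"
  by (auto simp: gather_def bit_horner_sum_bit_iff)

text \<open>The state in which the i-th qubit of the vector V sits at position loc i and all other qubits are 0.\<close>

definition place :: "nat \<Rightarrow> (nat \<Rightarrow> nat) \<Rightarrow> qvec \<Rightarrow> qvec" where
  "place M loc V x = (if \<forall>p. bit x p \<longrightarrow> p \<in> loc ` {..<M} then V (gather M loc x) else 0)"

lemma place_cong: "(\<And>i. i < M \<Longrightarrow> loc i = loc' i) \<Longrightarrow> place M loc V = place M loc' V"
proof -
  assume *: "\<And>i. i < M \<Longrightarrow> loc i = loc' i"
  then have "loc ` {..<M} = loc' ` {..<M}" by auto
  moreover have "map (\<lambda>i. bit x (loc i)) [0..<M] = map (\<lambda>i. bit x (loc' i)) [0..<M]" for x :: nat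
    using * by simp
  ultimately show ?thesis by (simp only: place_def gather_def fun_eq_iff simp_thms)
qed

lemma place_id:
  assumes "supp M V"
  shows "place M (\<lambda>i. i) V = V"
proof
  fix x :: nat
  have lt: "x < 2 ^ M \<longleftrightarrow> (\<forall>p. bit x p \<longrightarrow> p < M)"
    by (metis bit_take_bit_iff linorder_not_less take_bit_nat_eq_self_iff bit_eqI)
  show "place M (\<lambda>i. i) V x = V x"
  proof (cases "x < 2 ^ M")
    case True
    then have "gather M (\<lambda>i. i) x = x"
      by (intro bit_eqI) (use lt in \<open>auto simp: bit_gather\<close>)
    then show ?thesis using True lt by (auto simp: place_def)
  next
    case False
    then show ?thesis using assms lt by (auto simp: place_def supp_def)
  qed
qed

text \<open>The XOR swap, which replaces a SWAP gate.\<close>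

abbreviation swap_gates :: "nat \<Rightarrow> nat \<Rightarrow> nat gate list" where
  "swap_gates i j \<equiv> [CNOT i j, CNOT j i, CNOT i j]"

lemma swap_gates_place:
  assumes "i \<noteq> j"
  shows "fold gate_vec (swap_gates i j) (place M loc V) = place M (Transposition.transpose i j \<circ> loc) V"
proof
  fix x :: nat
  define cn :: "nat \<Rightarrow> nat \<Rightarrow> nat \<Rightarrow> nat" where "cn = (\<lambda>i j x. if bit x i then flip_bit j x else x)"
  \<comment> \<open>A CNOT acts on amplitudes by precomposition with the map \<open>cn\<close> of
    indices. So the final amplitude at \<open>x\<close> is the original one at \<open>y\<close>, and
    \<open>y\<close> is \<open>x\<close> with the bits \<open>i\<close> and \<open>j\<close>
    exchanged.\<close>
  define y where "y = cn i j (cn j i (cn i j x))"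
  have cn: "gate_vec (CNOT a b) v = (\<lambda>x. v (cn a b x))" if "a \<noteq> b" for a b v
    using that by (auto simp: cn_def)
  have bit_cn: "bit (cn a b x) k \<longleftrightarrow> (if k = b then bit x b \<noteq> bit x a else bit x k)" if "a \<noteq> b" for a b x k
    using that by (auto simp: cn_def bit_flip_bit_nat)
  have y: "bit y k \<longleftrightarrow> bit x (Transposition.transpose i j k)" for k
    using assms by (auto simp: y_def bit_cn Transposition.transpose_def)
  have "(\<forall>p. bit y p \<longrightarrow> p \<in> loc ` {..<M}) \<longleftrightarrow> (\<forall>p. bit x p \<longrightarrow> p \<in> (Transposition.transpose i j \<circ> loc) ` {..<M})"
  proof -
    let ?p = "Transposition.transpose i j"
    have "p = ?p q \<longleftrightarrow> ?p p = q" for p q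
      using transpose_involutory[of i j p] transpose_involutory[of i j q] by auto
    then have 1: "p \<in> (?p \<circ> loc) ` {..<M} \<longleftrightarrow> ?p p \<in> loc ` {..<M}" for p
      by (simp add: image_iff)
    show ?thesis
      unfolding y 1
    proof (intro iffI allI impI)
      fix p assume "\<forall>p. bit x (?p p) \<longrightarrow> p \<in> loc ` {..<M}" "bit x p"
      then show "?p p \<in> loc ` {..<M}" by (auto dest: spec[of _ "?p p"])
    next
      fix p assume "\<forall>p. bit x p \<longrightarrow> ?p p \<in> loc ` {..<M}" "bit x (?p p)"
      then show "p \<in> loc ` {..<M}" by (auto dest: spec[of _ "?p p"])
    qed
  qed
  moreover have "gather M loc y = gather M (Transposition.transpose i j \<circ> loc) x"
    by (rule bit_eqI) (simp add: bit_gather y)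
  ultimately have "place M loc V y = place M (Transposition.transpose i j \<circ> loc) V x"
    by (simp only: place_def)
  moreover have "fold gate_vec (swap_gates i j) (place M loc V) x = place M loc V y"
    using assms by (simp add: cn y_def del: gate_vec.simps)
  ultimately show "fold gate_vec (swap_gates i j) (place M loc V) x = place M (Transposition.transpose i j \<circ> loc) V x"
    by simp
qed

text \<open>A selection sort on qubits: round \<open>k\<close> swaps qubit \<open>k\<close> from its
  present place to \<open>tgt k\<close>, at a cost of three gates. The bound \<open>Q\<close> on the
  addresses matters because the circuit will be written down with addresses in unary.\<close>

lemma ex_placing_gates:
  assumes "inj_on tgt {..<M}" "tgt ` {..<M} \<subseteq> {..<Q}" "M \<le> Q"
  shows "\<exists>gs. length gs \<le> 3 * M \<and> (\<forall>g\<in>set gs. gate_on Q g) \<and>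
           (\<forall>V. supp M V \<longrightarrow> fold gate_vec gs V = place M tgt V)"
proof -
  have "\<exists>gs loc. length gs \<le> 3 * k \<and> (\<forall>g\<in>set gs. gate_on Q g) \<and> inj_on loc {..<M} \<and>
      loc ` {..<M} \<subseteq> {..<Q} \<and> (\<forall>i<k. loc i = tgt i) \<and>
      (\<forall>V. supp M V \<longrightarrow> fold gate_vec gs V = place M loc V)" if "k \<le> M" for k
    using that
  proof (induction k)
    case 0
    then show ?case
      using assms(3) by (intro exI[of _ "[]"] exI[of _ "\<lambda>i. i"]) (auto simp: place_id)
  next
    case (Suc k)
    then obtain gs loc where IH: "length gs \<le> 3 * k" "\<forall>g\<in>set gs. gate_on Q g" "inj_on loc {..<M}"
      "loc ` {..<M} \<subseteq> {..<Q}" "\<forall>i<k. loc i = tgt i" "\<forall>V. supp M V \<longrightarrow> fold gate_vec gs V = place M loc V"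
      by auto
    have k: "k < M" using Suc.prems by simp
    show ?case
    proof (cases "loc k = tgt k")
      case True
      then have "\<forall>i<Suc k. loc i = tgt i" using IH(5) by (auto simp: less_Suc_eq)
      then show ?thesis using IH by (intro exI[of _ gs] exI[of _ loc]) auto
    next
      case False
      let ?p = "Transposition.transpose (loc k) (tgt k)"
      have Q: "loc k < Q" "tgt k < Q" using IH(4) assms(2) k by auto
      have 1: "inj_on (?p \<circ> loc) {..<M}"
        using IH(3) by (intro comp_inj_on inj_on_subset[OF inj_transpose]) auto
      have 2: "(?p \<circ> loc) ` {..<M} \<subseteq> {..<Q}"
        using IH(4) Q by (auto simp: Transposition.transpose_def)
      \<comment> \<open>Injectivity of \<open>loc\<close> and \<open>tgt\<close> keeps the qubits
        placed in earlier rounds away from both ends of the new swap.\<close>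
      have 3: "(?p \<circ> loc) i = tgt i" if "i < Suc k" for i
      proof (cases "i = k")
        case False
        then have "loc i = tgt i" "loc i \<noteq> loc k" "tgt i \<noteq> tgt k"
          using that k IH(5) inj_onD[OF IH(3), of i k] inj_onD[OF assms(1), of i k] by auto
        then show ?thesis by (simp add: Transposition.transpose_def)
      qed simp
      have 4: "fold gate_vec (gs @ swap_gates (loc k) (tgt k)) V = place M (?p \<circ> loc) V" if "supp M V" for V
        using IH(6) that swap_gates_place[OF False] by simp
      show ?thesis
      proof (intro exI conjI)
        show "length (gs @ swap_gates (loc k) (tgt k)) \<le> 3 * Suc k" using IH(1) by simp
        show "\<forall>g\<in>set (gs @ swap_gates (loc k) (tgt k)). gate_on Q g" using IH(2) Q False by auto
        show "\<forall>i<Suc k. (?p \<circ> loc) i = tgt i" using 3 by blast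
        show "\<forall>V. supp M V \<longrightarrow> fold gate_vec (gs @ swap_gates (loc k) (tgt k)) V = place M (?p \<circ> loc) V"
          using 4 by blast
      qed (fact 1 2)+
    qed
  qed
  from this[of M] obtain gs loc where "length gs \<le> 3 * M" "\<forall>g\<in>set gs. gate_on Q g"
    "\<forall>i<M. loc i = tgt i" "\<forall>V. supp M V \<longrightarrow> fold gate_vec gs V = place M loc V" by auto
  then show ?thesis using place_cong[of M loc tgt] by (intro exI[of _ gs]) auto
qed

text \<open>The slots are those of a public key: the first vector goes to slot \<open>b\<close>,
  which belongs to message bit \<open>b\<close>.\<close>

definition pairv :: "nat \<Rightarrow> bool \<Rightarrow> qvec \<Rightarrow> qvec \<Rightarrow> qvec" where
  "pairv m b v w = (if b then tensorv m w v else tensorv m v w)"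

text \<open>The target positions of the qubits of t + 1 copies of an m-qubit state: the first t copies go
  to slot b of consecutive pairs of m-qubit registers, and the last one goes behind d further
  qubits.\<close>

primrec spread :: "nat \<Rightarrow> bool \<Rightarrow> nat \<Rightarrow> nat \<Rightarrow> nat \<Rightarrow> nat" where
  "spread m b d 0 i = d + i"
| "spread m b d (Suc t) i = (if i < m then of_bool b * m + i else 2 * m + spread m b d t (i - m))"

lemma spread_less: "i < m * Suc t \<Longrightarrow> spread m b d t i < d + 2 * m * t + m"
proof (induction t arbitrary: i)
  case (Suc t)
  show ?case
  proof (cases "i < m")
    case False
    then have "i - m < m * Suc t" using Suc.prems by simp
    then show ?thesis using Suc.IH[of "i - m"] False by simp
  qed (auto simp: of_bool_def)
qed simp

lemma spread_inj: "inj_on (spread m b d t) {..<m * Suc t}"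
proof (induction t)
  case 0
  then show ?case by (auto intro: inj_onI)
next
  case (Suc t)
  show ?case
  proof (rule inj_onI)
    fix i j assume ij: "i \<in> {..<m * Suc (Suc t)}" "j \<in> {..<m * Suc (Suc t)}"
      "spread m b d (Suc t) i = spread m b d (Suc t) j"
    consider "i < m" | "j < m" | "m \<le> i" "m \<le> j" by linarith
    then show "i = j"
    proof cases
      case 3
      then have "i - m \<in> {..<m * Suc t}" "j - m \<in> {..<m * Suc t}" using ij by auto
      moreover have "spread m b d t (i - m) = spread m b d t (j - m)" using 3 ij(3) by simp
      ultimately have "i - m = j - m" using Suc by (meson inj_onD)
      then show ?thesis using 3 by simp
    qed (use ij(3) in \<open>auto simp: of_bool_def split: if_splits\<close>)
  qed
qed

text \<open>Peels off one pair. Of its \<open>2 * m\<close> positions the \<open>m\<close> outside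
  slot \<open>b\<close> receive nothing and stay 0, which is the factor \<open>ket_zero\<close>; all
  other qubits go to positions from \<open>2 * m\<close> on.\<close>

lemma place_tensorv:
  assumes "\<And>i. i < m \<Longrightarrow> loc i = of_bool b * m + i" "\<And>i. i < M' \<Longrightarrow> loc (m + i) = 2 * m + loc' i"
  shows "place (m + M') loc (tensorv m v w)
    = tensorv (2 * m) (pairv m b v ket_zero) (place M' loc' w)"
proof
  fix x :: nat
  let ?e = "of_bool b * m"
  have img: "loc ` {..<m + M'} = {?e..<?e + m} \<union> (\<lambda>i. 2 * m + loc' i) ` {..<M'}"
  proof -
    have "(\<lambda>i. m + i) ` {..<M'} = {m..<m + M'}"
      by (rule image_plus_lessThan)
    then have "{..<m + M'} = {..<m} \<union> (\<lambda>i. m + i) ` {..<M'}" by auto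
    moreover have "loc ` {..<m} = {?e..<?e + m}"
    proof -
      have "loc ` {..<m} = (\<lambda>i. ?e + i) ` {..<m}" using assms(1) by (intro image_cong) auto
      then show ?thesis by (simp only: image_plus_lessThan)
    qed
    moreover have "loc ` (\<lambda>i. m + i) ` {..<M'} = (\<lambda>i. 2 * m + loc' i) ` {..<M'}"
      unfolding image_image using assms(2) by (auto intro!: image_cong)
    ultimately show ?thesis by (simp add: image_Un)
  qed
  define y where "y = x mod 2 ^ (2 * m)"
  define z where "z = x div 2 ^ (2 * m)"
  \<comment> \<open>The support condition of \<open>place\<close> splits into \<open>A\<close> for
    the positions below \<open>2 * m\<close> and \<open>B\<close> for the rest, one for each tensor
    factor.\<close>
  define A where "A \<longleftrightarrow> (\<forall>p<2 * m. bit x p \<longrightarrow> p \<in> {?e..<?e + m})"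
  define B where "B \<longleftrightarrow> (\<forall>p. bit z p \<longrightarrow> p \<in> loc' ` {..<M'})"
  have e: "?e + m \<le> 2 * m" by (cases b) auto
  have "(\<forall>p. bit x p \<longrightarrow> p \<in> loc ` {..<m + M'}) \<longleftrightarrow> A \<and> B"
  proof
    assume *: "\<forall>p. bit x p \<longrightarrow> p \<in> loc ` {..<m + M'}"
    have A unfolding A_def using * img by auto
    moreover have B
      unfolding B_def z_def bit_div_high
    proof (intro allI impI)
      fix p assume "bit x (2 * m + p)"
      then have "2 * m + p \<in> loc ` {..<m + M'}" using * by blast
      then show "p \<in> loc' ` {..<M'}" using e unfolding img by auto
    qed
    ultimately show "A \<and> B" by simp
  next
    assume AB: "A \<and> B"
    show "\<forall>p. bit x p \<longrightarrow> p \<in> loc ` {..<m + M'}"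
    proof (intro allI impI)
      fix p assume p: "bit x p"
      show "p \<in> loc ` {..<m + M'}"
      proof (cases "p < 2 * m")
        case True
        then show ?thesis using AB p unfolding A_def img by auto
      next
        case False
        then have "bit z (p - 2 * m)" using p unfolding z_def bit_div_high by simp
        then have "p - 2 * m \<in> loc' ` {..<M'}" using AB unfolding B_def by blast
        then show ?thesis using False unfolding img by (auto intro!: rev_image_eqI)
      qed
    qed
  qed
  moreover have "gather (m + M') loc x div 2 ^ m = gather M' loc' z"
    by (rule bit_eqI) (auto simp: bit_div_high bit_gather z_def assms(2))
  moreover have g: "gather (m + M') loc x mod 2 ^ m = (x div 2 ^ ?e) mod 2 ^ m"
  proof (rule bit_eqI)
    fix n
    have "bit (gather (m + M') loc x mod 2 ^ m) n \<longleftrightarrow> n < m \<and> bit x (?e + n)"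
      unfolding take_bit_eq_mod[symmetric] by (auto simp: bit_take_bit_iff bit_gather assms(1))
    also have "\<dots> \<longleftrightarrow> bit ((x div 2 ^ ?e) mod 2 ^ m) n"
      unfolding take_bit_eq_mod[symmetric] bit_take_bit_iff bit_div_high ..
    finally show "bit (gather (m + M') loc x mod 2 ^ m) n \<longleftrightarrow> bit ((x div 2 ^ ?e) mod 2 ^ m) n" .
  qed
  moreover have "pairv m b v ket_zero y = (if A then v ((x div 2 ^ ?e) mod 2 ^ m) else 0)"
  proof -
    have y_mod: "y mod 2 ^ m = x mod 2 ^ m"
      unfolding y_def by (simp add: mod_mod_cancel mult_2 power_add)
    have y_div: "y div 2 ^ m = (x div 2 ^ m) mod 2 ^ m"
      unfolding y_def mult_2 using drop_bit_take_bit[of m "m + m" x]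
      by (simp add: take_bit_eq_mod drop_bit_eq_div)
    show ?thesis
    proof (cases b)
      case True
      have "A \<longleftrightarrow> (\<forall>i<m. \<not> bit x i)"
      proof (intro iffI allI impI notI)
        fix i assume "A" "i < m" "bit x i"
        then have "i \<in> {?e..<?e + m}" unfolding A_def by auto
        then show False using \<open>i < m\<close> True by simp
      next
        assume "\<forall>i<m. \<not> bit x i"
        then show A unfolding A_def using True by (auto simp: not_less[symmetric])
      qed
      also have "\<dots> \<longleftrightarrow> x mod 2 ^ m = 0" by (rule no_low_bits_iff)
      finally show ?thesis
        using True y_mod y_div by (simp add: pairv_def tensorv_def ket_zero_def)
    next
      case False
      have "A \<longleftrightarrow> (\<forall>i<m. \<not> bit (x div 2 ^ m) i)"
      proof
        assume *: A
        show "\<forall>i<m. \<not> bit (x div 2 ^ m) i"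
        proof (intro allI impI notI)
          fix i assume "i < m" "bit (x div 2 ^ m) i"
          then have "m + i \<in> {?e..<?e + m}" using * unfolding A_def bit_div_high by auto
          then show False using False by simp
        qed
      next
        assume *: "\<forall>i<m. \<not> bit (x div 2 ^ m) i"
        show A
          unfolding A_def
        proof (intro allI impI)
          fix p assume p: "p < 2 * m" "bit x p"
          have "p < m"
          proof (rule ccontr)
            assume "\<not> p < m"
            then have "p - m < m" "m + (p - m) = p" using p(1) by auto
            then show False using *[rule_format, of "p - m"] p(2) unfolding bit_div_high by simp
          qed
          then show "p \<in> {?e..<?e + m}" using False by simp
        qed
      qed
      also have "\<dots> \<longleftrightarrow> (x div 2 ^ m) mod 2 ^ m = 0" by (rule no_low_bits_iff)
      finally show ?thesis
        using False y_mod y_div by (simp add: pairv_def tensorv_def ket_zero_def)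
    qed
  qed
  ultimately show "place (m + M') loc (tensorv m v w) x
      = tensorv (2 * m) (pairv m b v ket_zero) (place M' loc' w) x"
    unfolding place_def tensorv_def y_def[symmetric] z_def[symmetric] B_def[symmetric] by simp
qed

lemma place_offset:
  assumes "supp m v"
  shows "place m (\<lambda>i. d + i) v = tensorv d ket_zero v"
proof
  fix x :: nat
  have img: "(\<lambda>i. d + i) ` {..<m} = {d..<d + m}"
    by (rule image_plus_lessThan)
  have lt: "x div 2 ^ d < 2 ^ m \<longleftrightarrow> (\<forall>p\<ge>m. \<not> bit x (d + p))"
  proof -
    have "x div 2 ^ d < 2 ^ m \<longleftrightarrow> take_bit m (x div 2 ^ d) = x div 2 ^ d"
      by (simp add: take_bit_nat_eq_self_iff)
    also have "\<dots> \<longleftrightarrow> (\<forall>p\<ge>m. \<not> bit (x div 2 ^ d) p)"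
      by (metis bit_eqI bit_take_bit_iff linorder_not_less)
    finally show ?thesis by (simp add: bit_div_high)
  qed
  have "(\<forall>p. bit x p \<longrightarrow> p \<in> {d..<d + m}) \<longleftrightarrow> (\<forall>i<d. \<not> bit x i) \<and> (\<forall>p\<ge>m. \<not> bit x (d + p))"
  proof
    assume *: "(\<forall>i<d. \<not> bit x i) \<and> (\<forall>p\<ge>m. \<not> bit x (d + p))"
    show "\<forall>p. bit x p \<longrightarrow> p \<in> {d..<d + m}"
    proof (intro allI impI)
      fix p assume p: "bit x p"
      then have "d \<le> p" using * by (meson not_le)
      moreover have "p - d < m"
        using p *[THEN conjunct2, rule_format, of "p - d"] \<open>d \<le> p\<close> by (simp add: not_le[symmetric]) blast
      ultimately show "p \<in> {d..<d + m}" by auto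
    qed
  next
    assume *: "\<forall>p. bit x p \<longrightarrow> p \<in> {d..<d + m}"
    show "(\<forall>i<d. \<not> bit x i) \<and> (\<forall>p\<ge>m. \<not> bit x (d + p))"
    proof (intro conjI allI impI notI)
      fix i assume "i < d" "bit x i"
      then show False using * by fastforce
    next
      fix p assume "m \<le> p" "bit x (d + p)"
      then show False using *[rule_format, of "d + p"] by simp
    qed
  qed
  also have "\<dots> \<longleftrightarrow> x mod 2 ^ d = 0 \<and> x div 2 ^ d < 2 ^ m"
    by (simp only: no_low_bits_iff lt)
  finally have c: "(\<forall>p. bit x p \<longrightarrow> p \<in> {d..<d + m}) \<longleftrightarrow> x mod 2 ^ d = 0 \<and> x div 2 ^ d < 2 ^ m" .
  have "gather m (\<lambda>i. d + i) x = (x div 2 ^ d) mod 2 ^ m"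
    by (rule bit_eqI)
      (auto simp: bit_gather bit_div_high bit_take_bit_iff simp flip: take_bit_eq_mod)
  then show "place m (\<lambda>i. d + i) v x = tensorv d ket_zero v x"
    unfolding place_def img c tensorv_def ket_zero_def
    using assms by (auto simp: supp_def not_less)
qed

text \<open>The \<open>d\<close> idle qubits between the last pair and the spare copy appear only in
  the offset: the vector of the \<open>t\<close> pairs vanishes from \<open>2 ^ (2 * m * t)\<close>
  on, which says that these qubits are 0.\<close>

lemma place_spread:
  assumes "supp m v"
  shows "place (m * Suc t) (spread m b d t) (copiesv m (Suc t) v)
    = tensorv (d + 2 * m * t) (copiesv (2 * m) t (pairv m b v ket_zero)) v"
proof (induction t)
  case 0
  have "spread m b d 0 = (\<lambda>i. d + i)" by auto
  then show ?case
    using place_offset[OF assms, of d] by (simp add: tensorv_ket_zero[OF assms])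
next
  case (Suc t)
  have "place (m * Suc (Suc t)) (spread m b d (Suc t)) (copiesv m (Suc (Suc t)) v)
      = place (m + m * Suc t) (spread m b d (Suc t)) (tensorv m v (copiesv m (Suc t) v))"
    by simp
  also have "\<dots> = tensorv (2 * m) (pairv m b v ket_zero)
      (place (m * Suc t) (spread m b d t) (copiesv m (Suc t) v))"
    by (rule place_tensorv) auto
  also have "\<dots> = tensorv (2 * m) (pairv m b v ket_zero)
      (tensorv (d + 2 * m * t) (copiesv (2 * m) t (pairv m b v ket_zero)) v)"
    by (simp only: Suc)
  also have "\<dots> = tensorv (2 * m + (d + 2 * m * t))
      (tensorv (2 * m) (pairv m b v ket_zero) (copiesv (2 * m) t (pairv m b v ket_zero))) v"
    by (rule tensorv_assoc)
  also have "2 * m + (d + 2 * m * t) = d + 2 * m * Suc t" by simp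
  finally show ?case by (simp only: copiesv.simps)
qed


section \<open>The Haar measure\<close>

lemma measurable_coordinate [measurable]: "(\<lambda>\<psi> :: qvec. \<psi> x) \<in> borel_measurable borel"
  by (intro borel_measurable_continuous_onI continuous_on_product_coordinates)

lemma measurable_qvecI:
  "(\<And>x. (\<lambda>\<psi>. f \<psi> x) \<in> borel_measurable borel) \<Longrightarrow> (f :: qvec \<Rightarrow> qvec) \<in> borel \<rightarrow>\<^sub>M borel"
  by (rule measurable_coordinatewise_then_product)

lemma measurable_gate_vec [measurable]: "gate_vec g \<in> borel \<rightarrow>\<^sub>M borel"
proof (rule measurable_qvecI)
  fix x
  show "(\<lambda>\<psi>. gate_vec g \<psi> x) \<in> borel_measurable borel"
    by (cases g) auto
qed

lemma measurable_fold_gate_vec [measurable]: "fold gate_vec gs \<in> borel \<rightarrow>\<^sub>M borel"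
proof (induction gs)
  case (Cons g gs)
  have "fold gate_vec gs \<circ> gate_vec g \<in> borel \<rightarrow>\<^sub>M borel"
    by (rule measurable_comp[OF measurable_gate_vec Cons])
  then show ?case by (simp add: comp_def)
qed simp

lemma measurable_apply_matrix [measurable]: "apply_matrix d U \<in> borel \<rightarrow>\<^sub>M borel"
proof (rule measurable_qvecI)
  fix x
  show "(\<lambda>\<psi>. apply_matrix d U \<psi> x) \<in> borel_measurable borel"
    by (cases "x < d") (auto simp: apply_matrix_def)
qed

text \<open>\<open>haar_measure\<close> asks for invariance under matrices, so gates have to be
  rewritten as such; column \<open>y\<close> is the image of basis state \<open>y\<close>.\<close>

definition gate_matrix :: "nat gate \<Rightarrow> nat \<Rightarrow> nat \<Rightarrow> complex" where
  "gate_matrix g x y = gate_vec g (\<lambda>z. of_bool (z = y)) x"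

lemma unitary_gate_matrix:
  assumes "addrs_below d g"
  shows "unitary_matrix (2 ^ d) (gate_matrix g)"
  unfolding unitary_matrix_def
proof (intro allI impI)
  fix x y :: nat assume x: "x < 2 ^ d"
  have "(\<Sum>z<2 ^ d. cnj (gate_matrix g z x) * gate_matrix g z y)
      = inner_below d (\<lambda>z. of_bool (z = x)) (\<lambda>z. of_bool (z = y))"
    using inner_below_gate_vec[OF assms] by (simp add: inner_below_def gate_matrix_def)
  also have "\<dots> = (\<Sum>z<2 ^ d. if z = x then of_bool (x = y) else 0)"
    unfolding inner_below_def by (rule sum.cong) auto
  also have "\<dots> = (if x = y then 1 else 0)"
    using x by simp
  finally show "(\<Sum>z<2 ^ d. cnj (gate_matrix g z x) * gate_matrix g z y) = (if x = y then 1 else 0)" .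
qed

lemma gate_vec_sum: "gate_vec g (\<lambda>x. \<Sum>y\<in>A. f y x) x = (\<Sum>y\<in>A. gate_vec g (f y) x)"
  by (cases g) (auto simp: sum.distrib sum_divide_distrib sum_negf sum_distrib_left
      add_divide_distrib diff_divide_distrib sum_subtractf)

text \<open>\<open>apply_matrix\<close> cuts off at \<open>2 ^ d\<close>, so it is compared with the
  gate on \<open>d\<close>-qubit vectors. Under the Haar measure almost all vectors are of this
  kind.\<close>

lemma apply_gate_matrix:
  assumes "addrs_below d g" "supp d \<psi>"
  shows "apply_matrix (2 ^ d) (gate_matrix g) \<psi> = gate_vec g \<psi>"
proof
  fix x
  have "\<psi> = (\<lambda>x. \<Sum>y<2 ^ d. of_bool (x = y) * \<psi> y)"
  proof
    fix x
    have "(\<Sum>y<2 ^ d. of_bool (x = y) * \<psi> y) = (\<Sum>y<2 ^ d. if y = x then \<psi> x else 0)"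
      by (rule sum.cong) auto
    also have "\<dots> = \<psi> x" using assms(2) by (auto simp: supp_def not_less)
    finally show "\<psi> x = (\<Sum>y<2 ^ d. of_bool (x = y) * \<psi> y)" ..
  qed
  then have "gate_vec g \<psi> x = gate_vec g (\<lambda>x. \<Sum>y<2 ^ d. of_bool (x = y) * \<psi> y) x"
    by simp
  also have "\<dots> = (\<Sum>y<2 ^ d. gate_matrix g x y * \<psi> y)"
    unfolding gate_vec_sum gate_vec_scale gate_matrix_def ..
  finally show "apply_matrix (2 ^ d) (gate_matrix g) \<psi> x = gate_vec g \<psi> x"
    using supp_gate_vec[OF assms] by (auto simp: apply_matrix_def supp_def not_less)
qed

lemma haar_integral_unitary:
  fixes f :: "qvec \<Rightarrow> real"
  assumes "haar_measure m \<mu>" "unitary_matrix (2 ^ m) U" and [measurable]: "f \<in> borel_measurable borel"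
  shows "(LINT \<psi>|\<mu>. f (apply_matrix (2 ^ m) U \<psi>)) = (LINT \<psi>|\<mu>. f \<psi>)"
proof -
  have [measurable_cong]: "sets \<mu> = sets borel" and "distr \<mu> borel (apply_matrix (2 ^ m) U) = \<mu>"
    using assms unfolding haar_measure_def by auto
  then have "(LINT \<psi>|\<mu>. f \<psi>) = (LINT \<psi>|distr \<mu> borel (apply_matrix (2 ^ m) U). f \<psi>)" by simp
  also have "\<dots> = (LINT \<psi>|\<mu>. f (apply_matrix (2 ^ m) U \<psi>))"
    by (rule integral_distr) measurable
  finally show ?thesis ..
qed

lemma haar_supp: "haar_measure m \<mu> \<Longrightarrow> AE \<psi> in \<mu>. supp m \<psi> \<and> nsq \<psi> = 1"
  unfolding haar_measure_def by (auto simp: pure_state_iff)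

lemma haar_integral_circuit:
  fixes f :: "qvec \<Rightarrow> real"
  assumes "haar_measure m \<mu>" "\<forall>g\<in>set gs. addrs_below m g" "f \<in> borel_measurable borel"
  shows "(LINT \<psi>|\<mu>. f (fold gate_vec gs \<psi>)) = (LINT \<psi>|\<mu>. f \<psi>)"
  using assms(2)
proof (induction gs)
  case (Cons g gs)
  let ?h = "\<lambda>\<psi>. f (fold gate_vec gs \<psi>)"
  have sets [measurable_cong]: "sets \<mu> = sets borel"
    using assms(1) unfolding haar_measure_def by auto
  note [measurable] = assms(3)
  have "(LINT \<psi>|\<mu>. ?h (gate_vec g \<psi>)) = (LINT \<psi>|\<mu>. ?h (apply_matrix (2 ^ m) (gate_matrix g) \<psi>))"
  proof (rule integral_cong_AE)
    show "AE \<psi> in \<mu>. ?h (gate_vec g \<psi>) = ?h (apply_matrix (2 ^ m) (gate_matrix g) \<psi>)"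
      using haar_supp[OF assms(1)]
    proof eventually_elim
      case (elim \<psi>)
      then show ?case using Cons.prems by (simp add: apply_gate_matrix)
    qed
  qed measurable
  also have "\<dots> = (LINT \<psi>|\<mu>. ?h \<psi>)"
    by (rule haar_integral_unitary[OF assms(1) unitary_gate_matrix]) (use Cons.prems in \<open>auto\<close>)
  finally show ?case using Cons by simp
qed simp

lemma haar_circuit_integrable:
  assumes "haar_measure m \<mu>" "\<forall>g\<in>set gs. addrs_below m g" "x < 2 ^ m"
  shows "integrable \<mu> (\<lambda>\<psi>. (cmod (fold gate_vec gs \<psi> x))\<^sup>2)"
proof -
  have [measurable_cong]: "sets \<mu> = sets borel" and "prob_space \<mu>"
    using assms(1) unfolding haar_measure_def by auto
  then interpret prob_space \<mu> by simp
  have "(cmod (fold gate_vec gs \<psi> x))\<^sup>2 \<le> 1" if "supp m \<psi> \<and> nsq \<psi> = 1" for \<psi>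
  proof -
    have "(cmod (fold gate_vec gs \<psi> x))\<^sup>2 \<le> (\<Sum>x<2 ^ m. (cmod (fold gate_vec gs \<psi> x))\<^sup>2)"
      using assms(3) by (intro member_le_sum) auto
    also have "\<dots> = nsq (fold gate_vec gs \<psi>)"
      using nsq_eq_sum[OF supp_fold_gate_vec[OF assms(2)]] that by simp
    also have "\<dots> = 1" using nsq_fold_gate_vec[OF assms(2)] that by simp
    finally show ?thesis .
  qed
  then have "AE \<psi> in \<mu>. norm ((cmod (fold gate_vec gs \<psi> x))\<^sup>2) \<le> 1"
    by (intro eventually_mono[OF haar_supp[OF assms(1)]]) simp
  then show ?thesis
    by (rule integrable_const_bound) measurable
qed

text \<open>Invariance under exchanging two basis states makes all \<open>2 ^ m\<close> expectations
  equal, and they sum to the expected squared norm 1.\<close>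

lemma haar_coordinate:
  assumes "haar_measure m \<mu>" "x < 2 ^ m"
  shows "(LINT \<psi>|\<mu>. (cmod (\<psi> x))\<^sup>2) = 1 / 2 ^ m"
proof -
  have [measurable_cong]: "sets \<mu> = sets borel" and "prob_space \<mu>"
    using assms(1) unfolding haar_measure_def by auto
  then interpret prob_space \<mu> by simp
  have eq: "(LINT \<psi>|\<mu>. (cmod (\<psi> y))\<^sup>2) = (LINT \<psi>|\<mu>. (cmod (\<psi> x))\<^sup>2)" if y: "y < 2 ^ m" for y
  proof -
    \<comment> \<open>The permutation matrix that exchanges the basis states \<open>x\<close> and
      \<open>y\<close>.\<close>
    define U where "U z w = (of_bool (z = Transposition.transpose x y w) :: complex)" for z w :: nat
    have t: "Transposition.transpose x y w < 2 ^ m \<longleftrightarrow> w < 2 ^ m" for w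
      using assms(2) y by (auto simp: Transposition.transpose_def)
    have "unitary_matrix (2 ^ m) U"
      unfolding unitary_matrix_def
    proof (intro allI impI)
      fix a b :: nat assume ab: "a < 2 ^ m" "b < 2 ^ m"
      have "(\<Sum>z<2 ^ m. cnj (U z a) * U z b)
          = (\<Sum>z<2 ^ m. if z = Transposition.transpose x y a then of_bool (a = b) else 0)"
        unfolding U_def by (rule sum.cong) (auto dest: injD[OF inj_transpose])
      also have "\<dots> = (if a = b then 1 else 0)" using t ab by simp
      finally show "(\<Sum>z<2 ^ m. cnj (U z a) * U z b) = (if a = b then 1 else 0)" .
    qed
    moreover have "apply_matrix (2 ^ m) U \<psi> x = \<psi> y" for \<psi>
    proof -
      have "(\<Sum>w<2 ^ m. U x w * \<psi> w) = (\<Sum>w<2 ^ m. if w = y then \<psi> y else 0)"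
        unfolding U_def by (rule sum.cong) (auto simp: Transposition.transpose_def)
      then show ?thesis using assms(2) y by (simp add: apply_matrix_def)
    qed
    ultimately show ?thesis
      using haar_integral_unitary[OF assms(1), of U "\<lambda>\<psi>. (cmod (\<psi> x))\<^sup>2"] by simp
  qed
  have "1 = (LINT \<psi>|\<mu>. (1 :: real))" by (simp add: prob_space)
  also have "\<dots> = (LINT \<psi>|\<mu>. (\<Sum>y<2 ^ m. (cmod (\<psi> y))\<^sup>2))"
  proof (rule integral_cong_AE)
    show "AE \<psi> in \<mu>. 1 = (\<Sum>y<2 ^ m. (cmod (\<psi> y))\<^sup>2)"
      by (rule eventually_mono[OF haar_supp[OF assms(1)]]) (metis nsq_eq_sum)
  qed measurable
  also have "\<dots> = (\<Sum>y<2 ^ m. LINT \<psi>|\<mu>. (cmod (\<psi> y))\<^sup>2)"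
    using haar_circuit_integrable[OF assms(1), of "[]"] by (intro Bochner_Integration.integral_sum) simp
  also have "\<dots> = 2 ^ m * (LINT \<psi>|\<mu>. (cmod (\<psi> x))\<^sup>2)"
    using eq by simp
  finally show ?thesis by (simp add: field_simps)
qed

text \<open>Applied to the inverse circuit of a key, this is the expected squared overlap of a Haar
  random state with the state of that key.\<close>

lemma haar_circuit_zero:
  assumes "haar_measure m \<mu>" "\<forall>g\<in>set gs. addrs_below m g"
  shows "(LINT \<psi>|\<mu>. (cmod (fold gate_vec gs \<psi> 0))\<^sup>2) = 1 / 2 ^ m"
  using haar_integral_circuit[OF assms, of "\<lambda>\<psi>. (cmod (\<psi> 0))\<^sup>2"] haar_coordinate[OF assms(1), of 0]
  by simp

section \<open>Building blocks of programs\<close>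

lemma unary_simps [simp]:
  "unary 0 = []" "length (unary n) = n" "rev (unary n) = unary n" "tl (unary n) = unary (n - 1)"
  "unary n = [] \<longleftrightarrow> n = 0"
  by (simp_all add: unary_def)

lemma unary_Suc: "unary (Suc n) = True # unary n"
  by (simp add: unary_def)

lemma unary_append: "unary m @ unary n = unary (m + n)"
  by (simp add: unary_def replicate_add)

lemma unary_Cons_append: "unary n @ True # xs = True # unary n @ xs"
  by (simp add: unary_def replicate_app_Cons_same)

text \<open>Lemmas about deterministic programs are proved by composing the rules of the parts and
  then matching the final store and relaxing the step count in one go. The constants in the time
  bounds are therefore generous.\<close>

lemma exec_cong:
  "exec c s \<rho> N [(s1, \<rho>1)] \<Longrightarrow> s1 = s' \<Longrightarrow> \<rho>1 = \<rho>' \<Longrightarrow> N \<le> N' \<Longrightarrow> exec c s \<rho> N' [(s', \<rho>')]"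
  using execs_mono by blast

definition clear :: "nat \<Rightarrow> com" where
  "clear r = While r (Pop r)"

lemma exec_clear: "exec (clear r) s \<rho> (2 * length (s r) + 1) [(s(r := []), \<rho>)]"
  unfolding clear_def
proof (induction "length (s r)" arbitrary: s)
  case 0
  then show ?case
    by - (rule exec_cong[OF exec_While_done], auto)
next
  case (Suc n)
  have "exec (While r (Pop r)) (s(r := tl (s r))) \<rho> (2 * n + 1) [(s(r := []), \<rho>)]"
    using Suc(1)[of "s(r := tl (s r))"] Suc(2)[symmetric] by simp
  note loop = this
  show ?case
    by (rule exec_cong[OF exec_While_step_det[OF _ exec_Pop loop]])
      (use Suc(2)[symmetric] in \<open>auto\<close>)
qed

definition move_bit :: "nat \<Rightarrow> nat \<Rightarrow> com" where
  "move_bit a b = Seq (IfTop a (Push b True) (Push b False)) (Pop a)"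

lemma exec_move_bit:
  "a \<noteq> b \<Longrightarrow> exec (move_bit a b) s \<rho> 4 [(s(b := top_bit (s a) # s b, a := tl (s a)), \<rho>)]"
  unfolding move_bit_def
proof -
  assume ab: "a \<noteq> b"
  have "exec (IfTop a (Push b True) (Push b False)) s \<rho> 2 [(s(b := top_bit (s a) # s b), \<rho>)]"
    by (rule exec_cong[OF exec_IfTop[where N = 1 and L = "[(s(b := top_bit (s a) # s b), \<rho>)]"]])
      (auto intro!: exec_cong[OF exec_Push])
  with ab show "exec (Seq (IfTop a (Push b True) (Push b False)) (Pop a)) s \<rho> 4
      [(s(b := top_bit (s a) # s b, a := tl (s a)), \<rho>)]"
    by - (rule exec_cong[OF exec_Seq_det[OF _ exec_Pop]], assumption, auto)
qed

definition move :: "nat \<Rightarrow> nat \<Rightarrow> com" where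
  "move a b = While a (move_bit a b)"

lemma exec_move:
  "a \<noteq> b \<Longrightarrow> exec (move a b) s \<rho> (5 * length (s a) + 1) [(s(b := rev (s a) @ s b, a := []), \<rho>)]"
  unfolding move_def
proof (induction "s a" arbitrary: s)
  case Nil
  then show ?case
    by - (rule exec_cong[OF exec_While_done], auto)
next
  case (Cons x xs)
  let ?s = "s(b := top_bit (s a) # s b, a := tl (s a))"
  have "exec (While a (move_bit a b)) ?s \<rho> (5 * length (?s a) + 1)
      [(?s(b := rev (?s a) @ ?s b, a := []), \<rho>)]"
    using Cons by (intro Cons(1)) (auto simp flip: Cons(2))
  note loop = this
  show ?case
    by (rule exec_cong[OF exec_While_step_det[OF _ exec_move_bit[OF Cons(3)] loop]])
      (use Cons(2)[symmetric] Cons(3) in \<open>auto simp: top_bit_def fun_eq_iff\<close>)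
qed

text \<open>A single \<open>move\<close> reverses the contents; the detour through \<open>t\<close>
  restores the order.\<close>

definition transfer :: "nat \<Rightarrow> nat \<Rightarrow> nat \<Rightarrow> com" where
  "transfer a t b = Seq (move a t) (move t b)"

lemma exec_transfer:
  assumes "distinct [a, t, b]" "s t = []"
  shows "exec (transfer a t b) s \<rho> (10 * length (s a) + 3) [(s(b := s a @ s b, a := []), \<rho>)]"
  unfolding transfer_def using assms
  by - (rule exec_cong[OF exec_Seq_det[OF exec_move exec_move]], auto simp: fun_eq_iff)

text \<open>Reading a stack destroys it, so the contents are written to \<open>b\<close> and
  \<open>t\<close> at once and then fetched back from \<open>t\<close>. Pushing \<open>True\<close>
  without looking is right because the contents are unary.\<close>

definition dup :: "nat \<Rightarrow> nat \<Rightarrow> nat \<Rightarrow> com" where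
  "dup a t b = Seq (While a (Seq (Pop a) (Seq (Push t True) (Push b True)))) (move t a)"

lemma exec_dup_loop:
  assumes "distinct [a, t, b]" "s a = unary n"
  shows "exec (While a (Seq (Pop a) (Seq (Push t True) (Push b True)))) s \<rho> (6 * n + 1)
      [(s(a := [], t := unary n @ s t, b := unary n @ s b), \<rho>)]"
  using assms(2)
proof (induction n arbitrary: s)
  case 0
  then show ?case by - (rule exec_cong[OF exec_While_done], auto)
next
  case (Suc n)
  let ?s = "s(a := unary n, t := True # s t, b := True # s b)"
  have "exec (Seq (Pop a) (Seq (Push t True) (Push b True))) s \<rho> 5 [(?s, \<rho>)]"
    using assms(1) Suc.prems
    by - (rule exec_cong[OF exec_Seq_det[OF exec_Pop exec_Seq_det[OF exec_Push exec_Push]]], auto simp: fun_eq_iff unary_Suc)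
  note step = this
  show ?case
    by (rule exec_cong[OF exec_While_step_det[OF _ step Suc.IH[of ?s]]])
      (use assms(1) Suc.prems in \<open>auto simp: fun_eq_iff unary_Suc unary_Cons_append\<close>)
qed

lemma exec_dup:
  assumes "distinct [a, t, b]" "s a = unary n" "s t = []"
  shows "exec (dup a t b) s \<rho> (11 * n + 3) [(s(b := unary n @ s b), \<rho>)]"
  unfolding dup_def using assms
  by - (rule exec_cong[OF exec_Seq_det[OF exec_dup_loop exec_move]], auto simp: fun_eq_iff)

text \<open>\<open>While\<close> can test only for emptiness, so the loop hangs on a one-bit flag
  \<open>f\<close>, which is popped when the terminating \<open>False\<close> is read.\<close>

definition read_unary :: "nat \<Rightarrow> nat \<Rightarrow> nat \<Rightarrow> com" where
  "read_unary q u f = Seq (Push f True)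
     (While f (IfTop q (Seq (Pop q) (Push u True)) (Seq (Pop q) (Pop f))))"

lemma exec_read_unary_loop:
  assumes "distinct [q, u, f]" "s q = unary n @ False # xs" "s f = [True]"
  shows "exec (While f (IfTop q (Seq (Pop q) (Push u True)) (Seq (Pop q) (Pop f)))) s \<rho> (5 * n + 6)
      [(s(q := xs, u := unary n @ s u, f := []), \<rho>)]"
  using assms(2,3)
proof (induction n arbitrary: s)
  case 0
  let ?s = "s(q := xs, f := [])"
  have "exec (IfTop q (Seq (Pop q) (Push u True)) (Seq (Pop q) (Pop f))) s \<rho> 4 [(?s, \<rho>)]"
    using assms(1) 0
    by - (rule exec_cong[OF exec_IfTop[where N = 3 and L = "[(?s, \<rho>)]"]], auto simp: top_bit_def fun_eq_iff intro!: exec_cong[OF exec_Seq_det[OF exec_Pop exec_Pop]])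
  note step = this
  show ?case
    by (rule exec_cong[OF exec_While_step_det[OF _ step exec_While_done]])
      (use assms(1) 0 in \<open>auto simp: fun_eq_iff\<close>)
next
  case (Suc n)
  let ?s = "s(q := unary n @ False # xs, u := True # s u)"
  have "exec (IfTop q (Seq (Pop q) (Push u True)) (Seq (Pop q) (Pop f))) s \<rho> 4 [(?s, \<rho>)]"
    using assms(1) Suc.prems
    by - (rule exec_cong[OF exec_IfTop[where N = 3 and L = "[(?s, \<rho>)]"]], auto simp: top_bit_def fun_eq_iff unary_Suc intro!: exec_cong[OF exec_Seq_det[OF exec_Pop exec_Push]])
  note step = this
  show ?case
    by (rule exec_cong[OF exec_While_step_det[OF _ step Suc.IH[of ?s]]])
      (use assms(1) Suc.prems in \<open>auto simp: fun_eq_iff unary_Suc unary_Cons_append\<close>)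
qed

lemma exec_read_unary:
  assumes "distinct [q, u, f]" "s q = unary n @ False # xs" "s f = []"
  shows "exec (read_unary q u f) s \<rho> (5 * n + 8) [(s(q := xs, u := unary n @ s u), \<rho>)]"
  unfolding read_unary_def using assms
  by - (rule exec_cong[OF exec_Seq_det[OF exec_Push exec_read_unary_loop[of q u f _ n xs]]], auto simp: fun_eq_iff)

text \<open>Self-delimiting: each bit is announced by a mark \<open>True\<close>, and
  \<open>False\<close> ends the list, so that further data may follow in the same register.\<close>

definition encode_bits :: "bool list \<Rightarrow> bool list" where
  "encode_bits ks = concat (map (\<lambda>b. [True, b]) ks) @ [False]"

definition read_bits :: "nat \<Rightarrow> nat \<Rightarrow> nat \<Rightarrow> com" where
  "read_bits q k f = Seq (Push f True)
     (While f (IfTop q (Seq (Pop q) (move_bit q k)) (Seq (Pop q) (Pop f))))"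

lemma length_encode_bits: "length (encode_bits ks) = 2 * length ks + 1"
  by (induction ks) (auto simp: encode_bits_def)

lemma exec_read_bits_loop:
  assumes "distinct [q, k, f]" "s q = encode_bits ks @ xs" "s f = [True]"
  shows "exec (While f (IfTop q (Seq (Pop q) (move_bit q k)) (Seq (Pop q) (Pop f)))) s \<rho>
      (9 * length ks + 6) [(s(q := xs, k := rev ks @ s k, f := []), \<rho>)]"
  using assms(2,3)
proof (induction ks arbitrary: s)
  case Nil
  let ?s = "s(q := xs, f := [])"
  have "exec (IfTop q (Seq (Pop q) (move_bit q k)) (Seq (Pop q) (Pop f))) s \<rho> 4 [(?s, \<rho>)]"
    using assms(1) Nil
    by - (rule exec_cong[OF exec_IfTop[where N = 3 and L = "[(?s, \<rho>)]"]], auto simp: top_bit_def encode_bits_def fun_eq_iff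
        intro!: exec_cong[OF exec_Seq_det[OF exec_Pop exec_Pop]])
  note step = this
  show ?case
    by (rule exec_cong[OF exec_While_step_det[OF _ step exec_While_done]])
      (use assms(1) Nil in \<open>auto simp: fun_eq_iff\<close>)
next
  case (Cons b ks)
  let ?s = "s(q := encode_bits ks @ xs, k := b # s k)"
  have "exec (IfTop q (Seq (Pop q) (move_bit q k)) (Seq (Pop q) (Pop f))) s \<rho> 7 [(?s, \<rho>)]"
    using assms(1) Cons.prems
    by - (rule exec_cong[OF exec_IfTop[where N = 6 and L = "[(?s, \<rho>)]"]], auto simp: top_bit_def encode_bits_def fun_eq_iff
        intro!: exec_cong[OF exec_Seq_det[OF exec_Pop exec_move_bit]])
  note step = this
  show ?case
    by (rule exec_cong[OF exec_While_step_det[OF _ step Cons.IH[of ?s]]])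
      (use assms(1) Cons.prems in \<open>auto simp: fun_eq_iff\<close>)
qed

lemma exec_read_bits:
  assumes "distinct [q, k, f]" "s q = encode_bits ks @ xs" "s f = []"
  shows "exec (read_bits q k f) s \<rho> (9 * length ks + 8) [(s(q := xs, k := rev ks @ s k), \<rho>)]"
  unfolding read_bits_def using assms
  by - (rule exec_cong[OF exec_Seq_det[OF exec_Push exec_read_bits_loop[of q k f _ ks xs]]], auto simp: fun_eq_iff)

fun evens :: "bool list \<Rightarrow> bool list" where
  "evens [] = []"
| "evens [x] = [x]"
| "evens (x # y # zs) = x # evens zs"

text \<open>The value \<open>[False]\<close> on a single bit is what the machine produces, since
  \<open>move_bit\<close> pushes \<open>False\<close> when its source is empty. Generated keys have
  even length, but the programs are specified on all inputs.\<close>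

fun odds :: "bool list \<Rightarrow> bool list" where
  "odds [] = []"
| "odds [x] = [False]"
| "odds (x # y # zs) = y # odds zs"

definition deinterleave :: "nat \<Rightarrow> nat \<Rightarrow> nat \<Rightarrow> com" where
  "deinterleave r a b = While r (Seq (move_bit r a) (move_bit r b))"

lemma exec_deinterleave:
  assumes "distinct [r, a, b]"
  shows "exec (deinterleave r a b) s \<rho> (10 * length (s r) + 1)
      [(s(r := [], a := rev (evens (s r)) @ s a, b := rev (odds (s r)) @ s b), \<rho>)]"
proof -
  have "exec (While r (Seq (move_bit r a) (move_bit r b))) s \<rho> (10 * length xs + 1)
      [(s(r := [], a := rev (evens xs) @ s a, b := rev (odds xs) @ s b), \<rho>)]" if "s r = xs" for xs
    using that
  proof (induction xs arbitrary: s rule: evens.induct)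
    case 1
    then show ?case by - (rule exec_cong[OF exec_While_done], auto)
  next
    case (2 x)
    let ?s = "s(r := [], a := x # s a, b := False # s b)"
    have "exec (Seq (move_bit r a) (move_bit r b)) s \<rho> 9 [(?s, \<rho>)]"
      using assms 2
      by - (rule exec_cong[OF exec_Seq_det[OF exec_move_bit exec_move_bit]], auto simp: fun_eq_iff top_bit_def)
    note step = this
  show ?case
    by (rule exec_cong[OF exec_While_step_det[OF _ step exec_While_done]])
      (use assms 2 in \<open>auto simp: fun_eq_iff\<close>)
  next
    case (3 x y zs)
    let ?s = "s(r := zs, a := x # s a, b := y # s b)"
    have "exec (Seq (move_bit r a) (move_bit r b)) s \<rho> 9 [(?s, \<rho>)]"
      using assms 3
      by - (rule exec_cong[OF exec_Seq_det[OF exec_move_bit exec_move_bit]], auto simp: fun_eq_iff top_bit_def)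
    note step = this
  show ?case
    by (rule exec_cong[OF exec_While_step_det[OF _ step 3(1)[of ?s]]])
      (use assms 3(2) in \<open>auto simp: fun_eq_iff\<close>)
  qed
  then show ?thesis unfolding deinterleave_def by blast
qed

primrec clear_below :: "nat \<Rightarrow> com" where
  "clear_below 0 = Skip"
| "clear_below (Suc H) = Seq (clear_below H) (clear H)"

lemma exec_clear_below:
  assumes "\<And>r. r < H \<Longrightarrow> length (s r) \<le> B"
  shows "exec (clear_below H) s \<rho> (H * (2 * B + 2) + 1) [(overlay H (\<lambda>_. []) s, \<rho>)]"
  using assms
proof (induction H)
  case 0
  then show ?case by (auto intro!: exec_cong[OF exec_Skip] simp: overlay_def)
next
  case (Suc H)
  have "length (s H) \<le> B" using Suc.prems by simp
  then show ?case
    unfolding clear_below.simps using Suc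
    by - (rule exec_cong[OF exec_Seq_det[OF Suc.IH exec_clear]], auto simp: fun_eq_iff overlay_def less_Suc_eq)
qed

section \<open>Decoding and executing encoded circuits\<close>

primrec apply_times :: "nat \<Rightarrow> nat gate \<Rightarrow> com" where
  "apply_times 0 g = Skip"
| "apply_times (Suc k) g = Seq (apply_times k g) (Apply g)"

lemma exec_apply_times:
  "exec (apply_times k g) s \<rho> (2 * k + 1)
     [(s, fold gate_op (replicate k (map_gate (\<lambda>r. length (s r)) g)) \<rho>)]"
proof (induction k)
  case 0
  then show ?case by (auto intro!: exec_cong[OF exec_Skip])
next
  case (Suc k)
  have "fold gate_op (replicate (Suc k) h) \<rho> = gate_op h (fold gate_op (replicate k h) \<rho>)" for h
    by (metis comp_apply fold_append fold_simps(1,2) replicate_Suc replicate_append_same)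
  then show ?case
    unfolding apply_times.simps
    by - (rule exec_cong[OF exec_Seq_det[OF Suc exec_Apply]], auto)
qed

abbreviation gate_codes :: "nat gate list \<Rightarrow> bool list" where
  "gate_codes gs \<equiv> concat (map encode_gate gs)"

lemma length_le_gate_codes: "length gs \<le> length (gate_codes gs)"
proof (induction gs)
  case (Cons g gs)
  then show ?case by (cases g) auto
qed simp

text \<open>Parses one word of the prefix code: \<open>True\<close> announces CNOT,
  \<open>False, False\<close> Hadamard and \<open>False, True\<close> T. Addresses are pushed on top
  of what \<open>u\<close> and \<open>v\<close> hold, so preloading both with \<open>unary d\<close>
  shifts the gate by \<open>d\<close> qubits.\<close>

definition dispatch :: "nat \<Rightarrow> nat \<Rightarrow> nat \<Rightarrow> nat \<Rightarrow> com \<Rightarrow> com \<Rightarrow> com \<Rightarrow> com" where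
  "dispatch q u v f cH cT cC = IfTop q
     (Seq (Pop q) (Seq (read_unary q u f) (Seq (read_unary q v f) cC)))
     (Seq (Pop q) (IfTop q (Seq (Pop q) (Seq (read_unary q u f) cT)) (Seq (Pop q) (Seq (read_unary q u f) cH))))"

primrec addr1 :: "nat gate \<Rightarrow> nat" where
  "addr1 (Had i) = i"
| "addr1 (TGate i) = i"
| "addr1 (CNOT i j) = i"

primrec addr2 :: "nat gate \<Rightarrow> nat" where
  "addr2 (Had i) = 0"
| "addr2 (TGate i) = 0"
| "addr2 (CNOT i j) = j"

lemma addr_le: "addr1 g + addr2 g < length (encode_gate g)"
  by (cases g) auto

lemma exec_dispatch:
  assumes d: "distinct [q, u, v, f]"
    and s: "s q = encode_gate g @ xs" "s u = unary d" "s v = unary d" "s f = []"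
    and c: "exec (case g of Had _ \<Rightarrow> cH | TGate _ \<Rightarrow> cT | CNOT _ _ \<Rightarrow> cC)
      (s(q := xs, u := unary (d + addr1 g), v := unary (d + addr2 g))) \<rho> N [(s', \<rho>')]"
  shows "exec (dispatch q u v f cH cT cC) s \<rho> (5 * length (encode_gate g) + N + 20) [(s', \<rho>')]"
proof -
  have pop: "exec (Pop q) (s(q := b # ys)) \<rho> 1 [(s(q := ys), \<rho>)]" for b ys
    by (rule exec_cong[OF exec_Pop]) auto
  have read: "exec (read_unary q u f) (s(q := unary i @ False # ys)) \<rho> (5 * i + 8) [(s(q := ys, u := unary (d + i)), \<rho>)]"
    for i ys
    by (rule exec_cong[OF exec_read_unary[of q u f _ i ys]])
      (use d s in \<open>auto simp: fun_eq_iff unary_append add.commute\<close>)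
  \<comment> \<open>The two one-qubit gates differ only in the second bit \<open>b\<close> of their
    code and are treated together.\<close>
  have one: "exec (Seq (Pop q) (IfTop q (Seq (Pop q) (Seq (read_unary q u f) cT)) (Seq (Pop q) (Seq (read_unary q u f) cH))))
      (s(q := False # b # unary i @ False # xs)) \<rho> (5 * i + N + 20) [(s', \<rho>')]"
    if c: "exec (if b then cT else cH) (s(q := xs, u := unary (d + i), v := unary d)) \<rho> N [(s', \<rho>')]" for b i
  proof -
    have "s(q := xs, u := unary (d + i), v := unary d) = s(q := xs, u := unary (d + i))"
      using d s(3) by (auto simp: fun_eq_iff)
    then have 1: "exec (Seq (Pop q) (Seq (read_unary q u f) (if b then cT else cH))) (s(q := b # unary i @ False # xs)) \<rho>
        (5 * i + N + 11) [(s', \<rho>')]"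
      using c by - (rule exec_cong[OF exec_Seq_det[OF pop exec_Seq_det[OF read]]], auto)
    have 2: "exec (IfTop q (Seq (Pop q) (Seq (read_unary q u f) cT)) (Seq (Pop q) (Seq (read_unary q u f) cH)))
        (s(q := b # unary i @ False # xs)) \<rho> (Suc (5 * i + N + 11)) [(s', \<rho>')]"
      by (rule exec_IfTop) (use 1 in \<open>cases b; simp add: top_bit_def\<close>)
    show ?thesis by (rule exec_cong[OF exec_Seq_det[OF pop 2]]) auto
  qed
  have sq: "s(q := encode_gate g @ xs) = s" using s(1) by auto
  show ?thesis
  proof (cases g)
    case (CNOT i j)
    have "exec (read_unary q v f) (s(q := unary j @ False # xs, u := unary (d + i))) \<rho> (5 * j + 8)
        [(s(q := xs, u := unary (d + i), v := unary (d + j)), \<rho>)]"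
      by (rule exec_cong[OF exec_read_unary[of q v f _ j xs]])
        (use d s in \<open>auto simp: fun_eq_iff unary_append add.commute\<close>)
    from exec_Seq_det[OF pop exec_Seq_det[OF read exec_Seq_det[OF this]]] c
    have "exec (Seq (Pop q) (Seq (read_unary q u f) (Seq (read_unary q v f) cC)))
        (s(q := True # unary i @ False # unary j @ False # xs)) \<rho> (5 * i + 5 * j + N + 20) [(s', \<rho>')]"
      by - (rule exec_cong, auto simp: CNOT)
    with sq show ?thesis
      unfolding dispatch_def
      by - (rule exec_cong[OF exec_IfTop[where N = "5 * i + 5 * j + N + 20" and L = "[(s', \<rho>')]"]],
          auto simp: CNOT s(1) top_bit_def)
  next
    case (Had i)
    then have "exec (if False then cT else cH) (s(q := xs, u := unary (d + i), v := unary d)) \<rho> N [(s', \<rho>')]"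
      using c by simp
    from one[OF this] sq show ?thesis
      unfolding dispatch_def
      by - (rule exec_cong[OF exec_IfTop[where N = "5 * i + N + 20" and L = "[(s', \<rho>')]"]],
          auto simp: Had s(1) top_bit_def)
  next
    case (TGate i)
    then have "exec (if True then cT else cH) (s(q := xs, u := unary (d + i), v := unary d)) \<rho> N [(s', \<rho>')]"
      using c by simp
    from one[OF this] sq show ?thesis
      unfolding dispatch_def
      by - (rule exec_cong[OF exec_IfTop[where N = "5 * i + N + 20" and L = "[(s', \<rho>')]"]],
          auto simp: TGate s(1) top_bit_def)
  qed
qed

text \<open>Each T gate is applied k times: k = 1 runs the encoded circuit, and k = 7 inverts its gates.\<close>

definition interp :: "nat \<Rightarrow> nat \<Rightarrow> nat \<Rightarrow> nat \<Rightarrow> nat \<Rightarrow> nat \<Rightarrow> nat \<Rightarrow> com" where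
  "interp k q o' u v t f = While q (Seq (dup o' t u) (Seq (dup o' t v)
     (Seq (dispatch q u v f (Apply (Had u)) (apply_times k (TGate u)) (Apply (CNOT u v)))
     (Seq (clear u) (clear v)))))"

lemma exec_interp:
  assumes d: "distinct [q, o', u, v, t, f]"
  shows "s q = gate_codes gs \<Longrightarrow> s o' = unary d \<Longrightarrow> s u = [] \<Longrightarrow> s v = [] \<Longrightarrow> s t = [] \<Longrightarrow> s f = [] \<Longrightarrow>
    exec (interp k q o' u v t f) s \<rho> (length gs * (26 * d + 2 * k + 60) + 10 * length (gate_codes gs) + 1)
      [(s(q := []), fold gate_op (concat (map (expand k d) gs)) \<rho>)]"
proof (induction gs arbitrary: s \<rho>)
  case Nil
  then show ?case unfolding interp_def by - (rule exec_cong[OF exec_While_done], auto)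
next
  case (Cons g gs)
  define rest where "rest = gate_codes gs"
  define s1 where "s1 = s(u := unary d, v := unary d)"
  define s2 where "s2 = s(q := rest)"
  define s3 where "s3 = s(q := rest, u := unary (d + addr1 g), v := unary (d + addr2 g))"
  define \<rho>1 where "\<rho>1 = fold gate_op (expand k d g) \<rho>"
  let ?body = "dispatch q u v f (Apply (Had u)) (apply_times k (TGate u)) (Apply (CNOT u v))"
  have q: "s q = encode_gate g @ rest" using Cons.prems(1) by (simp add: rest_def)
  have e1: "exec (dup o' t u) s \<rho> (11 * d + 3) [(s(u := unary d), \<rho>)]"
    using d Cons.prems by - (rule exec_cong[OF exec_dup], auto)
  have e2: "exec (dup o' t v) (s(u := unary d)) \<rho> (11 * d + 3) [(s1, \<rho>)]"
    using d Cons.prems by - (rule exec_cong[OF exec_dup], auto simp: s1_def)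
  have "exec (case g of Had _ \<Rightarrow> Apply (Had u) | TGate _ \<Rightarrow> apply_times k (TGate u) | CNOT _ _ \<Rightarrow> Apply (CNOT u v))
      s3 \<rho> (2 * k + 1) [(s3, \<rho>1)]"
    using d by (cases g) (auto simp: \<rho>1_def s3_def intro!: exec_cong[OF exec_Apply] exec_cong[OF exec_apply_times])
  moreover have "s1(q := rest, u := unary (d + addr1 g), v := unary (d + addr2 g)) = s3"
    by (auto simp: s1_def s3_def fun_eq_iff)
  ultimately have e3: "exec ?body s1 \<rho> (5 * length (encode_gate g) + (2 * k + 1) + 20) [(s3, \<rho>1)]"
    using d q Cons.prems by (intro exec_dispatch[where xs = rest and d = d]) (auto simp: s1_def)
  have "exec (Seq (clear u) (clear v)) s3 \<rho>1 (4 * d + 2 * length (encode_gate g) + 3) [(s2, \<rho>1)]"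
    using d Cons.prems addr_le[of g]
    by - (rule exec_cong[OF exec_Seq_det[OF exec_clear exec_clear]], auto simp: s2_def s3_def fun_eq_iff)
  from exec_Seq_det[OF e1 exec_Seq_det[OF e2 exec_Seq_det[OF e3 this]]]
  have "exec (Seq (dup o' t u) (Seq (dup o' t v) (Seq ?body (Seq (clear u) (clear v))))) s \<rho>
      (26 * d + 7 * length (encode_gate g) + 2 * k + 50) [(s2, \<rho>1)]"
    by (rule exec_cong) auto
  moreover have "exec (interp k q o' u v t f) s2 \<rho>1
      (length gs * (26 * d + 2 * k + 60) + 10 * length (gate_codes gs) + 1)
      [(s2(q := []), fold gate_op (concat (map (expand k d) gs)) \<rho>1)]"
    using d Cons.prems by (intro Cons.IH) (auto simp: s2_def rest_def)
  moreover have "s q \<noteq> []" using q by (cases g) auto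
  ultimately show ?case
    unfolding interp_def
    by - (rule exec_cong[OF exec_While_step_det], (assumption | (simp add: s2_def \<rho>1_def fun_eq_iff)[1])+)
qed

text \<open>Pushing on \<open>w\<close> reverses the order of the gates, as inverting a circuit
  demands, but it would reverse each code word too. So every word is rebuilt from its last symbol to
  its first.\<close>

definition reverse_gates :: "nat \<Rightarrow> nat \<Rightarrow> nat \<Rightarrow> nat \<Rightarrow> nat \<Rightarrow> com" where
  "reverse_gates q w u v f = While q (dispatch q u v f
     (Seq (Push w False) (Seq (move u w) (Seq (Push w False) (Push w False))))
     (Seq (Push w False) (Seq (move u w) (Seq (Push w True) (Push w False))))
     (Seq (Push w False) (Seq (move v w) (Seq (Push w False) (Seq (move u w) (Push w True))))))"

lemma exec_reverse_gates:
  assumes d: "distinct [q, w, u, v, f]"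
  shows "s q = gate_codes gs \<Longrightarrow> s u = [] \<Longrightarrow> s v = [] \<Longrightarrow> s f = [] \<Longrightarrow>
    exec (reverse_gates q w u v f) s \<rho> (length gs * 60 + 10 * length (gate_codes gs) + 1)
      [(s(q := [], w := gate_codes (rev gs) @ s w), \<rho>)]"
proof (induction gs arbitrary: s)
  case Nil
  then show ?case unfolding reverse_gates_def by - (rule exec_cong[OF exec_While_done], auto)
next
  case (Cons g gs)
  define rest where "rest = gate_codes gs"
  define s2 where "s2 = s(q := rest, w := encode_gate g @ s w)"
  define i where "i = addr1 g"
  define j where "j = addr2 g"
  define s1 where "s1 = s(q := rest, u := unary (0 + i), v := unary (0 + j))"
  have q: "s q = encode_gate g @ rest" using Cons.prems(1) by (simp add: rest_def)
  have one: "exec (Seq (Push w False) (Seq (move u w) (Seq (Push w b) (Push w False)))) s1 \<rho> (5 * i + 5 * j + 30)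
      [(s(q := rest, w := False # b # unary i @ False # s w), \<rho>)]" if "j = 0" for b
    using that d Cons.prems(2,3) unfolding s1_def
    by - (rule exec_cong[OF exec_Seq_det[OF exec_Push exec_Seq_det[OF exec_move exec_Seq_det[OF exec_Push exec_Push]]]],
        auto simp: fun_eq_iff)
  have two: "exec (Seq (Push w False) (Seq (move v w) (Seq (Push w False) (Seq (move u w) (Push w True))))) s1 \<rho>
      (5 * i + 5 * j + 30) [(s(q := rest, w := True # unary i @ False # unary j @ False # s w), \<rho>)]"
    using d Cons.prems(2,3) unfolding s1_def
    by - (rule exec_cong[OF exec_Seq_det[OF exec_Push exec_Seq_det[OF exec_move exec_Seq_det[OF exec_Push
            exec_Seq_det[OF exec_move exec_Push]]]]], auto simp: fun_eq_iff)
  let ?body = "dispatch q u v f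
     (Seq (Push w False) (Seq (move u w) (Seq (Push w False) (Push w False))))
     (Seq (Push w False) (Seq (move u w) (Seq (Push w True) (Push w False))))
     (Seq (Push w False) (Seq (move v w) (Seq (Push w False) (Seq (move u w) (Push w True)))))"
  have "exec ?body s \<rho> (5 * length (encode_gate g) + (5 * i + 5 * j + 30) + 20) [(s2, \<rho>)]"
    using d q Cons.prems one two
    by (intro exec_dispatch[where xs = rest and d = 0]) (cases g; simp add: i_def j_def s1_def s2_def)+
  then have "exec ?body s \<rho> (10 * length (encode_gate g) + 55) [(s2, \<rho>)]"
    using addr_le[of g] by - (rule exec_cong, auto simp: i_def j_def)
  moreover have "exec (reverse_gates q w u v f) s2 \<rho> (length gs * 60 + 10 * length (gate_codes gs) + 1)
      [(s2(q := [], w := gate_codes (rev gs) @ s2 w), \<rho>)]"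
    using d Cons.prems by (intro Cons.IH) (auto simp: s2_def rest_def)
  moreover have "s q \<noteq> []" using q by (cases g) auto
  ultimately show ?case
    unfolding reverse_gates_def using d
    by - (rule exec_cong[OF exec_While_step_det], (assumption | (simp add: s2_def fun_eq_iff)[1])+)
qed

text \<open>A forger may submit a key of any length, whose circuit may act on a different number of
  qubits. The verdict is noted in \<open>bad\<close> and the run goes on. The key ends up reversed
  in \<open>a2\<close>, which is how \<open>describe\<close> expects it.\<close>

definition check_length :: "nat \<Rightarrow> nat \<Rightarrow> nat \<Rightarrow> nat \<Rightarrow> com" where
  "check_length a a2 n bad = Seq
     (While a (Seq (move_bit a a2) (IfEmpty n (Push bad True) (Pop n))))
     (Seq (IfEmpty n Skip (Push bad True)) (clear n))"

lemma exec_check_length: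
  assumes d: "distinct [a, a2, n, bad]" and n: "s n = unary l"
  shows "exec (check_length a a2 n bad) s \<rho> (8 * length (s a) + 2 * l + 10)
    [(s(a := [], a2 := rev (s a) @ s a2, n := [],
        bad := unary (length (s a) - l + of_bool (length (s a) < l)) @ s bad), \<rho>)]"
proof -
  let ?body = "Seq (move_bit a a2) (IfEmpty n (Push bad True) (Pop n))"
  have "exec (While a ?body) s \<rho> (8 * length xs + 1)
      [(s(a := [], a2 := rev xs @ s a2, n := unary (l - length xs), bad := unary (length xs - l) @ s bad), \<rho>)]"
    if "s a = xs" "s n = unary l" for xs l
    using that
  proof (induction xs arbitrary: s l)
    case Nil
    then show ?case using d by - (rule exec_cong[OF exec_While_done], auto simp: fun_eq_iff)
  next
    case (Cons x xs)
    let ?s1 = "s(a := xs, a2 := x # s a2)"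
    let ?s2 = "?s1(n := unary (l - 1), bad := (if l = 0 then [True] else []) @ s bad)"
    have 1: "exec (move_bit a a2) s \<rho> 4 [(?s1, \<rho>)]"
      using d Cons.prems by - (rule exec_cong[OF exec_move_bit], auto simp: top_bit_def fun_eq_iff)
    have 2: "exec (IfEmpty n (Push bad True) (Pop n)) ?s1 \<rho> 2 [(?s2, \<rho>)]"
      using d Cons.prems
      by - (rule exec_cong[OF exec_IfEmpty[where N = 1 and L = "[(?s2, \<rho>)]"]],
          auto simp: fun_eq_iff intro!: exec_cong[OF exec_Push] exec_cong[OF exec_Pop])
    have 3: "exec (While a ?body) ?s2 \<rho> (8 * length xs + 1)
      [(?s2(a := [], a2 := rev xs @ ?s2 a2, n := unary (l - 1 - length xs), bad := unary (length xs - (l - 1)) @ ?s2 bad), \<rho>)]"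
      by (rule Cons.IH) (use d Cons.prems in auto)
    have "unary (length xs - (l - 1)) @ (if l = 0 then [True] else []) @ s bad
        = unary (length (x # xs) - l) @ s bad"
      by (cases l) (simp_all add: unary_Suc unary_Cons_append)
    then show ?case
      using d Cons.prems
      by - (rule exec_cong[OF exec_While_step_det[OF _ exec_Seq_det[OF 1 2] 3]],
          auto simp: fun_eq_iff)
  qed
  note 1 = this[OF refl n]
  define s1 where "s1 = s(a := [], a2 := rev (s a) @ s a2, n := unary (l - length (s a)),
      bad := unary (length (s a) - l) @ s bad)"
  define s2 where "s2 = s1(bad := unary (length (s a) - l + of_bool (length (s a) < l)) @ s bad)"
  have 2: "exec (IfEmpty n Skip (Push bad True)) s1 \<rho> 2 [(s2, \<rho>)]"
    using d
    by - (rule exec_cong[OF exec_IfEmpty[where N = 1 and L = "[(s2, \<rho>)]"]],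
        auto simp: s1_def s2_def fun_eq_iff unary_Suc intro!: exec_cong[OF exec_Skip] exec_cong[OF exec_Push])
  have 3: "exec (clear n) s2 \<rho> (2 * l + 1) [(s2(n := []), \<rho>)]"
    using d by - (rule exec_cong[OF exec_clear], auto simp: s1_def s2_def)
  show ?thesis
    unfolding check_length_def using d
    by - (rule exec_cong[OF exec_Seq_det[OF 1[folded s1_def] exec_Seq_det[OF 2 3]]],
        auto simp: s1_def s2_def fun_eq_iff)
qed

definition measure_zeros :: "nat \<Rightarrow> nat \<Rightarrow> nat \<Rightarrow> nat \<Rightarrow> com" where
  "measure_zeros l o' x bad = While l (Seq (Pop l) (Seq (Meas o' x) (Seq (Push o' True)
     (Seq (IfTop x (Push bad True) Skip) (Pop x)))))"

text \<open>The \<open>2 ^ m\<close> branches are not listed. Only the total weight of those with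
  empty \<open>bad\<close> is tracked: after an outcome 1 the register \<open>bad\<close> stays
  nonempty, and the branch contributes nothing.\<close>

lemma exec_measure_zeros:
  assumes d: "distinct [l, o', x, bad]"
  shows "s l = unary m \<Longrightarrow> s o' = unary e \<Longrightarrow> \<exists>L. exec (measure_zeros l o' x bad) s \<rho> (20 * m + 1) L \<and>
    (\<Sum>(s', \<rho>')\<leftarrow>L. if s' bad = [] then Re (qtrace \<rho>') else 0)
      = (if s bad = [] then Re (qtrace (project_zeros e m \<rho>)) else 0)"
proof (induction m arbitrary: s e \<rho>)
  case 0
  then show ?case
    unfolding measure_zeros_def by (intro exI[of _ "[(s, \<rho>)]"]) (auto intro: execs_mono exec_While_done)
next
  case (Suc m)
  let ?body = "Seq (Pop l) (Seq (Meas o' x) (Seq (Push o' True) (Seq (IfTop x (Push bad True) Skip) (Pop x))))"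
  define st where "st b = s(l := unary m, o' := unary (Suc e), bad := (if b then [True] else []) @ s bad)" for b
  define \<rho>1 where "\<rho>1 b = project_qubit e b \<rho>" for b
  let ?s0 = "s(l := unary m)"
  let ?L1 = "[(?s0(x := b # s x), \<rho>1 b). b \<leftarrow> [False, True]]"
  have tail: "exec (Seq (Push o' True) (Seq (IfTop x (Push bad True) Skip) (Pop x))) (?s0(x := b # s x)) (\<rho>1 b) 8
      [(st b, \<rho>1 b)]" for b
  proof -
    let ?s1 = "?s0(x := b # s x, o' := unary (Suc e))"
    let ?s2 = "?s1(bad := (if b then [True] else []) @ s bad)"
    have 1: "exec (Push o' True) (?s0(x := b # s x)) (\<rho>1 b) 1 [(?s1, \<rho>1 b)]"
      using d Suc.prems by - (rule exec_cong[OF exec_Push], auto simp: unary_Suc)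
    have 2: "exec (IfTop x (Push bad True) Skip) ?s1 (\<rho>1 b) 2 [(?s2, \<rho>1 b)]"
      using d
      by - (rule exec_cong[OF exec_IfTop[where N = 1 and L = "[(?s2, \<rho>1 b)]"]],
          auto simp: top_bit_def fun_eq_iff intro!: exec_cong[OF exec_Push] exec_cong[OF exec_Skip])
    have 3: "exec (Pop x) ?s2 (\<rho>1 b) 1 [(st b, \<rho>1 b)]"
      using d by - (rule exec_cong[OF exec_Pop], auto simp: st_def fun_eq_iff)
    show ?thesis by (rule exec_cong[OF exec_Seq_det[OF 1 exec_Seq_det[OF 2 3]]]) auto
  qed
  have pop: "exec (Pop l) s \<rho> 1 [(?s0, \<rho>)]"
    using Suc.prems by - (rule exec_cong[OF exec_Pop], auto simp: unary_Suc)
  have meas: "exec (Meas o' x) ?s0 \<rho> 1 ?L1"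
    using exec_Meas[of o' x ?s0 \<rho>] d Suc.prems by (simp add: \<rho>1_def)
  have "exec (Seq (Meas o' x) (Seq (Push o' True) (Seq (IfTop x (Push bad True) Skip) (Pop x)))) ?s0 \<rho> (Suc (1 + 8))
      (concat (map (\<lambda>(s', \<rho>'). [(st (top_bit (s' x)), \<rho>')]) ?L1))"
    by (rule exec_Seq[OF meas]) (auto simp: top_bit_def intro: tail)
  from exec_Seq_det[OF pop this]
  have body: "exec ?body s \<rho> 12 [(st False, \<rho>1 False), (st True, \<rho>1 True)]"
    by (simp add: top_bit_def)
  have st: "st b l = unary m" "st b o' = unary (Suc e)" for b
    using d by (auto simp: st_def)
  let ?w = "\<lambda>L. \<Sum>(s', \<rho>')\<leftarrow>L. if s' bad = [] then Re (qtrace \<rho>') else 0"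
  have "\<exists>L. exec (measure_zeros l o' x bad) (st b) (\<rho>1 b) (20 * m + 1) L \<and>
      ?w L = (if st b bad = [] then Re (qtrace (project_zeros (Suc e) m (\<rho>1 b))) else 0)" for b
    by (rule Suc.IH[OF st])
  then obtain LF LT where
    F: "exec (measure_zeros l o' x bad) (st False) (\<rho>1 False) (20 * m + 1) LF"
      "?w LF = (if st False bad = [] then Re (qtrace (project_zeros (Suc e) m (\<rho>1 False))) else 0)" and
    T: "exec (measure_zeros l o' x bad) (st True) (\<rho>1 True) (20 * m + 1) LT"
      "?w LT = (if st True bad = [] then Re (qtrace (project_zeros (Suc e) m (\<rho>1 True))) else 0)"
    by blast
  \<comment> \<open>The two outcomes leave different stores, so the continuation of a branch can be
    selected by its store.\<close>
  have neq: "st False \<noteq> st True"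
  proof
    assume "st False = st True"
    then have "st False bad = st True bad" by simp
    then show False by (simp add: st_def)
  qed
  have "exec (measure_zeros l o' x bad) s \<rho> (Suc (12 + (20 * m + 1)))
      (concat (map (\<lambda>(s', \<rho>'). if s' = st False then LF else LT) [(st False, \<rho>1 False), (st True, \<rho>1 True)]))"
    unfolding measure_zeros_def
  proof (rule exec_While_step[OF _ body])
    show "s l \<noteq> []" using Suc.prems by (simp add: unary_Suc)
    show "exec (While l ?body) s' \<rho>' (20 * m + 1) (case (s', \<rho>') of (s', \<rho>') \<Rightarrow> if s' = st False then LF else LT)"
      if "(s', \<rho>') \<in> set [(st False, \<rho>1 False), (st True, \<rho>1 True)]" for s' \<rho>'
      using that neq F(1) T(1) unfolding measure_zeros_def by auto
  qed
  then have "exec (measure_zeros l o' x bad) s \<rho> (Suc (12 + (20 * m + 1))) (LF @ LT)"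
    using neq by simp
  then have "exec (measure_zeros l o' x bad) s \<rho> (20 * Suc m + 1) (LF @ LT)"
    by (rule execs_mono) simp
  moreover have "?w (LF @ LT) = (if s bad = [] then Re (qtrace (project_zeros e (Suc m) \<rho>)) else 0)"
    using F(2) T(2) d by (simp add: st_def \<rho>1_def)
  ultimately show ?case by blast
qed

lemma accepts_measure_zeros:
  assumes "distinct [l, o', x, bad]" "s l = unary m" "s o' = unary e"
  shows "accepts (Seq (measure_zeros l o' x bad) (IfEmpty bad (Push 0 True) (Push 0 False))) s \<rho> (20 * m + 4)
    (if s bad = [] then Re (qtrace (project_zeros e m \<rho>)) else 0)"
proof -
  obtain L where L: "exec (measure_zeros l o' x bad) s \<rho> (20 * m + 1) L"
    "(\<Sum>(s', \<rho>')\<leftarrow>L. if s' bad = [] then Re (qtrace \<rho>') else 0)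
      = (if s bad = [] then Re (qtrace (project_zeros e m \<rho>)) else 0)"
    using exec_measure_zeros[OF assms] by blast
  let ?d = "IfEmpty bad (Push 0 True) (Push 0 False)"
  have "accepts ?d s' \<rho>' 2 (if s' bad = [] then Re (qtrace \<rho>') else 0)" for s' \<rho>'
  proof -
    have "exec ?d s' \<rho>' 2 [(s'(0 := (s' bad = []) # s' 0), \<rho>')]"
      by (rule exec_cong[OF exec_IfEmpty[where N = 1 and L = "[(s'(0 := (s' bad = []) # s' 0), \<rho>')]"]])
        (auto intro!: exec_cong[OF exec_Push])
    then show ?thesis unfolding accepts_def by (intro exI conjI) (auto simp: top_bit_def)
  qed
  then have "accepts (Seq (measure_zeros l o' x bad) ?d) s \<rho> (Suc (20 * m + 1 + 2))
      (\<Sum>x\<leftarrow>L. case x of (s', \<rho>') \<Rightarrow> if s' bad = [] then Re (qtrace \<rho>') else 0)"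
    using L(1) by (intro accepts_Seq[where h = id]) auto
  then show ?thesis unfolding L(2) by (rule accepts_mono) simp
qed

section \<open>Uniform running times\<close>

lemma pexec_det_cong:
  assumes "pexec I sz c s \<rho> (\<lambda>i. [(s1 i, \<rho>1 i)])"
    and "\<And>i. i \<in> I \<Longrightarrow> s1 i = s' i" "\<And>i. i \<in> I \<Longrightarrow> \<rho>1 i = \<rho>' i"
  shows "pexec I sz c s \<rho> (\<lambda>i. [(s' i, \<rho>' i)])"
  using assms unfolding pexec_def by auto

lemma pexec_move:
  "a \<noteq> b \<Longrightarrow> pbd I sz (\<lambda>i. length (s i a)) \<Longrightarrow>
    pexec I sz (move a b) s \<rho> (\<lambda>i. [((s i)(b := rev (s i a) @ s i b, a := []), \<rho> i)])"
  by (rule pexecI[OF exec_move]) (auto intro!: pbd_intros)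

lemma pexec_clear:
  "pbd I sz (\<lambda>i. length (s i r)) \<Longrightarrow> pexec I sz (clear r) s \<rho> (\<lambda>i. [((s i)(r := []), \<rho> i)])"
  by (rule pexecI[OF exec_clear]) (auto intro!: pbd_intros)

lemma pexec_transfer:
  assumes "distinct [a, t, b]" "pbd I sz (\<lambda>i. length (s i a))" "\<And>i. i \<in> I \<Longrightarrow> s i t = []"
  shows "pexec I sz (transfer a t b) s \<rho> (\<lambda>i. [((s i)(b := s i a @ s i b, a := []), \<rho> i)])"
  by (rule pexecI[OF exec_transfer[OF assms(1)]]) (auto intro!: pbd_intros assms)

lemma pexec_dup:
  assumes "distinct [a, t, b]" "pbd I sz n" "\<And>i. i \<in> I \<Longrightarrow> s i a = unary (n i)" "\<And>i. i \<in> I \<Longrightarrow> s i t = []"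
  shows "pexec I sz (dup a t b) s \<rho> (\<lambda>i. [((s i)(b := unary (n i) @ s i b), \<rho> i)])"
  by (rule pexecI[OF exec_dup[OF assms(1)]]) (auto intro!: pbd_intros assms)

lemma pexec_read_unary:
  assumes "distinct [q, u, f]" "pbd I sz n" "\<And>i. i \<in> I \<Longrightarrow> s i q = unary (n i) @ False # xs i"
    "\<And>i. i \<in> I \<Longrightarrow> s i f = []"
  shows "pexec I sz (read_unary q u f) s \<rho> (\<lambda>i. [((s i)(q := xs i, u := unary (n i) @ s i u), \<rho> i)])"
  by (rule pexecI[OF exec_read_unary[OF assms(1)]]) (auto intro!: pbd_intros assms)

lemma pexec_read_bits:
  assumes "distinct [q, k, f]" "pbd I sz (\<lambda>i. length (ks i))" "\<And>i. i \<in> I \<Longrightarrow> s i q = encode_bits (ks i) @ xs i"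
    "\<And>i. i \<in> I \<Longrightarrow> s i f = []"
  shows "pexec I sz (read_bits q k f) s \<rho> (\<lambda>i. [((s i)(q := xs i, k := rev (ks i) @ s i k), \<rho> i)])"
  by (rule pexecI[OF exec_read_bits[OF assms(1)]]) (auto intro!: pbd_intros assms)

lemma pexec_deinterleave:
  assumes "distinct [r, a, b]" "pbd I sz (\<lambda>i. length (s i r))"
  shows "pexec I sz (deinterleave r a b) s \<rho>
    (\<lambda>i. [((s i)(r := [], a := rev (evens (s i r)) @ s i a, b := rev (odds (s i r)) @ s i b), \<rho> i)])"
  by (rule pexecI[OF exec_deinterleave[OF assms(1)]]) (auto intro!: pbd_intros assms)

lemma pexec_clear_below:
  assumes "pbd I sz B" "\<And>i r. i \<in> I \<Longrightarrow> r < H \<Longrightarrow> length (s i r) \<le> B i"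
  shows "pexec I sz (clear_below H) s \<rho> (\<lambda>i. [(overlay H (\<lambda>_. []) (s i), \<rho> i)])"
  by (rule pexecI[OF exec_clear_below]) (auto intro!: pbd_intros assms)

lemma pexec_interp:
  assumes "distinct [q, o', u, v, t, f]"
    and "pbd I sz (\<lambda>i. length (gate_codes (gs i)))" "pbd I sz d"
    and "\<And>i. i \<in> I \<Longrightarrow> s i q = gate_codes (gs i)" "\<And>i. i \<in> I \<Longrightarrow> s i o' = unary (d i)"
    and "\<And>i r. i \<in> I \<Longrightarrow> r \<in> {u, v, t, f} \<Longrightarrow> s i r = []"
  shows "pexec I sz (interp k q o' u v t f) s \<rho>
    (\<lambda>i. [((s i)(q := []), fold gate_op (concat (map (expand k (d i)) (gs i))) (\<rho> i))])"
proof (rule pexecI[OF exec_interp[OF assms(1)]])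
  have "pbd I sz (\<lambda>i. length (gs i))"
    by (rule pbd_le[OF assms(2) length_le_gate_codes])
  then show "pbd I sz (\<lambda>i. length (gs i) * (26 * d i + 2 * k + 60) + 10 * length (gate_codes (gs i)) + 1)"
    by (intro pbd_intros assms(2,3))
qed (simp_all add: assms)

lemma pexec_reverse_gates:
  assumes "distinct [q, w, u, v, f]" "pbd I sz (\<lambda>i. length (gate_codes (gs i)))"
    and "\<And>i. i \<in> I \<Longrightarrow> s i q = gate_codes (gs i)" "\<And>i r. i \<in> I \<Longrightarrow> r \<in> {u, v, f} \<Longrightarrow> s i r = []"
  shows "pexec I sz (reverse_gates q w u v f) s \<rho>
    (\<lambda>i. [((s i)(q := [], w := gate_codes (rev (gs i)) @ s i w), \<rho> i)])"
proof (rule pexecI[OF exec_reverse_gates[OF assms(1)]])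
  have "pbd I sz (\<lambda>i. length (gs i))"
    by (rule pbd_le[OF assms(2) length_le_gate_codes])
  then show "pbd I sz (\<lambda>i. length (gs i) * 60 + 10 * length (gate_codes (gs i)) + 1)"
    by (intro pbd_intros assms(2))
qed (simp_all add: assms)

lemma pexec_check_length:
  assumes "distinct [a, a2, n, bad]" "pbd I sz l" "pbd I sz (\<lambda>i. length (s i a))"
    and "\<And>i. i \<in> I \<Longrightarrow> s i n = unary (l i)"
  shows "pexec I sz (check_length a a2 n bad) s \<rho>
    (\<lambda>i. [((s i)(a := [], a2 := rev (s i a) @ s i a2, n := [],
        bad := unary (length (s i a) - l i + of_bool (length (s i a) < l i)) @ s i bad), \<rho> i)])"
  by (rule pexecI[OF exec_check_length[OF assms(1)]]) (auto intro!: pbd_intros assms)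

text \<open>For programs of which only a halting time is known, such as the adversary; their results
  are whatever \<open>branches\<close> says.\<close>

lemma pexec_black_box:
  assumes "\<And>i. i \<in> I \<Longrightarrow> halts_within (N i) c (s i)" "pbd I sz N" "regs_below H c"
  shows "pexec I sz c (\<lambda>i. overlay H (s i) (s' i)) \<rho>
    (\<lambda>i. map (\<lambda>(t, \<tau>). (overlay H t (s' i), \<tau>)) (branches c (s i) (\<rho> i)))"
  by (rule pexecI[OF exec_overlay[OF halts_within_exec[OF assms(1)] assms(3)] assms(2)])

lemma accepts_paccepts:
  assumes "\<And>i. i \<in> I \<Longrightarrow> accepts c (s i) (\<rho> i) (N i) (p i)" "pbd I sz N"
  shows "paccepts I sz c s \<rho> p"
  using assms unfolding paccepts_def by blast


section \<open>Computing the circuit of a key\<close>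

text \<open>The key waits reversed in \<open>a\<close> because the \<open>move\<close> to register 0
  reverses it again. The registers below \<open>H\<close> are cleared afterwards, since every call
  of \<open>G\<close> needs a fresh input store.\<close>

definition describe :: "com \<Rightarrow> nat \<Rightarrow> nat \<Rightarrow> nat \<Rightarrow> nat \<Rightarrow> nat \<Rightarrow> nat \<Rightarrow> com" where
  "describe G H a q l t f =
     Seq (move a 0) (Seq G (Seq (transfer 0 t q) (Seq (clear_below H) (read_unary q l f))))"

text \<open>The programs below work in registers from \<open>H\<close> on; \<open>3 \<le> H\<close>
  keeps these apart from the input registers 0, 1 and 2.\<close>

locale generator =
  fixes G :: com and m :: "nat \<Rightarrow> nat" and U :: "bool list \<Rightarrow> nat gate list" and H :: nat
  assumes gen: "circuit_generator G m U" and regs: "regs_below H G" and H3: "3 \<le> H"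
begin

lemma gates_on: "g \<in> set (U k) \<Longrightarrow> gate_on (m (length k)) g"
  using gen unfolding circuit_generator_def by blast

lemma gates_below: "\<forall>g\<in>set (U k). addrs_below (m (length k)) g"
  using gates_on gate_on_addrs_below by blast

lemma ex_generator_exec:
  "\<exists>p :: nat poly. \<forall>k. \<exists>s'. (\<forall>\<rho>. exec G (input [k]) \<rho> (poly p (length k)) [(s', \<rho>)]) \<and>
     s' 0 = encode_circuit (m (length k)) (U k) \<and> (\<forall>r. length (s' r) \<le> length k + poly p (length k))"
proof -
  have G: "quantum_free G" "coin_free G" and "poly_time G {[k] | k. True}"
    and out: "\<And>k. classical_output G [k] = encode_circuit (m (length k)) (U k)"
    using gen unfolding circuit_generator_def by auto
  then obtain p where "\<forall>xs\<in>{[k] | k. True}. halts_within (poly p (\<Sum>x\<leftarrow>xs. length x)) G (input xs)"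
    unfolding poly_time_def by blast
  then have p: "halts_within (poly p (length k)) G (input [k])" for k
    by (auto dest: spec[of _ "[k]"])
  have "\<exists>s'. (\<forall>\<rho>. exec G (input [k]) \<rho> (poly p (length k)) [(s', \<rho>)]) \<and>
     s' 0 = encode_circuit (m (length k)) (U k) \<and> (\<forall>r. length (s' r) \<le> length k + poly p (length k))" for k
  proof -
    obtain s' where s': "\<And>\<rho>. exec G (input [k]) \<rho> (poly p (length k)) [(s', \<rho>)]"
      using exec_classical[OF G p] by blast
    moreover have "s' 0 = encode_circuit (m (length k)) (U k)"
      using out[of k] exec_branches_eq[OF s'] by (simp add: classical_output_def)
    moreover have "length (s' r) \<le> length k + poly p (length k)" for r
      by (rule exec_length[OF s'[of "proj ket_zero"]]) (auto simp: input_def)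
    ultimately show ?thesis by blast
  qed
  then show ?thesis by blast
qed

text \<open>The generator writes the number of qubits in unary and the gates after it, and it cannot
  write more than its running time allows. Efficiency thus bounds both quantities.\<close>

lemma pbd_circuit:
  assumes "pbd I sz (\<lambda>i. length (k i))"
  shows "pbd I sz (\<lambda>i. length (gate_codes (U (k i))))" and "pbd I sz (\<lambda>i. m (length (k i)))"
proof -
  obtain p :: "nat poly" where p: "\<And>k. \<exists>s'. (\<forall>\<rho>. exec G (input [k]) \<rho> (poly p (length k)) [(s', \<rho>)]) \<and>
     s' 0 = encode_circuit (m (length k)) (U k) \<and> (\<forall>r. length (s' r) \<le> length k + poly p (length k))"
    using ex_generator_exec by blast
  have "length (encode_circuit (m (length k)) (U k)) \<le> length k + poly p (length k)" for k
    using p[of k] by metis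
  then have le: "m (length k) + 1 + length (gate_codes (U k)) \<le> length k + poly p (length k)" for k
    by (simp add: encode_circuit_def)
  have pb: "pbd I sz (\<lambda>i. length (k i) + poly p (length (k i)))"
    by (intro pbd_intros assms)
  show "pbd I sz (\<lambda>i. length (gate_codes (U (k i))))"
    by (rule pbd_le[OF pb]) (meson le add_leD2)
  show "pbd I sz (\<lambda>i. m (length (k i)))"
    by (rule pbd_le[OF pb]) (meson le add_leD1)
qed

lemma pexec_describe:
  assumes d: "distinct [a, q, l, t, f]" "\<And>r. r \<in> {a, q, l, t, f} \<Longrightarrow> H \<le> r"
    and k: "\<And>i. i \<in> I \<Longrightarrow> s i a = rev (k i)" "pbd I sz (\<lambda>i. length (k i))"
    and e: "\<And>i r. i \<in> I \<Longrightarrow> r \<in> {q, l, t, f} \<Longrightarrow> s i r = []" "\<And>i r. i \<in> I \<Longrightarrow> r < H \<Longrightarrow> s i r = []"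
  shows "pexec I sz (describe G H a q l t f) s \<rho>
    (\<lambda>i. [((s i)(a := [], q := gate_codes (U (k i)), l := unary (m (length (k i)))), \<rho> i)])"
proof -
  obtain p :: "nat poly" where "\<And>k. \<exists>s'. (\<forall>\<rho>. exec G (input [k]) \<rho> (poly p (length k)) [(s', \<rho>)]) \<and>
     s' 0 = encode_circuit (m (length k)) (U k) \<and> (\<forall>r. length (s' r) \<le> length k + poly p (length k))"
    using ex_generator_exec by blast
  then obtain S where S: "\<And>k \<rho>. exec G (input [k]) \<rho> (poly p (length k)) [(S k, \<rho>)]"
    "\<And>k. S k 0 = encode_circuit (m (length k)) (U k)"
    "\<And>k r. length (S k r) \<le> length k + poly p (length k)"
    by metis
  define B where "B i = length (k i) + poly p (length (k i))" for i
  have pB: "pbd I sz B" unfolding B_def by (intro pbd_intros k(2))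
  define s1 where "s1 i = (s i)(a := [], 0 := k i)" for i
  define s2 where "s2 i = overlay H (S (k i)) (s1 i)" for i
  define s3 where "s3 i = (s2 i)(q := S (k i) 0, 0 := [])" for i
  define s4 where "s4 i = (s i)(a := [], q := encode_circuit (m (length (k i))) (U (k i)))" for i
  have nz: "a \<noteq> 0" "q \<noteq> 0" "t \<noteq> 0" "l \<noteq> 0" "f \<noteq> 0" "0 < H" using d(2) H3 by force+
  have s2: "s2 i 0 = S (k i) 0" "s2 i t = []" "s2 i q = []" if "i \<in> I" for i
  proof -
    have "\<not> t < H" "\<not> q < H" using d(2) by (auto simp: not_less)
    then show "s2 i 0 = S (k i) 0" "s2 i t = []" "s2 i q = []"
      using e that d nz by (auto simp: s2_def overlay_def s1_def)
  qed
  have "pexec I sz (move a 0) s \<rho> (\<lambda>i. [(s1 i, \<rho> i)])"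
    by (rule pexec_det_cong[OF pexec_move]) (use k e nz in \<open>auto simp: s1_def intro: pbd_le[OF k(2)]\<close>)
  moreover have "pexec I sz G s1 \<rho> (\<lambda>i. [(s2 i, \<rho> i)])"
  proof (rule pexecI)
    fix i assume i: "i \<in> I"
    \<comment> \<open>Below \<open>H\<close> only register 0 is in use, so the store looks to
      \<open>G\<close> exactly like its own input.\<close>
    have "overlay H (input [k i]) (s1 i) = s1 i"
      using e[OF i] d(2) nz by (auto simp: overlay_def input_def s1_def fun_eq_iff)
    then show "exec G (s1 i) (\<rho> i) (poly p (length (k i))) [(s2 i, \<rho> i)]"
      using exec_overlay[OF S(1)[of "k i" "\<rho> i"] regs, of "s1 i"] by (simp add: s2_def)
  qed (intro pbd_intros k(2))
  moreover have "pexec I sz (transfer 0 t q) s2 \<rho> (\<lambda>i. [(s3 i, \<rho> i)])"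
  proof (rule pexec_det_cong[OF pexec_transfer])
    show "pbd I sz (\<lambda>i. length (s2 i 0))"
      by (rule pbd_le[OF pB]) (use s2 S(3) in \<open>auto simp: B_def\<close>)
  qed (use d nz s2 in \<open>auto simp: s3_def\<close>)
  moreover have "pexec I sz (clear_below H) s3 \<rho> (\<lambda>i. [(s4 i, \<rho> i)])"
  proof (rule pexec_det_cong[OF pexec_clear_below[OF pB]])
    fix i r assume "i \<in> I" "r < H"
    then show "length (s3 i r) \<le> B i"
      using S(3)[of "k i" r] S(3)[of "k i" 0] d(2) by (auto simp: s3_def s2_def overlay_def B_def)
  next
    fix i assume i: "i \<in> I"
    have "\<not> q < H" "\<not> a < H" using d(2) by (auto simp: not_less)
    then show "overlay H (\<lambda>_. []) (s3 i) = s4 i"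
      using e[OF i] nz S(2) by (auto simp: fun_eq_iff overlay_def s4_def s3_def s2_def s1_def)
  qed auto
  moreover have "pexec I sz (read_unary q l f) s4 \<rho>
      (\<lambda>i. [((s i)(a := [], q := gate_codes (U (k i)), l := unary (m (length (k i)))), \<rho> i)])"
    by (rule pexec_det_cong[OF pexec_read_unary[where n = "\<lambda>i. m (length (k i))"
            and xs = "\<lambda>i. gate_codes (U (k i))"]])
      (use d e pbd_circuit(2)[OF k(2)] in \<open>auto simp: s4_def encode_circuit_def fun_eq_iff\<close>)
  ultimately show ?thesis
    unfolding describe_def by (intro pexec_Seq_det)
qed

end


section \<open>The programs of the signature scheme\<close>

abbreviation (input) empty_store :: store where
  "empty_store \<equiv> \<lambda>_. []"

text \<open>Two coins for each unit of the security parameter, one bit for either key of the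
  generator.\<close>

definition gen1_com :: com where
  "gen1_com = Seq (move 0 1) (While 1 (Seq (Pop 1) (Seq (Flip 0) (Flip 0))))"

text \<open>\<open>H + 5\<close> holds gate codes, \<open>H + 4\<close> the first qubit to act on
  and \<open>H + 7\<close> the number of qubits; \<open>H\<close> to \<open>H + 3\<close> are
  scratch. The size of the first state becomes the offset of the second one, and finally both sizes
  are joined in register 0, which announces the length of the public key.\<close>

definition gen2_com :: "nat \<Rightarrow> com \<Rightarrow> com" where
  "gen2_com H G = Seq (deinterleave 0 (H + 8) (H + 9))
     (Seq (describe G H (H + 8) (H + 5) (H + 7) (H + 3) H)
     (Seq (interp 1 (H + 5) (H + 4) (H + 1) (H + 2) (H + 3) H)
     (Seq (move (H + 7) (H + 4))
     (Seq (describe G H (H + 9) (H + 5) (H + 7) (H + 3) H)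
     (Seq (interp 1 (H + 5) (H + 4) (H + 1) (H + 2) (H + 3) H)
     (Seq (move (H + 7) 0) (move (H + 4) 0)))))))"

definition sign_com :: com where
  "sign_com = Seq (deinterleave 0 2 3) (IfTop 1 (move 3 0) (move 2 0))"

text \<open>The check comes in two parts because the verifier and the reduction obtain the offset
  \<open>H + 4\<close> in different ways. Sharing both parts makes them accept with the same
  \<open>weight\<close>.\<close>

definition prepare_check :: "nat \<Rightarrow> com \<Rightarrow> com" where
  "prepare_check H G = Seq (check_length (H + 8) (H + 10) (H + 11) (H + 12))
     (describe G H (H + 10) (H + 5) (H + 7) (H + 3) H)"

definition finish_check :: "nat \<Rightarrow> com" where
  "finish_check H = Seq (reverse_gates (H + 5) (H + 6) (H + 1) (H + 2) H)
     (Seq (interp 7 (H + 6) (H + 4) (H + 1) (H + 2) (H + 3) H)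
     (Seq (measure_zeros (H + 7) (H + 4) (H + 13) (H + 12))
        (IfEmpty (H + 12) (Push 0 True) (Push 0 False))))"

definition verify_com :: "nat \<Rightarrow> com \<Rightarrow> com" where
  "verify_com H G = Seq (move 0 (H + 11)) (Seq (move 1 (H + 9)) (Seq (transfer 2 (H + 3) (H + 8))
     (Seq (prepare_check H G) (Seq (IfTop (H + 9) (dup (H + 7) (H + 3) (H + 4)) Skip)
        (finish_check H)))))"

lemma input_simps:
  "input [x] = empty_store(0 := x)"
  "input [x, y] = empty_store(0 := x, 1 := y)"
  "input [x, y, z] = empty_store(0 := x, 1 := y, 2 := z)"
  by (auto simp: fun_eq_iff input_def less_Suc_eq nth_Cons split: nat.split)

lemma paccepts_finish_check:
  assumes gs: "\<And>i. i \<in> I \<Longrightarrow> s i (H + 5) = gate_codes (gs i)" "pbd I sz (\<lambda>i. length (gate_codes (gs i)))"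
    and d: "\<And>i. i \<in> I \<Longrightarrow> s i (H + 4) = unary (d i)" "pbd I sz d"
    and l: "\<And>i. i \<in> I \<Longrightarrow> s i (H + 7) = unary (l i)" "pbd I sz l"
    and e: "\<And>i r. i \<in> I \<Longrightarrow> r \<in> {H, H + 1, H + 2, H + 3, H + 6} \<Longrightarrow> s i r = []"
  shows "paccepts I sz (finish_check H) s \<rho> (\<lambda>i. if s i (H + 12) = []
    then Re (qtrace (project_zeros (d i) (l i)
           (fold gate_op (concat (map (expand 7 (d i)) (rev (gs i)))) (\<rho> i)))) else 0)"
proof -
  define s1 where "s1 i = (s i)(H + 5 := [], H + 6 := gate_codes (rev (gs i)))" for i
  define s2 where "s2 i = (s i)(H + 5 := [], H + 6 := [])" for i
  define \<rho>2 where "\<rho>2 i = fold gate_op (concat (map (expand 7 (d i)) (rev (gs i)))) (\<rho> i)" for i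
  have "length (gate_codes (rev gs)) = length (gate_codes gs)" for gs
    by (simp add: length_concat rev_map[symmetric])
  then have rgs: "pbd I sz (\<lambda>i. length (gate_codes (rev (gs i))))" using gs(2) by simp
  have 1: "pexec I sz (reverse_gates (H + 5) (H + 6) (H + 1) (H + 2) H) s \<rho> (\<lambda>i. [(s1 i, \<rho> i)])"
    by (rule pexec_det_cong[OF pexec_reverse_gates[where gs = gs, OF _ gs(2)]]) (auto simp: e gs s1_def)
  have 2: "pexec I sz (interp 7 (H + 6) (H + 4) (H + 1) (H + 2) (H + 3) H) s1 \<rho> (\<lambda>i. [(s2 i, \<rho>2 i)])"
    by (rule pexec_det_cong[OF pexec_interp[where gs = "\<lambda>i. rev (gs i)" and d = d, OF _ rgs d(2)]]) (auto simp: e d s1_def s2_def \<rho>2_def)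
  have "accepts (Seq (measure_zeros (H + 7) (H + 4) (H + 13) (H + 12)) (IfEmpty (H + 12) (Push 0 True) (Push 0 False)))
      (s2 i) (\<rho>2 i) (20 * l i + 4) (if s i (H + 12) = [] then Re (qtrace (project_zeros (d i) (l i) (\<rho>2 i))) else 0)"
    if "i \<in> I" for i
    using accepts_measure_zeros[of "H + 7" "H + 4" "H + 13" "H + 12" "s2 i" "l i" "d i" "\<rho>2 i"] that
    by (simp add: s2_def l d)
  then have 3: "paccepts I sz (Seq (measure_zeros (H + 7) (H + 4) (H + 13) (H + 12)) (IfEmpty (H + 12) (Push 0 True) (Push 0 False)))
      s2 \<rho>2 (\<lambda>i. if s i (H + 12) = [] then Re (qtrace (project_zeros (d i) (l i) (\<rho>2 i))) else 0)"
    by (rule accepts_paccepts) (assumption | intro pbd_intros l(2))+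
  show ?thesis
    unfolding finish_check_def \<rho>2_def[symmetric] by (rule paccepts_Seq_det[OF 1 paccepts_Seq_det[OF 2 3]])
qed

context generator begin

lemma pexec_prepare_check:
  assumes "pbd I sz n" "\<And>i. i \<in> I \<Longrightarrow> s i (H + 11) = unary (n i)"
    and "pbd I sz (\<lambda>i. length (\<sigma> i))" "\<And>i. i \<in> I \<Longrightarrow> s i (H + 8) = \<sigma> i"
    and "\<And>i r. i \<in> I \<Longrightarrow> r \<in> {H + 5, H + 7, H + 3, H, H + 10} \<Longrightarrow> s i r = []"
    and "\<And>i r. i \<in> I \<Longrightarrow> r < H \<Longrightarrow> s i r = []"
  shows "pexec I sz (prepare_check H G) s \<rho> (\<lambda>i. [((s i)(H + 8 := [], H + 11 := [],
    H + 12 := unary (length (\<sigma> i) - n i + of_bool (length (\<sigma> i) < n i)) @ s i (H + 12),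
    H + 5 := gate_codes (U (\<sigma> i)), H + 7 := unary (m (length (\<sigma> i)))), \<rho> i)])"
proof -
  define s1 where "s1 i = (s i)(H + 8 := [], H + 10 := rev (\<sigma> i), H + 11 := [],
    H + 12 := unary (length (\<sigma> i) - n i + of_bool (length (\<sigma> i) < n i)) @ s i (H + 12))" for i
  have pl: "pbd I sz (\<lambda>i. length (s i (H + 8)))"
    by (rule pbd_le[OF assms(3)]) (simp add: assms)
  have 1: "pexec I sz (check_length (H + 8) (H + 10) (H + 11) (H + 12)) s \<rho> (\<lambda>i. [(s1 i, \<rho> i)])"
    by (rule pexec_det_cong[OF pexec_check_length[where s = s and l = n, OF _ assms(1) pl]]) (auto simp: s1_def assms)
  show ?thesis
    unfolding prepare_check_def
    by (rule pexec_Seq_det[OF 1 pexec_det_cong[OF pexec_describe[where k = \<sigma>]]])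
      (use assms in \<open>auto simp: s1_def fun_eq_iff\<close>)
qed

text \<open>The probability that the check of the claimed key \<sigma> passes on the block of
  \<open>m n\<close> qubits that starts at qubit \<open>d\<close>.\<close>

definition weight :: "nat \<Rightarrow> nat \<Rightarrow> bool list \<Rightarrow> qop \<Rightarrow> real" where
  "weight d n \<sigma> \<rho> = (if length \<sigma> = n then Re (qtrace (project_zeros d (m n)
     (fold gate_op (concat (map (expand 7 d) (rev (U \<sigma>)))) \<rho>))) else 0)"

lemma paccepts_verify:
  "paccepts UNIV (\<lambda>(n, b, \<sigma>). \<Sum>x\<leftarrow>[unary n, [b], \<sigma>]. length x) (verify_com H G)
    (\<lambda>(n, b, \<sigma>). input [unary n, [b], \<sigma>]) \<rho>
    (\<lambda>(n, b, \<sigma>). weight (if b then m n else 0) n \<sigma> (\<rho> (n, b, \<sigma>)))"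
proof -
  let ?n = "\<lambda>i :: nat \<times> bool \<times> bool list. fst i"
  let ?b = "\<lambda>i :: nat \<times> bool \<times> bool list. fst (snd i)"
  let ?\<sigma> = "\<lambda>i :: nat \<times> bool \<times> bool list. snd (snd i)"
  define sz where "sz i = (\<Sum>x\<leftarrow>[unary (?n i), [?b i], ?\<sigma> i]. length x)" for i
  have pn: "pbd UNIV sz ?n" by (rule pbd_le[OF pbd_sz]) (simp add: sz_def)
  have p\<sigma>: "pbd UNIV sz (\<lambda>i. length (?\<sigma> i))" by (rule pbd_le[OF pbd_sz]) (simp add: sz_def)
  note pm = pbd_circuit(2)[OF p\<sigma>]
  note pg = pbd_circuit(1)[OF p\<sigma>]
  define s0 where "s0 i = empty_store(0 := unary (?n i), 1 := [?b i], 2 := ?\<sigma> i)" for i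
  define s1 where "s1 i = empty_store(1 := [?b i], 2 := ?\<sigma> i, H + 11 := unary (?n i))" for i
  define s2 where "s2 i = empty_store(2 := ?\<sigma> i, H + 11 := unary (?n i), H + 9 := [?b i])" for i
  define s3 where "s3 i = empty_store(H + 8 := ?\<sigma> i, H + 11 := unary (?n i), H + 9 := [?b i])" for i
  define s4 where "s4 i = empty_store(H + 9 := [?b i],
    H + 12 := unary (length (?\<sigma> i) - ?n i + of_bool (length (?\<sigma> i) < ?n i)),
    H + 5 := gate_codes (U (?\<sigma> i)), H + 7 := unary (m (length (?\<sigma> i))))" for i
  define s5 where "s5 i = (s4 i)(H + 4 := unary (if ?b i then m (length (?\<sigma> i)) else 0))" for i
  have ne: "Suc 0 \<noteq> H + k" "2 \<noteq> H + k" "0 \<noteq> H + k" for k using H3 by auto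
  note ne' = ne ne[symmetric]
  have 1: "pexec UNIV sz (move 0 (H + 11)) s0 \<rho> (\<lambda>i. [(s1 i, \<rho> i)])"
    by (rule pexec_det_cong[OF pexec_move]) (use pn ne' in \<open>auto simp: s0_def s1_def fun_eq_iff\<close>)
  have 2: "pexec UNIV sz (move 1 (H + 9)) s1 \<rho> (\<lambda>i. [(s2 i, \<rho> i)])"
    by (rule pexec_det_cong[OF pexec_move]) (use ne' pbd_const[of UNIV sz 1] in \<open>auto simp: s1_def s2_def fun_eq_iff\<close>)
  have 3: "pexec UNIV sz (transfer 2 (H + 3) (H + 8)) s2 \<rho> (\<lambda>i. [(s3 i, \<rho> i)])"
    by (rule pexec_det_cong[OF pexec_transfer]) (use ne' p\<sigma> in \<open>auto simp: s2_def s3_def fun_eq_iff\<close>)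
  have 4: "pexec UNIV sz (prepare_check H G) s3 \<rho> (\<lambda>i. [(s4 i, \<rho> i)])"
    by (rule pexec_det_cong[OF pexec_prepare_check[where n = ?n and \<sigma> = ?\<sigma>, OF pn _ p\<sigma>]]) (auto simp: s3_def s4_def fun_eq_iff)
  have 5: "pexec UNIV sz (IfTop (H + 9) (dup (H + 7) (H + 3) (H + 4)) Skip) s4 \<rho> (\<lambda>i. [(s5 i, \<rho> i)])"
  proof (rule pexecI)
    fix i
    have "exec (if top_bit (s4 i (H + 9)) then dup (H + 7) (H + 3) (H + 4) else Skip) (s4 i) (\<rho> i)
        (11 * m (length (?\<sigma> i)) + 3) [(s5 i, \<rho> i)]"
    proof (cases "?b i")
      case True
      then have "top_bit (s4 i (H + 9))" by (simp add: s4_def top_bit_def)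
      then show ?thesis
        using True
        by - (simp, rule exec_cong[OF exec_dup], auto simp: s4_def s5_def)
    next
      case False
      then have "\<not> top_bit (s4 i (H + 9))" by (simp add: s4_def top_bit_def)
      then show ?thesis
        using False by - (simp, rule exec_cong[OF exec_Skip], auto simp: s4_def s5_def fun_eq_iff)
    qed
    then show "exec (IfTop (H + 9) (dup (H + 7) (H + 3) (H + 4)) Skip) (s4 i) (\<rho> i)
        (Suc (11 * m (length (?\<sigma> i)) + 3)) [(s5 i, \<rho> i)]" by (rule exec_IfTop)
  qed (intro pbd_intros pm)
  \<comment> \<open>The program takes \<open>m (length \<sigma>)\<close> as block size and offset.
    This can differ from \<open>m n\<close> only if the length check has failed, and then both sides
    are 0.\<close>
  have 6: "paccepts UNIV sz (finish_check H) s5 \<rho> (\<lambda>i. weight (if ?b i then m (?n i) else 0) (?n i) (?\<sigma> i) (\<rho> i))"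
  proof (rule paccepts_cong[OF paccepts_finish_check[where gs = "\<lambda>i. U (?\<sigma> i)" and l = "\<lambda>i. m (length (?\<sigma> i))"
        and d = "\<lambda>i. if ?b i then m (length (?\<sigma> i)) else 0"]])
    show "pbd UNIV sz (\<lambda>i. if ?b i then m (length (?\<sigma> i)) else 0)" by (intro pbd_intros pm)
  qed (use pg pm in \<open>auto simp: s4_def s5_def weight_def\<close>)
  have s0: "s0 = (\<lambda>(n, b, \<sigma>). input [unary n, [b], \<sigma>])"
    by (auto simp: s0_def input_simps fun_eq_iff)
  have "paccepts UNIV sz (verify_com H G) s0 \<rho> (\<lambda>i. weight (if ?b i then m (?n i) else 0) (?n i) (?\<sigma> i) (\<rho> i))"
    unfolding verify_com_def
    by (rule paccepts_Seq_det[OF 1 paccepts_Seq_det[OF 2 paccepts_Seq_det[OF 3 paccepts_Seq_det[OF 4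
        paccepts_Seq_det[OF 5 6]]]]])
  then show ?thesis unfolding s0 sz_def by (simp add: case_prod_unfold)
qed

lemma pexec_gen2:
  "pexec UNIV (\<lambda>sk. \<Sum>x\<leftarrow>[sk]. length x) (gen2_com H G) (\<lambda>sk. input [sk]) \<rho>
    (\<lambda>sk. [(empty_store(0 := unary (m (length (evens sk)) + m (length (odds sk)))),
       fold gate_op (concat (map (expand 1 (m (length (evens sk)))) (U (odds sk))))
         (fold gate_op (concat (map (expand 1 0) (U (evens sk)))) (\<rho> sk)))])"
proof -
  define sz :: "bool list \<Rightarrow> nat" where "sz sk = (\<Sum>x\<leftarrow>[sk]. length x)" for sk
  have le: "length (evens sk) \<le> length sk \<and> length (odds sk) \<le> length sk" for sk
    by (induction sk rule: evens.induct) auto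
  have psk: "pbd UNIV sz length" by (rule pbd_le[OF pbd_sz]) (simp add: sz_def)
  have p0: "pbd UNIV sz (\<lambda>sk. length (evens sk))" by (rule pbd_le[OF psk]) (use le in auto)
  have p1: "pbd UNIV sz (\<lambda>sk. length (odds sk))" by (rule pbd_le[OF psk]) (use le in auto)
  note pm = pbd_circuit(2)[OF p0] pbd_circuit(2)[OF p1]
  note pg = pbd_circuit(1)[OF p0] pbd_circuit(1)[OF p1]
  let ?m0 = "\<lambda>sk. m (length (evens sk))"
  let ?m1 = "\<lambda>sk. m (length (odds sk))"
  define \<rho>1 where "\<rho>1 sk = fold gate_op (concat (map (expand 1 0) (U (evens sk)))) (\<rho> sk)" for sk
  define \<rho>2 where "\<rho>2 sk = fold gate_op (concat (map (expand 1 (?m0 sk)) (U (odds sk)))) (\<rho>1 sk)" for sk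
  define s0 where "s0 sk = empty_store(0 := sk)" for sk
  define s1 where "s1 sk = empty_store(H + 8 := rev (evens sk), H + 9 := rev (odds sk))" for sk
  define s2 where "s2 sk = empty_store(H + 9 := rev (odds sk), H + 5 := gate_codes (U (evens sk)), H + 7 := unary (?m0 sk))" for sk
  define s3 where "s3 sk = empty_store(H + 9 := rev (odds sk), H + 7 := unary (?m0 sk))" for sk
  define s4 where "s4 sk = empty_store(H + 9 := rev (odds sk), H + 4 := unary (?m0 sk))" for sk
  define s5 where "s5 sk = empty_store(H + 5 := gate_codes (U (odds sk)), H + 4 := unary (?m0 sk), H + 7 := unary (?m1 sk))" for sk
  define s6 where "s6 sk = empty_store(H + 4 := unary (?m0 sk), H + 7 := unary (?m1 sk))" for sk
  define s7 where "s7 sk = empty_store(0 := unary (?m1 sk), H + 4 := unary (?m0 sk))" for sk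
  have ne: "0 \<noteq> H + k" for k using H3 by auto
  note ne' = ne ne[symmetric]
  have 1: "pexec UNIV sz (deinterleave 0 (H + 8) (H + 9)) s0 \<rho> (\<lambda>sk. [(s1 sk, \<rho> sk)])"
    by (rule pexec_det_cong[OF pexec_deinterleave]) (use psk ne' in \<open>auto simp: s0_def s1_def fun_eq_iff\<close>)
  have 2: "pexec UNIV sz (describe G H (H + 8) (H + 5) (H + 7) (H + 3) H) s1 \<rho> (\<lambda>sk. [(s2 sk, \<rho> sk)])"
    by (rule pexec_det_cong[OF pexec_describe[where k = evens]]) (use p0 in \<open>auto simp: s1_def s2_def fun_eq_iff\<close>)
  have 3: "pexec UNIV sz (interp 1 (H + 5) (H + 4) (H + 1) (H + 2) (H + 3) H) s2 \<rho> (\<lambda>sk. [(s3 sk, \<rho>1 sk)])"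
    by (rule pexec_det_cong[OF pexec_interp[where gs = "\<lambda>sk. U (evens sk)" and d = "\<lambda>_. 0"]])
      (use pg in \<open>auto simp: s2_def s3_def \<rho>1_def fun_eq_iff intro: pbd_const\<close>)
  have 4: "pexec UNIV sz (move (H + 7) (H + 4)) s3 \<rho>1 (\<lambda>sk. [(s4 sk, \<rho>1 sk)])"
    by (rule pexec_det_cong[OF pexec_move]) (use pm in \<open>auto simp: s3_def s4_def fun_eq_iff\<close>)
  have 5: "pexec UNIV sz (describe G H (H + 9) (H + 5) (H + 7) (H + 3) H) s4 \<rho>1 (\<lambda>sk. [(s5 sk, \<rho>1 sk)])"
    by (rule pexec_det_cong[OF pexec_describe[where k = odds]]) (use p1 in \<open>auto simp: s4_def s5_def fun_eq_iff\<close>)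
  have 6: "pexec UNIV sz (interp 1 (H + 5) (H + 4) (H + 1) (H + 2) (H + 3) H) s5 \<rho>1 (\<lambda>sk. [(s6 sk, \<rho>2 sk)])"
    by (rule pexec_det_cong[OF pexec_interp[where gs = "\<lambda>sk. U (odds sk)" and d = ?m0]])
      (use pg pm in \<open>auto simp: s5_def s6_def \<rho>2_def fun_eq_iff\<close>)
  have 7: "pexec UNIV sz (move (H + 7) 0) s6 \<rho>2 (\<lambda>sk. [(s7 sk, \<rho>2 sk)])"
    by (rule pexec_det_cong[OF pexec_move]) (use pm ne' in \<open>auto simp: s6_def s7_def fun_eq_iff\<close>)
  have 8: "pexec UNIV sz (move (H + 4) 0) s7 \<rho>2 (\<lambda>sk. [(empty_store(0 := unary (?m0 sk + ?m1 sk)), \<rho>2 sk)])"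
    by (rule pexec_det_cong[OF pexec_move]) (use pm ne' in \<open>auto simp: s7_def fun_eq_iff unary_append\<close>)
  have s0: "s0 = (\<lambda>sk. input [sk])" by (auto simp: s0_def input_simps)
  have "pexec UNIV sz (gen2_com H G) s0 \<rho> (\<lambda>sk. [(empty_store(0 := unary (?m0 sk + ?m1 sk)), \<rho>2 sk)])"
    unfolding gen2_com_def
    by (rule pexec_Seq_det[OF 1 pexec_Seq_det[OF 2 pexec_Seq_det[OF 3 pexec_Seq_det[OF 4
        pexec_Seq_det[OF 5 pexec_Seq_det[OF 6 pexec_Seq_det[OF 7 8]]]]]]])
  then show ?thesis unfolding s0 \<rho>2_def \<rho>1_def sz_def .
qed

end

lemma pexec_sign:
  "pexec UNIV (\<lambda>(sk, b). \<Sum>x\<leftarrow>[sk, [b]]. length x) sign_com (\<lambda>(sk, b). input [sk, [b]]) \<rho>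
    (\<lambda>(sk, b). [(empty_store(0 := if b then odds sk else evens sk, 1 := [b],
       (if b then 2 else 3) := (if b then rev (evens sk) else rev (odds sk))), \<rho> (sk, b))])"
proof -
  let ?sk = "\<lambda>i :: bool list \<times> bool. fst i"
  let ?b = "\<lambda>i :: bool list \<times> bool. snd i"
  define sz where "sz i = (\<Sum>x\<leftarrow>[?sk i, [?b i]]. length x)" for i
  have psk: "pbd UNIV sz (\<lambda>i. length (?sk i))" by (rule pbd_le[OF pbd_sz]) (simp add: sz_def)
  have le: "length (evens sk) \<le> length sk \<and> length (odds sk) \<le> length sk" for sk
    by (induction sk rule: evens.induct) auto
  define s0 where "s0 i = empty_store(0 := ?sk i, 1 := [?b i])" for i
  define s1 where "s1 i = empty_store(1 := [?b i], 2 := rev (evens (?sk i)), 3 := rev (odds (?sk i)))" for i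
  define s2 where "s2 i = empty_store(0 := if ?b i then odds (?sk i) else evens (?sk i), 1 := [?b i],
       (if ?b i then 2 else 3) := (if ?b i then rev (evens (?sk i)) else rev (odds (?sk i))))" for i
  have 1: "pexec UNIV sz (deinterleave 0 2 3) s0 \<rho> (\<lambda>i. [(s1 i, \<rho> i)])"
    by (rule pexec_det_cong[OF pexec_deinterleave]) (use psk in \<open>auto simp: s0_def s1_def fun_eq_iff\<close>)
  have 2: "pexec UNIV sz (IfTop 1 (move 3 0) (move 2 0)) s1 \<rho> (\<lambda>i. [(s2 i, \<rho> i)])"
  proof (rule pexecI)
    fix i
    have "exec (if top_bit (s1 i 1) then move 3 0 else move 2 0) (s1 i) (\<rho> i) (5 * length (?sk i) + 1) [(s2 i, \<rho> i)]"
    proof (cases "?b i")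
      case True
      then have "top_bit (s1 i 1)" by (simp add: s1_def top_bit_def)
      then show ?thesis
        using True le[of "?sk i"] by - (simp, rule exec_cong[OF exec_move], auto simp: s1_def s2_def fun_eq_iff)
    next
      case False
      then have "\<not> top_bit (s1 i 1)" by (simp add: s1_def top_bit_def)
      then show ?thesis
        using False le[of "?sk i"] by - (simp, rule exec_cong[OF exec_move], auto simp: s1_def s2_def fun_eq_iff)
    qed
    then show "exec (IfTop 1 (move 3 0) (move 2 0)) (s1 i) (\<rho> i) (Suc (5 * length (?sk i) + 1)) [(s2 i, \<rho> i)]"
      by (rule exec_IfTop)
  qed (intro pbd_intros psk)
  have "pexec UNIV sz sign_com s0 \<rho> (\<lambda>i. [(s2 i, \<rho> i)])"
    unfolding sign_com_def by (rule pexec_Seq_det[OF 1 2])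
  moreover have "s0 = (\<lambda>(sk, b). input [sk, [b]])" by (auto simp: s0_def input_simps fun_eq_iff)
  ultimately show ?thesis unfolding sz_def s2_def by (simp add: case_prod_unfold)
qed

text \<open>The four parts follow the order in which two coin flips list their branches, so that the
  final branches agree as lists.\<close>

primrec coins :: "nat \<Rightarrow> bool list \<Rightarrow> bool list list" where
  "coins 0 xs = [xs]"
| "coins (Suc n) xs = coins n (False # False # xs) @ coins n (True # False # xs) @
     coins n (False # True # xs) @ coins n (True # True # xs)"

lemma exec_two_coins:
  "exec (Seq (Pop 1) (Seq (Flip 0) (Flip 0))) s \<rho> 5
    (map (\<lambda>(b, c). (s(1 := tl (s 1), 0 := b # c # s 0), \<lambda>x y. \<rho> x y / 4))
      [(False, False), (True, False), (False, True), (True, True)])"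
  by (simp add: execs_def numeral_eq_Suc)

lemma exec_gen1_loop:
  "s 1 = unary n \<Longrightarrow> exec (While 1 (Seq (Pop 1) (Seq (Flip 0) (Flip 0)))) s \<rho> (6 * n + 1)
    (map (\<lambda>sk. (s(1 := [], 0 := sk), \<lambda>x y. \<rho> x y / 4 ^ n)) (coins n (s 0)))"
proof (induction n arbitrary: s \<rho>)
  case 0
  then have e: "s(1 := [], 0 := s 0) = s" by (auto simp: fun_eq_iff)
  show ?case unfolding coins.simps list.map e using exec_While_done[of s 1] 0 by simp
next
  case (Suc n)
  let ?f = "\<lambda>(s', \<rho>'). map (\<lambda>sk. (s'(1 := [], 0 := sk), \<lambda>x y. \<rho>' x y / 4 ^ n)) (coins n (s' 0))"
  have "exec (While 1 (Seq (Pop 1) (Seq (Flip 0) (Flip 0)))) s \<rho> (Suc (5 + (6 * n + 1)))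
      (concat (map ?f (map (\<lambda>(b, c). (s(1 := tl (s 1), 0 := b # c # s 0), \<lambda>x y. \<rho> x y / 4))
        [(False, False), (True, False), (False, True), (True, True)])))"
  proof (rule exec_While_step[OF _ exec_two_coins])
    show "s 1 \<noteq> []" using Suc.prems by (simp add: unary_Suc)
    fix s' \<rho>' assume "(s', \<rho>') \<in> set (map (\<lambda>(b, c). (s(1 := tl (s 1), 0 := b # c # s 0), \<lambda>x y. \<rho> x y / 4))
        [(False, False), (True, False), (False, True), (True, True)])"
    then have "s' 1 = unary n" using Suc.prems by auto
    then show "exec (While 1 (Seq (Pop 1) (Seq (Flip 0) (Flip 0)))) s' \<rho>' (6 * n + 1) (?f (s', \<rho>'))"
      unfolding prod.case by (rule Suc.IH)
  qed
  then have "exec (While 1 (Seq (Pop 1) (Seq (Flip 0) (Flip 0)))) s \<rho> (Suc (5 + (6 * n + 1)))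
    (map (\<lambda>sk. (s(1 := [], 0 := sk), \<lambda>x y. \<rho> x y / 4 ^ Suc n)) (coins (Suc n) (s 0)))"
    by (simp add: fun_upd_twist fun_upd_upd)
  then show ?case by (rule execs_mono) simp
qed

lemma pexec_gen1:
  "pexec UNIV (\<lambda>n. \<Sum>x\<leftarrow>[unary n]. length x) gen1_com (\<lambda>n. input [unary n]) \<rho>
    (\<lambda>n. map (\<lambda>sk. (empty_store(0 := sk), \<lambda>x y. \<rho> n x y / 4 ^ n)) (coins n []))"
proof (rule pexecI)
  fix n
  let ?s = "empty_store(1 := unary n)"
  have 1: "exec (move 0 1) (input [unary n]) (\<rho> n) (5 * n + 1) [(?s, \<rho> n)]"
    by (rule exec_cong[OF exec_move]) (auto simp: input_simps fun_eq_iff)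
  have "?s(1 := [], 0 := sk) = empty_store(0 := sk)" for sk by (auto simp: fun_eq_iff)
  then have 2: "exec (While 1 (Seq (Pop 1) (Seq (Flip 0) (Flip 0)))) ?s (\<rho> n) (6 * n + 1)
      (map (\<lambda>sk. (empty_store(0 := sk), \<lambda>x y. \<rho> n x y / 4 ^ n)) (coins n []))"
    using exec_gen1_loop[of ?s n "\<rho> n"] by simp
  show "exec gen1_com (input [unary n]) (\<rho> n) (Suc (5 * n + 1 + (6 * n + 1)))
      (map (\<lambda>sk. (empty_store(0 := sk), \<lambda>x y. \<rho> n x y / 4 ^ n)) (coins n []))"
    unfolding gen1_com_def by (rule exec_Seq_det[OF 1 2])
next
  have "pbd UNIV (\<lambda>n. \<Sum>x\<leftarrow>[unary n]. length x) (\<lambda>n. n)"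
    by (rule pbd_le[OF pbd_sz]) simp
  then show "pbd UNIV (\<lambda>n. \<Sum>x\<leftarrow>[unary n]. length x) (\<lambda>n. Suc (5 * n + 1 + (6 * n + 1)))"
    by (intro pbd_intros)
qed

lemma sum_lists_Suc:
  fixes F :: "bool list \<Rightarrow> real"
  shows "(\<Sum>xs | length xs = Suc n. F xs) = (\<Sum>xs | length xs = n. F (False # xs) + F (True # xs))"
    and "(\<Sum>xs | length xs = Suc n. F xs) = (\<Sum>xs | length xs = n. F (xs @ [False]) + F (xs @ [True]))"
proof -
  have "(\<Sum>xs | length xs = Suc n. F xs) = (\<Sum>(xs, b)\<in>{xs. length xs = n} \<times> UNIV. F (b # xs))"
    by (rule sum.reindex_bij_witness[where i = "\<lambda>(xs, b). b # xs" and j = "\<lambda>xs. (tl xs, hd xs)"])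
      (auto simp: length_Suc_conv)
  then show "(\<Sum>xs | length xs = Suc n. F xs) = (\<Sum>xs | length xs = n. F (False # xs) + F (True # xs))"
    by (simp add: sum.cartesian_product[symmetric] UNIV_bool)
  have "(\<Sum>xs | length xs = Suc n. F xs) = (\<Sum>(xs, b)\<in>{xs. length xs = n} \<times> UNIV. F (xs @ [b]))"
    by (rule sum.reindex_bij_witness[where i = "\<lambda>(xs, b). xs @ [b]" and j = "\<lambda>xs. (butlast xs, last xs)"])
      (auto simp: append_butlast_last_id simp flip: length_greater_0_conv)
  then show "(\<Sum>xs | length xs = Suc n. F xs) = (\<Sum>xs | length xs = n. F (xs @ [False]) + F (xs @ [True]))"
    by (simp add: sum.cartesian_product[symmetric] UNIV_bool)
qed

text \<open>The first coins end up deepest in the stack, so strings are split at their end, by the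
  second form of \<open>sum_lists_Suc\<close>.\<close>

lemma sum_coins:
  fixes F :: "bool list \<Rightarrow> real"
  shows "(\<Sum>sk\<leftarrow>coins n xs. F sk) = (\<Sum>ys | length ys = 2 * n. F (ys @ xs))"
proof (induction n arbitrary: xs)
  case (Suc n)
  have "(\<Sum>ys | length ys = 2 * Suc n. F (ys @ xs)) = (\<Sum>ys | length ys = 2 * n.
      F (ys @ False # False # xs) + F (ys @ True # False # xs) + (F (ys @ False # True # xs) + F (ys @ True # True # xs)))"
    by (simp add: sum_lists_Suc(2) sum.distrib)
  then show ?case by (simp add: Suc sum.distrib)
qed simp

text \<open>Deinterleaving is a bijection onto pairs of keys, so a uniform secret key amounts to two
  independent uniform keys.\<close>

lemma sum_interleaved:
  fixes F :: "bool list \<Rightarrow> bool list \<Rightarrow> real"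
  shows "(\<Sum>sk | length sk = 2 * n. F (evens sk) (odds sk)) = (\<Sum>k0 | length k0 = n. \<Sum>k1 | length k1 = n. F k0 k1)"
proof (induction n arbitrary: F)
  case (Suc n)
  have "(\<Sum>sk | length sk = 2 * Suc n. F (evens sk) (odds sk)) = (\<Sum>sk | length sk = 2 * n.
      F (False # evens sk) (False # odds sk) + F (False # evens sk) (True # odds sk) +
      (F (True # evens sk) (False # odds sk) + F (True # evens sk) (True # odds sk)))"
    by (simp add: sum_lists_Suc(1) sum.distrib)
  also have "\<dots> = (\<Sum>k0 | length k0 = n. \<Sum>k1 | length k1 = n.
      F (False # k0) (False # k1) + F (False # k0) (True # k1) +
      (F (True # k0) (False # k1) + F (True # k0) (True # k1)))"
    by (rule Suc)
  also have "\<dots> = (\<Sum>k0 | length k0 = Suc n. \<Sum>k1 | length k1 = Suc n. F k0 k1)"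
    by (simp add: sum_lists_Suc(1) sum.distrib)
  finally show ?case .
qed simp

lemma length_evens_odds: "length sk = 2 * n \<Longrightarrow> length (evens sk) = n \<and> length (odds sk) = n"
proof (induction sk arbitrary: n rule: evens.induct)
  case (3 x y zs)
  then show ?case by (cases n) auto
qed auto

lemma length_coins: "sk \<in> set (coins n xs) \<Longrightarrow> length sk = 2 * n + length xs"
  by (induction n arbitrary: xs) fastforce+


section \<open>The reduction\<close>

text \<open>A failed condition is only noted in \<open>bad\<close>, so all branches run through the
  same code and the last check rejects those with nonempty \<open>bad\<close>.\<close>

definition test :: "bool \<Rightarrow> nat \<Rightarrow> com" where
  "test c bad = (if c then IfTop 0 Skip (Push bad True) else IfTop 0 (Push bad True) Skip)"

lemma exec_test:
  "exec (test c bad) s \<rho> 2 [(s(bad := (if top_bit (s 0) = c then [] else [True]) @ s bad), \<rho>)]"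
  (is "exec _ _ _ _ [(?s, _)]")
proof (cases c)
  case True
  then have t: "test c bad = IfTop 0 Skip (Push bad True)" by (simp add: test_def)
  show ?thesis
    unfolding t by (rule exec_cong[OF exec_IfTop[where N = 1 and L = "[(?s, \<rho>)]"]])
      (use True in \<open>auto intro!: exec_cong[OF exec_Push] exec_cong[OF exec_Skip]\<close>)
next
  case False
  then have t: "test c bad = IfTop 0 (Push bad True) Skip" by (simp add: test_def)
  show ?thesis
    unfolding t by (rule exec_cong[OF exec_IfTop[where N = 1 and L = "[(?s, \<rho>)]"]])
      (use False in \<open>auto intro!: exec_cong[OF exec_Push] exec_cong[OF exec_Skip]\<close>)
qed

lemma pexec_test:
  "pexec I sz (test c bad) s \<rho>
    (\<lambda>i. [((s i)(bad := (if top_bit (s i 0) = c then [] else [True]) @ s i bad), \<rho> i)])"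
  by (rule pexecI[OF exec_test]) (intro pbd_intros)

definition attack_end :: "bool \<Rightarrow> nat \<Rightarrow> com \<Rightarrow> com" where
  "attack_end b H G = Seq (test (\<not> b) (H + 12)) (Seq (transfer 1 (H + 3) (H + 8)) (Seq (clear_below H)
     (Seq (move (H + 15) (H + 4)) (Seq (prepare_check H G) (finish_check H)))))"

text \<open>The message is tested before the signature takes its place in register 0. A branch that
  asked for the other message runs on with the same key, but it is already marked for
  rejection.\<close>

definition attack_mid :: "bool \<Rightarrow> nat \<Rightarrow> com \<Rightarrow> com \<Rightarrow> com" where
  "attack_mid b H G A2 = Seq (test b (H + 12)) (Seq (clear 0) (Seq (move (H + 16) 0)
     (Seq A2 (attack_end b H G))))"

text \<open>Above the adversary's registers, \<open>H + 11\<close> keeps the security parameter,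
  \<open>H + 14\<close> the length of a public key, \<open>H + 15\<close> the position of the spare
  copy, \<open>H + 16\<close> the revealed key in reverse and \<open>H + 12\<close> the rejection
  mark. The circuit from the advice runs before \<open>A1\<close>, which then sees the registers and
  qubits of the real game.\<close>

definition attack_com :: "bool \<Rightarrow> nat \<Rightarrow> com \<Rightarrow> com \<Rightarrow> com \<Rightarrow> com" where
  "attack_com b H G A1 A2 = Seq (transfer 1 (H + 3) (H + 5)) (Seq (move 0 (H + 11))
     (Seq (read_unary (H + 5) (H + 14) H) (Seq (read_unary (H + 5) (H + 15) H)
     (Seq (read_bits (H + 5) (H + 16) H) (Seq (interp 1 (H + 5) (H + 4) (H + 1) (H + 2) (H + 3) H)
     (Seq (dup (H + 11) (H + 3) 0) (Seq (move (H + 14) 1) (Seq A1 (attack_mid b H G A2)))))))))"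

text \<open>The numbers \<open>l\<close> and \<open>d\<close> are included so that the program need
  not compute them. The gates come last and without delimiter, because \<open>interp\<close> reads
  until its register is empty.\<close>

definition attack_advice :: "nat \<Rightarrow> nat \<Rightarrow> bool list \<Rightarrow> nat gate list \<Rightarrow> bool list" where
  "attack_advice l d k gs = unary l @ False # unary d @ False # encode_bits k @ gate_codes gs"

context generator begin

lemma paccepts_attack_end:
  fixes s :: "'i \<Rightarrow> store"
  assumes n: "pbd I sz n" and d: "pbd I sz d"
    and B: "pbd I sz B" "\<And>i r. i \<in> I \<Longrightarrow> length (s i r) \<le> B i"
  shows "paccepts I sz (attack_end b H G)
    (\<lambda>i. overlay H (s i) (empty_store(H + 11 := unary (n i), H + 15 := unary (d i), H + 12 := flag i))) \<rho>
    (\<lambda>i. if flag i = [] \<and> top_bit (s i 0) \<noteq> b then weight (d i) (n i) (s i 1) (\<rho> i) else 0)"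
proof -
  define flag' where "flag' i = (if top_bit (s i 0) = (\<not> b) then [] else [True]) @ flag i" for i
  define len where "len i = unary (length (s i 1) - n i + of_bool (length (s i 1) < n i))" for i
  define t0 where "t0 i = overlay H (s i) (empty_store(H + 11 := unary (n i), H + 15 := unary (d i), H + 12 := flag i))" for i
  define t1 where "t1 i = overlay H (s i) (empty_store(H + 11 := unary (n i), H + 15 := unary (d i), H + 12 := flag' i))" for i
  define t2 where "t2 i = overlay H ((s i)(1 := [])) (empty_store(H + 11 := unary (n i), H + 15 := unary (d i),
    H + 12 := flag' i, H + 8 := s i 1))" for i
  define t3 where "t3 i = empty_store(H + 11 := unary (n i), H + 15 := unary (d i), H + 12 := flag' i, H + 8 := s i 1)" for i
  define t4 where "t4 i = empty_store(H + 11 := unary (n i), H + 4 := unary (d i), H + 12 := flag' i, H + 8 := s i 1)" for i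
  define t5 where "t5 i = empty_store(H + 4 := unary (d i), H + 12 := len i @ flag' i,
    H + 5 := gate_codes (U (s i 1)), H + 7 := unary (m (length (s i 1))))" for i
  have ne: "Suc 0 \<noteq> H + k" "0 \<noteq> H + k" for k using H3 by auto
  note ne' = ne ne[symmetric]
  have low: "0 < H" "Suc 0 < H" "0 \<noteq> H" using H3 by auto
  have p\<sigma>: "pbd I sz (\<lambda>i. length (s i 1))" by (rule pbd_le[OF B(1)]) (rule B(2))
  note pm = pbd_circuit(2)[OF p\<sigma>] and pg = pbd_circuit(1)[OF p\<sigma>]
  have 1: "pexec I sz (test (\<not> b) (H + 12)) t0 \<rho> (\<lambda>i. [(t1 i, \<rho> i)])"
    by (rule pexec_det_cong[OF pexec_test]) (use low in \<open>auto simp: t0_def t1_def flag'_def overlay_def fun_eq_iff\<close>)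
  have 2: "pexec I sz (transfer 1 (H + 3) (H + 8)) t1 \<rho> (\<lambda>i. [(t2 i, \<rho> i)])"
    by (rule pexec_det_cong[OF pexec_transfer])
      (use p\<sigma> ne' low in \<open>auto simp: t1_def t2_def overlay_def fun_eq_iff\<close>)
  have 3: "pexec I sz (clear_below H) t2 \<rho> (\<lambda>i. [(t3 i, \<rho> i)])"
    by (rule pexec_det_cong[OF pexec_clear_below[OF B(1)]])
      (use B(2) in \<open>auto simp: t2_def t3_def overlay_def fun_eq_iff\<close>)
  have 4: "pexec I sz (move (H + 15) (H + 4)) t3 \<rho> (\<lambda>i. [(t4 i, \<rho> i)])"
    by (rule pexec_det_cong[OF pexec_move]) (use d in \<open>auto simp: t3_def t4_def fun_eq_iff\<close>)
  have 5: "pexec I sz (prepare_check H G) t4 \<rho> (\<lambda>i. [(t5 i, \<rho> i)])"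
    by (rule pexec_det_cong[OF pexec_prepare_check[where n = n and \<sigma> = "\<lambda>i. s i 1", OF n _ p\<sigma>]])
      (auto simp: t4_def t5_def len_def fun_eq_iff)
  have 6: "paccepts I sz (finish_check H) t5 \<rho>
      (\<lambda>i. if flag i = [] \<and> top_bit (s i 0) \<noteq> b then weight (d i) (n i) (s i 1) (\<rho> i) else 0)"
    by (rule paccepts_cong[OF paccepts_finish_check[where gs = "\<lambda>i. U (s i 1)" and l = "\<lambda>i. m (length (s i 1))" and d = d]])
      (use pg pm d in \<open>auto simp: t5_def len_def flag'_def weight_def\<close>)
  show ?thesis
    unfolding attack_end_def t0_def[symmetric]
    by (rule paccepts_Seq_det[OF 1 paccepts_Seq_det[OF 2 paccepts_Seq_det[OF 3 paccepts_Seq_det[OF 4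
        paccepts_Seq_det[OF 5 6]]]]])
qed

lemma paccepts_attack_mid:
  fixes s :: "'i \<Rightarrow> store"
  assumes A2: "regs_below H A2" "\<And>i. i \<in> I \<Longrightarrow> halts_within (N i) A2 ((s i)(0 := k i))" "pbd I sz N"
    and n: "pbd I sz n" and d: "pbd I sz d" and k: "pbd I sz (\<lambda>i. length (k i))"
    and B: "pbd I sz B" "\<And>i r. i \<in> I \<Longrightarrow> length (s i r) \<le> B i"
  shows "paccepts I sz (attack_mid b H G A2)
    (\<lambda>i. overlay H (s i) (empty_store(H + 11 := unary (n i), H + 15 := unary (d i), H + 16 := rev (k i)))) \<rho>
    (\<lambda>i. \<Sum>x\<leftarrow>branches A2 ((s i)(0 := k i)) (\<rho> i).
       if top_bit (s i 0) = b \<and> top_bit (fst x 0) \<noteq> b then weight (d i) (n i) (fst x 1) (snd x) else 0)"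
proof -
  define flag where "flag i = (if top_bit (s i 0) = b then [] else [True])" for i
  define t0 where "t0 i = overlay H (s i) (empty_store(H + 11 := unary (n i), H + 15 := unary (d i), H + 16 := rev (k i)))" for i
  define t1 where "t1 i = overlay H (s i) (empty_store(H + 11 := unary (n i), H + 15 := unary (d i),
    H + 16 := rev (k i), H + 12 := flag i))" for i
  define t2 where "t2 i = overlay H ((s i)(0 := [])) (empty_store(H + 11 := unary (n i), H + 15 := unary (d i),
    H + 16 := rev (k i), H + 12 := flag i))" for i
  define base where "base i = empty_store(H + 11 := unary (n i), H + 15 := unary (d i), H + 12 := flag i)" for i
  define t3 where "t3 i = overlay H ((s i)(0 := k i)) (base i)" for i
  have ne: "0 \<noteq> H + j" for j using H3 by auto
  note ne' = ne ne[symmetric]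
  have low: "0 < H" "0 \<noteq> H" using H3 by auto
  have 1: "pexec I sz (test b (H + 12)) t0 \<rho> (\<lambda>i. [(t1 i, \<rho> i)])"
    by (rule pexec_det_cong[OF pexec_test]) (use low in \<open>auto simp: t0_def t1_def flag_def overlay_def fun_eq_iff\<close>)
  have 2: "pexec I sz (clear 0) t1 \<rho> (\<lambda>i. [(t2 i, \<rho> i)])"
    by (rule pexec_det_cong[OF pexec_clear])
      (use B low in \<open>auto simp: t1_def t2_def overlay_def fun_eq_iff intro: pbd_le[OF B(1)]\<close>)
  have 3: "pexec I sz (move (H + 16) 0) t2 \<rho> (\<lambda>i. [(t3 i, \<rho> i)])"
    by (rule pexec_det_cong[OF pexec_move])
      (use k ne' low in \<open>auto simp: t2_def t3_def base_def overlay_def fun_eq_iff\<close>)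
  let ?M = "\<lambda>i. branches A2 ((s i)(0 := k i)) (\<rho> i)"
  let ?h = "\<lambda>i (t, \<tau>). (overlay H t (base i), \<tau>)"
  have 4: "pexec I sz A2 t3 \<rho> (\<lambda>i. map (?h i) (?M i))"
    unfolding t3_def by (rule pexec_black_box[OF A2(2,3,1)])
  let ?J = "{(i, x). i \<in> I \<and> x \<in> set (?M i)}"
  let ?sz = "\<lambda>j. sz (fst j)"
  have sub: "fst ` ?J \<subseteq> I" by auto
  \<comment> \<open>Old lengths, plus the inserted signature, plus one bit per step of
    \<open>A2\<close>; this bounds the cost of clearing and checking afterwards.\<close>
  have len: "length (fst (snd j) r) \<le> B (fst j) + length (k (fst j)) + N (fst j)" if "j \<in> ?J" for j r
  proof -
    obtain i t \<tau> where j: "j = (i, t, \<tau>)" "i \<in> I" "(t, \<tau>) \<in> set (?M i)" using \<open>j \<in> ?J\<close> by auto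
    have "length (t r) \<le> (B i + length (k i)) + N i"
    proof (rule exec_length[OF halts_within_exec[OF A2(2)[OF j(2)]] _ j(3)])
      fix r' show "length (((s i)(0 := k i)) r') \<le> B i + length (k i)"
        using B(2)[OF j(2), of r'] by simp
    qed
    then show ?thesis using j by simp
  qed
  have 5: "paccepts ?J ?sz (attack_end b H G)
    (\<lambda>j. overlay H (fst (snd j)) (empty_store(H + 11 := unary (n (fst j)), H + 15 := unary (d (fst j)), H + 12 := flag (fst j))))
    (\<lambda>j. snd (snd j))
    (\<lambda>j. if flag (fst j) = [] \<and> top_bit (fst (snd j) 0) \<noteq> b then weight (d (fst j)) (n (fst j)) (fst (snd j) 1) (snd (snd j)) else 0)"
  proof (rule paccepts_attack_end[OF pbd_reindex[OF n sub] pbd_reindex[OF d sub] _ len])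
    show "pbd ?J ?sz (\<lambda>j. B (fst j) + length (k (fst j)) + N (fst j))"
      by (intro pbd_add pbd_reindex[OF B(1) sub] pbd_reindex[OF k sub] pbd_reindex[OF A2(3) sub])
  qed
  have "paccepts I sz (Seq A2 (attack_end b H G)) t3 \<rho> (\<lambda>i. \<Sum>x\<leftarrow>?M i.
      (\<lambda>j. if flag (fst j) = [] \<and> top_bit (fst (snd j) 0) \<noteq> b then weight (d (fst j)) (n (fst j)) (fst (snd j) 1) (snd (snd j)) else 0) (i, x))"
    by (rule paccepts_Seq[OF 4]) (use 5 in \<open>simp add: base_def case_prod_unfold\<close>)
  from paccepts_Seq_det[OF 1 paccepts_Seq_det[OF 2 paccepts_Seq_det[OF 3 this]]]
  show ?thesis
    unfolding attack_mid_def t0_def[symmetric]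
    by (rule paccepts_cong) (auto simp: flag_def intro!: arg_cong[where f = sum_list] map_cong)
qed

lemma paccepts_attack:
  fixes l d :: "nat \<Rightarrow> nat" and k :: "nat \<Rightarrow> bool list" and gs :: "nat \<Rightarrow> nat gate list" and \<rho> :: "nat \<Rightarrow> qop"
  defines "advice \<equiv> \<lambda>n. attack_advice (l n) (d n) (k n) (gs n)"
  defines "\<rho>1 \<equiv> \<lambda>n. fold gate_op (gs n) (\<rho> n)"
  assumes A1: "regs_below H A1" "\<And>n. halts_within (N1 n) A1 (input [unary n, unary (l n)])" "pbd UNIV (\<lambda>n. n) N1"
    and A2: "regs_below H A2" "pbd UNIV (\<lambda>n. n) N2"
      "\<And>n s \<tau>. (s, \<tau>) \<in> set (branches A1 (input [unary n, unary (l n)]) (\<rho>1 n)) \<Longrightarrow> halts_within (N2 n) A2 (s(0 := k n))"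
  shows "paccepts UNIV (\<lambda>n. \<Sum>x\<leftarrow>[unary n, advice n]. length x) (attack_com b H G A1 A2)
    (\<lambda>n. input [unary n, advice n]) \<rho>
    (\<lambda>n. \<Sum>x\<leftarrow>branches A1 (input [unary n, unary (l n)]) (\<rho>1 n).
       \<Sum>y\<leftarrow>branches A2 ((fst x)(0 := k n)) (snd x).
         if top_bit (fst x 0) = b \<and> top_bit (fst y 0) \<noteq> b then weight (d n) n (fst y 1) (snd y) else 0)"
proof -
  define sz where "sz n = (\<Sum>x\<leftarrow>[unary n, advice n]. length x)" for n
  have pn: "pbd UNIV sz (\<lambda>n. n)" by (rule pbd_le[OF pbd_sz]) (simp add: sz_def)
  have pa: "pbd UNIV sz (\<lambda>n. length (advice n))" by (rule pbd_le[OF pbd_sz]) (simp add: sz_def)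
  have pl: "pbd UNIV sz l" and pd: "pbd UNIV sz d" and pk: "pbd UNIV sz (\<lambda>n. length (k n))"
    and pg: "pbd UNIV sz (\<lambda>n. length (gate_codes (gs n)))"
    by (rule pbd_le[OF pa], simp add: advice_def attack_advice_def length_encode_bits)+
  note pN1 = pbd_trans[OF A1(3) pn] and pN2 = pbd_trans[OF A2(2) pn]
  define base where "base n = empty_store(H + 11 := unary n, H + 15 := unary (d n), H + 16 := rev (k n))" for n
  define t0 where "t0 n = empty_store(0 := unary n, 1 := advice n)" for n
  define t1 where "t1 n = empty_store(0 := unary n, H + 5 := advice n)" for n
  define t2 where "t2 n = empty_store(H + 11 := unary n, H + 5 := advice n)" for n
  define t3 where "t3 n = empty_store(H + 11 := unary n, H + 14 := unary (l n),
    H + 5 := unary (d n) @ False # encode_bits (k n) @ gate_codes (gs n))" for n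
  define t4 where "t4 n = empty_store(H + 11 := unary n, H + 14 := unary (l n), H + 15 := unary (d n),
    H + 5 := encode_bits (k n) @ gate_codes (gs n))" for n
  define t5 where "t5 n = empty_store(H + 11 := unary n, H + 14 := unary (l n), H + 15 := unary (d n),
    H + 16 := rev (k n), H + 5 := gate_codes (gs n))" for n
  define t6 where "t6 n = empty_store(H + 11 := unary n, H + 14 := unary (l n), H + 15 := unary (d n),
    H + 16 := rev (k n))" for n
  define t7 where "t7 n = (t6 n)(0 := unary n)" for n
  define t8 where "t8 n = overlay H (input [unary n, unary (l n)]) (base n)" for n
  have ne: "Suc 0 \<noteq> H + j" "0 \<noteq> H + j" for j using H3 by auto
  note ne' = ne ne[symmetric]
  have low: "0 < H" "Suc 0 < H" "0 \<noteq> H" "Suc 0 \<noteq> H" using H3 by auto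
  have 1: "pexec UNIV sz (transfer 1 (H + 3) (H + 5)) t0 \<rho> (\<lambda>n. [(t1 n, \<rho> n)])"
    by (rule pexec_det_cong[OF pexec_transfer]) (use pa ne' in \<open>auto simp: t0_def t1_def fun_eq_iff\<close>)
  have 2: "pexec UNIV sz (move 0 (H + 11)) t1 \<rho> (\<lambda>n. [(t2 n, \<rho> n)])"
    by (rule pexec_det_cong[OF pexec_move]) (use pn ne' in \<open>auto simp: t1_def t2_def fun_eq_iff\<close>)
  have 3: "pexec UNIV sz (read_unary (H + 5) (H + 14) H) t2 \<rho> (\<lambda>n. [(t3 n, \<rho> n)])"
    by (rule pexec_det_cong[OF pexec_read_unary[where n = l and
            xs = "\<lambda>n. unary (d n) @ False # encode_bits (k n) @ gate_codes (gs n)"]])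
      (use pl in \<open>auto simp: t2_def t3_def advice_def attack_advice_def fun_eq_iff\<close>)
  have 4: "pexec UNIV sz (read_unary (H + 5) (H + 15) H) t3 \<rho> (\<lambda>n. [(t4 n, \<rho> n)])"
    by (rule pexec_det_cong[OF pexec_read_unary[where n = d and xs = "\<lambda>n. encode_bits (k n) @ gate_codes (gs n)"]])
      (use pd in \<open>auto simp: t3_def t4_def fun_eq_iff\<close>)
  have 5: "pexec UNIV sz (read_bits (H + 5) (H + 16) H) t4 \<rho> (\<lambda>n. [(t5 n, \<rho> n)])"
    by (rule pexec_det_cong[OF pexec_read_bits[where ks = k and xs = "\<lambda>n. gate_codes (gs n)"]])
      (use pk in \<open>auto simp: t4_def t5_def fun_eq_iff\<close>)
  have 6: "pexec UNIV sz (interp 1 (H + 5) (H + 4) (H + 1) (H + 2) (H + 3) H) t5 \<rho> (\<lambda>n. [(t6 n, \<rho>1 n)])"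
    by (rule pexec_det_cong[OF pexec_interp[where gs = gs and d = "\<lambda>_. 0"]])
      (use pg in \<open>auto simp: t5_def t6_def \<rho>1_def concat_expand_1[unfolded One_nat_def] fun_eq_iff intro: pbd_const\<close>)
  have 7: "pexec UNIV sz (dup (H + 11) (H + 3) 0) t6 \<rho>1 (\<lambda>n. [(t7 n, \<rho>1 n)])"
    by (rule pexec_det_cong[OF pexec_dup[where n = "\<lambda>n. n"]]) (use pn ne' in \<open>auto simp: t6_def t7_def fun_eq_iff\<close>)
  have 8: "pexec UNIV sz (move (H + 14) 1) t7 \<rho>1 (\<lambda>n. [(t8 n, \<rho>1 n)])"
    by (rule pexec_det_cong[OF pexec_move])
      (use pl ne' low in \<open>auto simp: t6_def t7_def t8_def base_def overlay_def input_simps fun_eq_iff\<close>)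
  let ?M = "\<lambda>n. branches A1 (input [unary n, unary (l n)]) (\<rho>1 n)"
  let ?h = "\<lambda>n (t, \<tau>). (overlay H t (base n), \<tau>)"
  have 9: "pexec UNIV sz A1 t8 \<rho>1 (\<lambda>n. map (?h n) (?M n))"
    unfolding t8_def by (rule pexec_black_box[OF A1(2) pN1 A1(1)])
  let ?J = "{(n, x). n \<in> UNIV \<and> x \<in> set (?M n)}"
  let ?sz = "\<lambda>j. sz (fst j)"
  have sub: "fst ` ?J \<subseteq> UNIV" by auto
  have len: "length (fst (snd j) r) \<le> (fst j + l (fst j)) + N1 (fst j)" if "j \<in> ?J" for j r
  proof -
    obtain n t \<tau> where j: "j = (n, t, \<tau>)" "(t, \<tau>) \<in> set (?M n)" using \<open>j \<in> ?J\<close> by auto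
    have "length (t r) \<le> (n + l n) + N1 n"
      by (rule exec_length[OF halts_within_exec[OF A1(2)] _ j(2)]) (auto simp: input_simps)
    then show ?thesis using j by simp
  qed
  let ?f = "\<lambda>j. \<Sum>y\<leftarrow>branches A2 ((fst (snd j))(0 := k (fst j))) (snd (snd j)).
         if top_bit (fst (snd j) 0) = b \<and> top_bit (fst y 0) \<noteq> b then weight (d (fst j)) (fst j) (fst y 1) (snd y) else 0"
  have 10: "paccepts ?J ?sz (attack_mid b H G A2)
    (\<lambda>j. overlay H (fst (snd j)) (empty_store(H + 11 := unary (fst j), H + 15 := unary (d (fst j)), H + 16 := rev (k (fst j)))))
    (\<lambda>j. snd (snd j)) ?f"
  proof (rule paccepts_attack_mid[OF A2(1) _ pbd_reindex[OF pN2 sub] pbd_reindex[OF pn sub] pbd_reindex[OF pd sub]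
        pbd_reindex[OF pk sub] _ len])
    show "pbd ?J ?sz (\<lambda>j. fst j + l (fst j) + N1 (fst j))"
      by (intro pbd_add pbd_reindex[OF pn sub] pbd_reindex[OF pl sub] pbd_reindex[OF pN1 sub])
  qed (use A2(3) in auto)
  have "paccepts UNIV sz (Seq A1 (attack_mid b H G A2)) t8 \<rho>1 (\<lambda>n. \<Sum>x\<leftarrow>?M n. ?f (n, x))"
    by (rule paccepts_Seq[OF 9]) (use 10 in \<open>simp only: base_def case_prod_unfold fst_conv snd_conv\<close>)
  from paccepts_Seq_det[OF 1 paccepts_Seq_det[OF 2 paccepts_Seq_det[OF 3 paccepts_Seq_det[OF 4
        paccepts_Seq_det[OF 5 paccepts_Seq_det[OF 6 paccepts_Seq_det[OF 7 paccepts_Seq_det[OF 8 this]]]]]]]]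
  have "paccepts UNIV sz (attack_com b H G A1 A2) t0 \<rho> (\<lambda>n. \<Sum>x\<leftarrow>?M n. ?f (n, x))"
    unfolding attack_com_def .
  moreover have "t0 = (\<lambda>n. input [unary n, advice n])" by (auto simp: t0_def input_simps)
  ultimately show ?thesis unfolding sz_def by (simp only: fst_conv snd_conv)
qed

end

section \<open>Correctness of the scheme\<close>

definition scheme :: "nat \<Rightarrow> com \<Rightarrow> (nat \<Rightarrow> nat) \<Rightarrow> signature_scheme" where
  "scheme H G m = \<lparr>gen1 = gen1_com, gen2 = gen2_com H G, sign = sign_com, verify = verify_com H G,
     pk_qubits = (\<lambda>n. 2 * m n)\<rparr>"

lemma finite_keys: "finite {k :: bool list. length k = n}"
  using finite_lists_length_eq[of "UNIV :: bool set" n] by simp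

lemma card_keys: "card {k :: bool list. length k = n} = 2 ^ n"
  using card_lists_length_eq[of "UNIV :: bool set" n] by simp

text \<open>The key generation leaves no ancilla behind, so tracing out the further qubits changes
  nothing and the public key is pure.\<close>

lemma keep_qubits_proj:
  assumes "supp l v"
  shows "keep_qubits l (proj v) = proj v"
proof (intro ext)
  fix x y :: nat
  show "keep_qubits l (proj v) x y = proj v x y"
  proof (cases "x < 2 ^ l \<and> y < 2 ^ l")
    case True
    have "(\<Sum>z | proj v (x + 2 ^ l * z) (y + 2 ^ l * z) \<noteq> 0. proj v (x + 2 ^ l * z) (y + 2 ^ l * z))
        = (\<Sum>z\<in>{0}. proj v (x + 2 ^ l * z) (y + 2 ^ l * z))"
    proof (rule sum.mono_neutral_left)
      show "{z. proj v (x + 2 ^ l * z) (y + 2 ^ l * z) \<noteq> 0} \<subseteq> {0}"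
      proof
        fix z assume "z \<in> {z. proj v (x + 2 ^ l * z) (y + 2 ^ l * z) \<noteq> 0}"
        then have "\<not> 2 ^ l \<le> x + 2 ^ l * z" using assms by (auto simp: proj_def supp_def)
        then show "z \<in> {0}" by (cases z) auto
      qed
    qed auto
    then show ?thesis using True by (simp add: keep_qubits_def)
  next
    case False
    then show ?thesis using assms by (auto simp: keep_qubits_def proj_def supp_def not_less)
  qed
qed

lemma trace_scaled_ket_zero: "Re (qtrace (\<lambda>x y. proj ket_zero x y / c)) = Re (1 / c)"
proof -
  have "{x. proj ket_zero x x / c \<noteq> 0} = (if c = 0 then {} else {0})"
    by (auto simp: proj_def ket_zero_def)
  then show ?thesis by (simp add: qtrace_def proj_def ket_zero_def)
qed

context generator begin

abbreviation \<phi> :: "bool list \<Rightarrow> qvec" where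
  "\<phi> k \<equiv> circuit_output (U k)"

lemma supp_state: "length k = n \<Longrightarrow> supp (m n) (\<phi> k)"
  using supp_fold_gate_vec[OF gates_below supp_ket_zero] unfolding circuit_output_def by blast

lemma nsq_state: "nsq (\<phi> k) = 1"
  using nsq_fold_gate_vec[OF gates_below supp_ket_zero] nsq_ket_zero unfolding circuit_output_def by simp

text \<open>For \<sigma> of length \<open>n\<close>, the squared overlap of \<psi> with the state of
  \<sigma>, written through the inverse circuit because that is what the verifier measures.\<close>

definition overlap :: "nat \<Rightarrow> bool list \<Rightarrow> qvec \<Rightarrow> real" where
  "overlap n \<sigma> \<psi> = (if length \<sigma> = n then (cmod (fold gate_vec (inverse_circuit (U \<sigma>)) \<psi> 0))\<^sup>2 else 0)"

lemma overlap_nonneg: "0 \<le> overlap n \<sigma> \<psi>"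
  by (simp add: overlap_def)

lemma overlap_self: "length k = n \<Longrightarrow> overlap n k (\<phi> k) = 1"
  using fold_inverse_circuit[of "U k" "m (length k)" ket_zero] gates_on[of _ k]
  by (simp add: overlap_def circuit_output_def ket_zero_def)

lemma weight_tensor:
  assumes "supp d u" "supp (m n) \<psi>" "supp e w"
  shows "weight d n \<sigma> (tensor d (proj u) (tensor (m n) (proj \<psi>) (proj w))) = nsq u * overlap n \<sigma> \<psi> * nsq w"
proof (cases "length \<sigma> = n")
  case True
  then show ?thesis
    using inverse_circuit_weight[OF assms, of "U \<sigma>"] gates_below[of \<sigma>]
    by (simp add: weight_def overlap_def)
qed (simp add: weight_def overlap_def)

lemma secret_keys_scheme: "secret_keys (scheme H G m) n = map (\<lambda>sk. (sk, 1 / 4 ^ n)) (coins n [])"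
proof -
  have "branches gen1_com (input [unary n]) (proj ket_zero)
      = map (\<lambda>sk. (empty_store(0 := sk), \<lambda>x y. proj ket_zero x y / 4 ^ n)) (coins n [])"
    by (rule pexec_branches[OF pexec_gen1 UNIV_I])
  then show ?thesis
    by (simp add: secret_keys_def scheme_def comp_def trace_scaled_ket_zero del: of_real_power)
qed

lemma sum_secret_keys:
  "(\<Sum>(sk, w)\<leftarrow>secret_keys (scheme H G m) n. w * F (evens sk) (odds sk))
    = (\<Sum>k0 | length k0 = n. \<Sum>k1 | length k1 = n. F k0 k1) / 4 ^ n"
proof -
  have "(\<Sum>(sk, w)\<leftarrow>secret_keys (scheme H G m) n. w * F (evens sk) (odds sk))
      = (\<Sum>sk\<leftarrow>coins n []. F (evens sk) (odds sk) / 4 ^ n)"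
    by (simp add: secret_keys_scheme comp_def)
  also have "\<dots> = (\<Sum>k0 | length k0 = n. \<Sum>k1 | length k1 = n. F k0 k1 / 4 ^ n)"
    unfolding sum_coins append_Nil2 by (rule sum_interleaved)
  finally show ?thesis by (simp add: sum_divide_distrib)
qed

lemma secret_keys_length:
  "(sk, w) \<in> set (secret_keys (scheme H G m) n) \<Longrightarrow> length (evens sk) = n \<and> length (odds sk) = n"
  using length_coins[of sk n "[]"] length_evens_odds[of sk n] by (auto simp: secret_keys_scheme)

lemma public_key_scheme:
  assumes "length (evens sk) = n" "length (odds sk) = n"
  shows "public_key (scheme H G m) (2 * m n) sk = proj (tensorv (m n) (\<phi> (evens sk)) (\<phi> (odds sk)))"
proof -
  let ?v = "tensorv (m n) (\<phi> (evens sk)) (\<phi> (odds sk))"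
  have 1: "fold gate_op (U (evens sk)) (proj ket_zero) = tensor (m n) (proj (\<phi> (evens sk))) (proj ket_zero)"
    unfolding fold_gate_op_proj circuit_output_def[symmetric] proj_tensorv[symmetric]
    by (simp add: tensorv_ket_zero[OF supp_state[OF assms(1)]])
  have "fold gate_op (concat (map (expand 1 (m n)) (U (odds sk)))) (fold gate_op (U (evens sk)) (proj ket_zero))
      = proj ?v"
    unfolding concat_expand_shift[of 1 "m n"] concat_expand_1 1 fold_gate_op_tensor_high proj_tensorv
    by (simp add: fold_gate_op_proj circuit_output_def)
  moreover have "branches (gen2_com H G) (input [sk]) (proj ket_zero)
      = [(empty_store(0 := unary (m n + m n)),
         fold gate_op (concat (map (expand 1 (m n)) (U (odds sk)))) (fold gate_op (U (evens sk)) (proj ket_zero)))]"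
    using pexec_branches[OF pexec_gen2[of "\<lambda>_. proj ket_zero"] UNIV_I[of sk]] assms
    by (simp only: concat_expand_1)
  moreover have "supp (2 * m n) ?v"
    using supp_tensorv[OF supp_state[OF assms(2)]] by (simp add: mult_2)
  ultimately show ?thesis
    by (intro ext) (simp add: public_key_def scheme_def keep_qubits_proj)
qed

lemma verify_prob_eq_weight:
  "verify_prob (scheme H G m) n \<rho> b \<sigma> = weight (if b then m n else 0) n \<sigma> \<rho>"
proof -
  have "paccepts UNIV (\<lambda>(n, b, \<sigma>). \<Sum>x\<leftarrow>[unary n, [b], \<sigma>]. length x) (verify_com H G)
    (\<lambda>i. input ((\<lambda>(n, b, \<sigma>). [unary n, [b], \<sigma>]) i)) (\<lambda>_. \<rho>)
    (\<lambda>(n, b, \<sigma>). weight (if b then m n else 0) n \<sigma> \<rho>)"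
    using paccepts_verify[of "\<lambda>_. \<rho>"] by (simp add: case_prod_unfold)
  from paccepts_accept_prob[OF this, of "(n, b, \<sigma>)"] show ?thesis
    by (simp add: verify_prob_def scheme_def)
qed

lemma verify_prob_scheme:
  assumes "length (evens sk) = n" "length (odds sk) = n"
  shows "verify_prob (scheme H G m) n (public_key (scheme H G m) (2 * m n) sk) b \<sigma>
    = overlap n \<sigma> (if b then \<phi> (odds sk) else \<phi> (evens sk))"
proof (cases b)
  case True
  \<comment> \<open>Appending an empty third factor brings the key into the three-block form of
    \<open>weight_tensor\<close>; for the other message the empty block goes in front.\<close>
  have "tensorv (m n) (\<phi> (odds sk)) ket_zero = \<phi> (odds sk)"
    by (rule tensorv_ket_zero[OF supp_state[OF assms(2)]])
  then have "public_key (scheme H G m) (2 * m n) sk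
      = tensor (m n) (proj (\<phi> (evens sk))) (tensor (m n) (proj (\<phi> (odds sk))) (proj ket_zero))"
    unfolding public_key_scheme[OF assms] by (simp flip: proj_tensorv)
  then show ?thesis
    using True weight_tensor[OF supp_state[OF assms(1)] supp_state[OF assms(2)] supp_ket_zero]
    by (simp add: verify_prob_eq_weight nsq_state nsq_ket_zero)
next
  case False
  have "public_key (scheme H G m) (2 * m n) sk
      = tensor 0 (proj ket_zero) (tensor (m n) (proj (\<phi> (evens sk))) (proj (\<phi> (odds sk))))"
    unfolding public_key_scheme[OF assms] tensor_0_ket_zero by (simp add: proj_tensorv)
  then show ?thesis
    using False weight_tensor[OF supp_ket_zero supp_state[OF assms(1)] supp_state[OF assms(2)]]
    by (simp add: verify_prob_eq_weight nsq_state nsq_ket_zero)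
qed

lemma signature_eq: "signature (scheme H G m) sk b = (if b then odds sk else evens sk)"
proof -
  have "branches sign_com (input [sk, [b]]) (proj ket_zero) = [(empty_store(0 := if b then odds sk else evens sk, 1 := [b],
       (if b then 2 else 3) := (if b then rev (evens sk) else rev (odds sk))), proj ket_zero)]"
    using pexec_branches[OF pexec_sign[of "\<lambda>_. proj ket_zero"] UNIV_I[of "(sk, b)"]]
    by (simp only: prod.case)
  then show ?thesis by (simp add: signature_def classical_output_def scheme_def)
qed

lemma perfectly_correct_scheme: "perfectly_correct (scheme H G m)"
  unfolding perfectly_correct_def
proof (intro allI)
  fix n b
  have "(\<Sum>(sk, w)\<leftarrow>secret_keys (scheme H G m) n. w * verify_prob (scheme H G m) n
      (public_key (scheme H G m) (pk_qubits (scheme H G m) n) sk) b (signature (scheme H G m) sk b))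
    = (\<Sum>(sk, w)\<leftarrow>secret_keys (scheme H G m) n. w * (\<lambda>_ _. 1) (evens sk) (odds sk))"
  proof (intro arg_cong[where f = sum_list] map_cong refl)
    fix p assume "p \<in> set (secret_keys (scheme H G m) n)"
    moreover obtain sk w where p: "p = (sk, w)" by (cases p)
    ultimately have len: "length (evens sk) = n" "length (odds sk) = n"
      using secret_keys_length[of sk w n] by auto
    have "pk_qubits (scheme H G m) n = 2 * m n" by (simp add: scheme_def)
    then show "(case p of (sk, w) \<Rightarrow> w * verify_prob (scheme H G m) n
        (public_key (scheme H G m) (pk_qubits (scheme H G m) n) sk) b (signature (scheme H G m) sk b))
      = (case p of (sk, w) \<Rightarrow> w * (\<lambda>_ _. 1) (evens sk) (odds sk))"
      using len by (simp add: p verify_prob_scheme[OF len] signature_eq overlap_self)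
  qed
  also have "\<dots> = 1"
    using sum_secret_keys[of "\<lambda>_ _. 1" n] by (simp add: card_keys power_mult_distrib[symmetric])
  finally show "(\<Sum>(sk, w)\<leftarrow>secret_keys (scheme H G m) n. w * verify_prob (scheme H G m) n
      (public_key (scheme H G m) (pk_qubits (scheme H G m) n) sk) b (signature (scheme H G m) sk b)) = 1" .
qed

lemma scheme_efficient: "efficient_scheme (scheme H G m)"
proof -
  let ?S = "scheme H G m"
  have "poly_time gen1_com {[unary n] | n. True}"
    by (rule pexec_poly_time[OF pexec_gen1[of "\<lambda>_. proj ket_zero"]]) auto
  moreover have "poly_time (gen2_com H G) {[sk] | sk. True}"
    by (rule pexec_poly_time[OF pexec_gen2[of "\<lambda>_. proj ket_zero"]]) auto
  moreover have "poly_time sign_com {[sk, [b]] | sk b. True}"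
  proof (rule pexec_poly_time)
    show "pexec UNIV (\<lambda>i. \<Sum>x\<leftarrow>(\<lambda>(sk, b). [sk, [b]]) i. length x) sign_com (\<lambda>i. input ((\<lambda>(sk, b). [sk, [b]]) i))
      (\<lambda>_. proj ket_zero) (\<lambda>(sk, b). [(empty_store(0 := if b then odds sk else evens sk, 1 := [b],
       (if b then 2 else 3) := (if b then rev (evens sk) else rev (odds sk))), proj ket_zero)])"
      using pexec_sign[of "\<lambda>_. proj ket_zero"] by (simp only: case_prod_unfold)
  qed auto
  moreover have "poly_time (verify_com H G) {[unary n, [b], \<sigma>] | n b \<sigma>. True}"
  proof (rule paccepts_poly_time)
    show "paccepts UNIV (\<lambda>i. \<Sum>x\<leftarrow>(\<lambda>(n, b, \<sigma>). [unary n, [b], \<sigma>]) i. length x) (verify_com H G)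
      (\<lambda>i. input ((\<lambda>(n, b, \<sigma>). [unary n, [b], \<sigma>]) i)) (\<lambda>_. proj ket_zero)
      (\<lambda>(n, b, \<sigma>). weight (if b then m n else 0) n \<sigma> (proj ket_zero))"
      using paccepts_verify[of "\<lambda>_. proj ket_zero"] by (simp only: case_prod_unfold)
  qed (auto simp: image_iff)
  moreover have "length (s 0) = pk_qubits ?S n"
    if sk: "(sk, w) \<in> set (secret_keys ?S n)"
      and s: "(s, \<rho>) \<in> set (branches (gen2_com H G) (input [sk]) (proj ket_zero))" for n sk w s \<rho>
    using s pexec_branches[OF pexec_gen2[of "\<lambda>_. proj ket_zero"] UNIV_I[of sk]] secret_keys_length[OF sk]
    by (simp add: scheme_def)
  ultimately show ?thesis
    unfolding efficient_scheme_def
    by (auto simp: scheme_def gen1_com_def move_def move_bit_def sign_com_def deinterleave_def)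
qed

end


section \<open>Security of the scheme\<close>

lemma branches_fst_indep:
  assumes "halts_within N c s"
  shows "map fst (branches c s \<rho>) = map fst (branches c s \<rho>')"
proof -
  have "map fst (branches c s \<rho>) = map (snd \<circ> (\<lambda>(K, s, \<rho>). (K, s))) (ev N ([c], s, \<rho>))" for \<rho>
    using halts_within_exec[OF assms, of \<rho>] by (simp add: execs_def comp_def case_prod_unfold)
  then show ?thesis
    using ev_fst_snd_indep[of N "[c]" s \<rho> \<rho>'] by (simp flip: map_map)
qed

text \<open>Unlike the unknown state, the state of the revealed key can be made from scratch, by
  repeating its circuit in slot \<open>b\<close> of every pair.\<close>

primrec prepare_gates :: "nat \<Rightarrow> bool \<Rightarrow> nat gate list \<Rightarrow> nat \<Rightarrow> nat gate list" where
  "prepare_gates m b gs 0 = []"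
| "prepare_gates m b gs (Suc t) = map (map_gate ((+) (of_bool b * m))) gs @
     map (map_gate ((+) (2 * m))) (prepare_gates m b gs t)"

lemma map_gate_plus_0: "map_gate ((+) (0 :: nat)) = (\<lambda>g. g)"
proof
  fix g :: "nat gate"
  show "map_gate ((+) 0) g = g" by (cases g) auto
qed

lemma addrs_below_map_gate: "addrs_below m g \<Longrightarrow> addrs_below (d + m) (map_gate ((+) d) g)"
  by (cases g) auto

lemma prepare_gates_below:
  assumes "\<forall>g\<in>set gs. addrs_below m g"
  shows "\<forall>g\<in>set (prepare_gates m b gs t). addrs_below (2 * m * t) g"
proof (induction t)
  case (Suc t)
  show ?case
  proof
    fix g assume "g \<in> set (prepare_gates m b gs (Suc t))"
    then consider h where "h \<in> set gs" "g = map_gate ((+) (of_bool b * m)) h"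
      | h where "h \<in> set (prepare_gates m b gs t)" "g = map_gate ((+) (2 * m)) h" by auto
    then show "addrs_below (2 * m * Suc t) g"
    proof cases
      case 1
      then have "addrs_below (of_bool b * m + m) g" using assms addrs_below_map_gate by blast
      then show ?thesis by (cases b) fastforce+
    next
      case 2
      then have "addrs_below (2 * m + 2 * m * t) g" using Suc addrs_below_map_gate by blast
      then show ?thesis by simp
    qed
  qed
qed simp

lemma length_prepare_gates: "length (prepare_gates m b gs t) = t * length gs"
  by (induction t) auto

lemma fold_prepare_gates:
  assumes "\<forall>g\<in>set gs. addrs_below m g"
  shows "fold gate_op (prepare_gates m b gs t) (copies (2 * m) t (proj (pairv m (\<not> b) \<psi> ket_zero)))
    = copies (2 * m) t (proj (pairv m (\<not> b) \<psi> (fold gate_vec gs ket_zero)))"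
proof (induction t)
  case (Suc t)
  let ?gs = "map (map_gate ((+) (of_bool b * m))) gs"
  have "\<forall>g\<in>set ?gs. addrs_below (2 * m) g"
    using assms by (cases b) (force simp: gate.set_map)+
  moreover have "fold gate_op ?gs (proj (pairv m (\<not> b) \<psi> ket_zero))
      = proj (pairv m (\<not> b) \<psi> (fold gate_vec gs ket_zero))"
    using fold_gate_op_tensor_low[OF assms] fold_gate_op_tensor_high[of m gs]
    by (cases b) (simp_all add: pairv_def proj_tensorv fold_gate_op_proj map_gate_plus_0)
  ultimately show ?case
    using fold_gate_op_tensor_low[of ?gs "2 * m"] Suc by (simp add: fold_gate_op_tensor_high)
qed simp

text \<open>CNOT is the worst case, with two unary addresses and three marker bits.\<close>

lemma length_encode_gate: "addrs_below Q g \<Longrightarrow> length (encode_gate g) \<le> 2 * Q + 3"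
  by (cases g) auto

lemma length_gate_codes_le:
  "\<forall>g\<in>set gs. addrs_below Q g \<Longrightarrow> length (gate_codes gs) \<le> length gs * (2 * Q + 3)"
proof (induction gs)
  case (Cons g gs)
  then show ?case using length_encode_gate[of g Q] by simp
qed simp

text \<open>Moving costs three gates per qubit and the preparation costs \<open>t\<close> runs of
  \<open>gs\<close>, all on addresses below \<open>d + 2 * m * t + m\<close>. The explicit bound
  keeps the advice polynomially long, and one circuit serves all \<open>\<psi>\<close>, so that the
  unknown state can be replaced later.\<close>

lemma ex_rearranging_gates:
  assumes "\<forall>g\<in>set gs. addrs_below m g"
  shows "\<exists>hs. length (gate_codes hs) \<le> (3 * (m * Suc t) + t * length gs) * (2 * (d + 2 * m * t + m) + 3) \<and>
    (\<forall>\<psi>. supp m \<psi> \<longrightarrow> fold gate_op hs (copies m (Suc t) (proj \<psi>)) =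
       tensor (d + 2 * m * t) (copies (2 * m) t (proj (pairv m (\<not> b) \<psi> (fold gate_vec gs ket_zero)))) (proj \<psi>))"
proof -
  let ?Q = "d + 2 * m * t + m"
  let ?D = "d + 2 * m * t"
  have img: "spread m (\<not> b) d t ` {..<m * Suc t} \<subseteq> {..<?Q}" using spread_less by auto
  have le: "m * Suc t \<le> ?Q" by simp
  from ex_placing_gates[OF spread_inj img le] obtain ps where ps: "length ps \<le> 3 * (m * Suc t)" "\<forall>g\<in>set ps. gate_on ?Q g"
    "\<And>V. supp (m * Suc t) V \<Longrightarrow> fold gate_vec ps V = place (m * Suc t) (spread m (\<not> b) d t) V"
    by blast
  let ?hs = "ps @ prepare_gates m b gs t"
  note below = prepare_gates_below[OF assms, of b t]
  have "\<forall>g\<in>set ?hs. addrs_below ?Q g"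
    using ps(2) gate_on_addrs_below below by fastforce
  then have "length (gate_codes ?hs) \<le> length ?hs * (2 * ?Q + 3)"
    by (rule length_gate_codes_le)
  also have "\<dots> \<le> (3 * (m * Suc t) + t * length gs) * (2 * ?Q + 3)"
    using ps(1) by (intro mult_le_mono1) (simp add: length_prepare_gates)
  finally have len: "length (gate_codes ?hs) \<le> (3 * (m * Suc t) + t * length gs) * (2 * ?Q + 3)" .
  have "fold gate_op ?hs (copies m (Suc t) (proj \<psi>)) =
       tensor ?D (copies (2 * m) t (proj (pairv m (\<not> b) \<psi> (fold gate_vec gs ket_zero)))) (proj \<psi>)"
    if "supp m \<psi>" for \<psi>
  proof -
    have "fold gate_op ps (copies m (Suc t) (proj \<psi>))
        = proj (place (m * Suc t) (spread m (\<not> b) d t) (copiesv m (Suc t) \<psi>))"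
      unfolding copies_proj fold_gate_op_proj ps(3)[OF supp_copiesv] ..
    also have "\<dots> = tensor ?D (copies (2 * m) t (proj (pairv m (\<not> b) \<psi> ket_zero))) (proj \<psi>)"
      unfolding place_spread[OF that] proj_tensorv copies_proj ..
    finally have "fold gate_op ?hs (copies m (Suc t) (proj \<psi>))
        = fold gate_op (prepare_gates m b gs t)
            (tensor ?D (copies (2 * m) t (proj (pairv m (\<not> b) \<psi> ket_zero))) (proj \<psi>))"
      by (simp del: copies.simps)
    moreover have "\<forall>g\<in>set (prepare_gates m b gs t). addrs_below ?D g" using below by fastforce
    ultimately show ?thesis
      by (simp only: fold_gate_op_tensor_low fold_prepare_gates[OF assms])
  qed
  then show ?thesis using len by blast
qed


lemma supp_pairv: "supp m v \<Longrightarrow> supp m w \<Longrightarrow> supp (2 * m) (pairv m b v w)"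
  using supp_tensorv[of m _ m] by (auto simp: pairv_def mult_2)

lemma nsq_pairv: "supp m v \<Longrightarrow> supp m w \<Longrightarrow> nsq (pairv m b v w) = nsq v * nsq w"
  using nsq_tensorv[of m _ m] by (auto simp: pairv_def)

context generator begin

text \<open>The probability that the adversary asks for the signature k of message b and forges a signature
  of the other message, whose part of the public key is \<psi>.\<close>

definition game :: "com \<Rightarrow> com \<Rightarrow> nat \<Rightarrow> bool \<Rightarrow> nat \<Rightarrow> bool list \<Rightarrow> qvec \<Rightarrow> real" where
  "game A1 A2 t b n k \<psi> =
     (\<Sum>x\<leftarrow>branches A1 (input [unary n, unary (2 * m n)]) (copies (2 * m n) t (proj (pairv (m n) (\<not> b) \<psi> (\<phi> k)))).
      \<Sum>y\<leftarrow>branches A2 ((fst x)(0 := k)) (snd x).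
        if top_bit (fst x 0) = b \<and> top_bit (fst y 0) \<noteq> b then Re (qtrace (snd y)) * overlap n (fst y 1) \<psi> else 0)"

text \<open>Each branch of \<open>A1\<close> asks for exactly one message and so counts in exactly
  one of the two games. The revealed key is then the one of this message, and the forgery is checked
  against the state of the other key.\<close>

lemma forgery_prob_eq:
  "forgery_prob (scheme H G m) A1 A2 t n = (\<Sum>k0 | length k0 = n. \<Sum>k1 | length k1 = n.
     game A1 A2 (poly t n) False n k0 (\<phi> k1) + game A1 A2 (poly t n) True n k1 (\<phi> k0)) / 4 ^ n"
proof -
  let ?S = "scheme H G m"
  let ?F = "\<lambda>k0 k1. game A1 A2 (poly t n) False n k0 (\<phi> k1) + game A1 A2 (poly t n) True n k1 (\<phi> k0)"
  have l: "pk_qubits ?S n = 2 * m n" by (simp add: scheme_def)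
  let ?adv = "\<lambda>sk. \<Sum>(s1, \<rho>1) \<leftarrow> adversary_start ?S A1 t n sk.
          (let b = top_bit (s1 0) in
           \<Sum>(s2, \<rho>2) \<leftarrow> branches A2 (s1(0 := signature ?S sk b)) \<rho>1.
             (let b' = top_bit (s2 0); \<sigma>' = s2 1 in
              if b' \<noteq> b
              then Re (qtrace \<rho>2) * verify_prob ?S n (public_key ?S (pk_qubits ?S n) sk) b' \<sigma>'
              else 0))"
  have adv: "?adv sk = ?F (evens sk) (odds sk)" if len: "length (evens sk) = n" "length (odds sk) = n" for sk
  proof -
    let ?B = "branches A1 (input [unary n, unary (2 * m n)])
      (copies (2 * m n) (poly t n) (proj (tensorv (m n) (\<phi> (evens sk)) (\<phi> (odds sk)))))"
    have start: "adversary_start ?S A1 t n sk = ?B"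
      by (simp add: adversary_start_def Let_def l public_key_scheme[OF len])
    let ?G = "\<lambda>b k \<psi> x. \<Sum>y\<leftarrow>branches A2 ((fst x)(0 := k)) (snd x).
        if top_bit (fst x 0) = b \<and> top_bit (fst y 0) \<noteq> b then Re (qtrace (snd y)) * overlap n (fst y 1) \<psi> else 0"
    have "?F (evens sk) (odds sk) = (\<Sum>x\<leftarrow>?B. ?G False (evens sk) (\<phi> (odds sk)) x + ?G True (odds sk) (\<phi> (evens sk)) x)"
      by (simp add: game_def pairv_def sum_list_addf)
    also have "\<dots> = ?adv sk"
      unfolding start
    proof (intro arg_cong[where f = sum_list] map_cong refl)
      fix x :: "store \<times> qop"
      obtain s1 \<rho>1 where x: "x = (s1, \<rho>1)" by (cases x)
      show "?G False (evens sk) (\<phi> (odds sk)) x + ?G True (odds sk) (\<phi> (evens sk)) x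
        = (case x of (s1, \<rho>1) \<Rightarrow> let b = top_bit (s1 0) in
           \<Sum>(s2, \<rho>2) \<leftarrow> branches A2 (s1(0 := signature ?S sk b)) \<rho>1.
             (let b' = top_bit (s2 0); \<sigma>' = s2 1 in
              if b' \<noteq> b
              then Re (qtrace \<rho>2) * verify_prob ?S n (public_key ?S (pk_qubits ?S n) sk) b' \<sigma>'
              else 0))"
        unfolding x l
        by (cases "top_bit (s1 0)")
          (auto simp: Let_def signature_eq verify_prob_scheme[OF len] case_prod_unfold
            intro!: arg_cong[where f = sum_list] map_cong)
    qed
    finally show ?thesis ..
  qed
  have "forgery_prob ?S A1 A2 t n = (\<Sum>(sk, w)\<leftarrow>secret_keys ?S n. w * ?F (evens sk) (odds sk))"
    unfolding forgery_prob_def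
  proof (intro arg_cong[where f = sum_list] map_cong refl)
    fix p assume p: "p \<in> set (secret_keys ?S n)"
    obtain sk w where sk: "p = (sk, w)" by (cases p)
    have "length (evens sk) = n" "length (odds sk) = n"
      using secret_keys_length[of sk w n] p sk by auto
    from adv[OF this] show "(case p of (sk, w) \<Rightarrow> w * ?adv sk) = (case p of (sk, w) \<Rightarrow> w * ?F (evens sk) (odds sk))"
      unfolding sk prod.case by (rule arg_cong)
  qed
  also have "\<dots> = (\<Sum>k0 | length k0 = n. \<Sum>k1 | length k1 = n. ?F k0 k1) / 4 ^ n"
    by (rule sum_secret_keys)
  finally show ?thesis .
qed

text \<open>\<open>game_le\<close> uses that the final weights are nonnegative and sum to 1. In
  \<open>game_tensor\<close> the product of a branch weight with a separate verification becomes one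
  measurement on the same memory, which is what a single program can carry out.\<close>

lemma
  fixes A1 A2 :: com
  defines "inp \<equiv> \<lambda>n. input [unary n, unary (2 * m n)]"
  assumes A1: "halts_within N1 A1 (inp n)"
    and A2: "\<And>s \<rho> \<tau>. (s, \<tau>) \<in> set (branches A1 (inp n) \<rho>) \<Longrightarrow> halts_within N2 A2 (s(0 := k))"
    and k: "length k = n" and \<psi>: "supp (m n) \<psi>" "nsq \<psi> = 1"
  shows game_le: "game A1 A2 t b n k \<psi> \<le> (\<Sum>k | length k = n. overlap n k \<psi>)"
    and game_tensor: "2 * m n * t + n + 2 * m n + N1 + n + N2 < d \<Longrightarrow>
      (\<Sum>x\<leftarrow>branches A1 (inp n) (tensor d (copies (2 * m n) t (proj (pairv (m n) (\<not> b) \<psi> (\<phi> k)))) (proj \<psi>)).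
        \<Sum>y\<leftarrow>branches A2 ((fst x)(0 := k)) (snd x).
          if top_bit (fst x 0) = b \<and> top_bit (fst y 0) \<noteq> b then weight d n (fst y 1) (snd y) else 0)
      = game A1 A2 t b n k \<psi>"
proof -
  define v where "v = copiesv (2 * m n) t (pairv (m n) (\<not> b) \<psi> (\<phi> k))"
  define \<rho> where "\<rho> = copies (2 * m n) t (proj (pairv (m n) (\<not> b) \<psi> (\<phi> k)))"
  have inp: "input [unary n, unary (2 * m n)] = inp n" by (simp add: inp_def)
  have \<rho>: "\<rho> = proj v" by (simp add: \<rho>_def v_def copies_proj)
  note pair = supp_pairv[OF \<psi>(1) supp_state[OF k]] nsq_pairv[OF \<psi>(1) supp_state[OF k]]
  have v: "supp (2 * m n * t) v" "nsq v = 1"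
    using supp_copiesv nsq_copiesv[OF pair(1)] pair(2) \<psi>(2) by (auto simp: v_def nsq_state)
  let ?L1 = "branches A1 (inp n) \<rho>"
  let ?L2 = "\<lambda>x. branches A2 ((fst x)(0 := k)) (snd x)"
  \<comment> \<open>Room for the qubits of the public keys and for all addresses: initial registers,
    steps of \<open>A1\<close>, the inserted signature, steps of \<open>A2\<close>.\<close>
  let ?d0 = "2 * m n * t + n + 2 * m n + N1 + n + N2 + 1"
  have E1: "exec A1 (inp n) \<rho>' N1 (branches A1 (inp n) \<rho>')" for \<rho>'
    by (rule halts_within_exec[OF A1])
  have len0: "length (inp n r) \<le> n + 2 * m n" for r
    by (auto simp: inp_def input_simps)
  have E2: "exec A2 ((fst x)(0 := k)) \<rho>' N2 (branches A2 ((fst x)(0 := k)) \<rho>')" if "x \<in> set ?L1" for x \<rho>'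
    using A2[of "fst x" "snd x" \<rho>] that by (intro halts_within_exec) simp
  have len1: "length (((fst x)(0 := k)) r) \<le> n + 2 * m n + N1 + n" if "x \<in> set ?L1" for x r
  proof -
    have "length (fst x r) \<le> n + 2 * m n + N1"
      by (rule exec_length[OF E1[of \<rho>] len0, where \<rho>' = "snd x"]) (use that in simp)
    then show ?thesis using k by simp
  qed
  have pure: "pure_op d \<rho>" if "?d0 \<le> d" for d
    using v(1) \<rho> supp_mono[of "2 * m n * t" v d] that unfolding pure_op_def by auto
  have pure1: "pure_op d (snd x)" if "?d0 \<le> d" "x \<in> set ?L1" for d x
    by (rule exec_local(1)[OF E1 len0 _ _ pure[OF that(1)], where s' = "fst x"]) (use that in auto)
  have pure2: "pure_op d (snd y)" if "?d0 \<le> d" "x \<in> set ?L1" "y \<in> set (?L2 x)" for d x y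
    by (rule exec_local(1)[OF E2[OF that(2)] len1[OF that(2)] _ _ pure1[OF that(1,2)], where s' = "fst y"])
      (use that in auto)
  have tr1: "(\<Sum>x\<leftarrow>?L1. Re (qtrace (snd x))) = 1"
    using exec_local(2)[OF E1 len0 _ _ pure[OF order_refl]] v(2) by (simp add: case_prod_unfold \<rho> nsq_def)
  have tr2: "(\<Sum>y\<leftarrow>?L2 x. Re (qtrace (snd y))) = Re (qtrace (snd x))" if "x \<in> set ?L1" for x
    using exec_local(2)[OF E2[OF that] len1[OF that] _ _ pure1[OF order_refl that]] by (simp add: case_prod_unfold)
  let ?W = "\<Sum>k | length k = n. overlap n k \<psi>"
  \<comment> \<open>The forged key varies with the branch, so its overlap is replaced by a bound
    common to all branches.\<close>
  have W: "overlap n \<sigma> \<psi> \<le> ?W" for \<sigma>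
  proof (cases "length \<sigma> = n")
    case True
    then show ?thesis by (intro member_le_sum) (auto simp: overlap_nonneg finite_keys)
  next
    case False
    then show ?thesis by (simp add: overlap_def sum_nonneg)
  qed
  have W0: "0 \<le> ?W" by (intro sum_nonneg) (simp add: overlap_nonneg)
  have "game A1 A2 t b n k \<psi> \<le> (\<Sum>x\<leftarrow>?L1. \<Sum>y\<leftarrow>?L2 x. Re (qtrace (snd y)) * ?W)"
    unfolding game_def inp \<rho>_def[symmetric]
  proof (intro sum_list_mono)
    fix x y assume xy: "x \<in> set ?L1" "y \<in> set (?L2 x)"
    have "0 \<le> Re (qtrace (snd y))" by (rule trace_pure_op_nonneg[OF pure2[OF order_refl xy]])
    then show "(if top_bit (fst x 0) = b \<and> top_bit (fst y 0) \<noteq> b then Re (qtrace (snd y)) * overlap n (fst y 1) \<psi> else 0)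
        \<le> Re (qtrace (snd y)) * ?W"
      using W[of "fst y 1"] W0 by (auto intro: mult_left_mono)
  qed
  also have "\<dots> = (\<Sum>x\<leftarrow>?L1. Re (qtrace (snd x)) * ?W)"
    by (intro arg_cong[where f = sum_list] map_cong refl) (simp add: sum_list_mult_const tr2)
  also have "\<dots> = ?W" by (simp add: sum_list_mult_const tr1)
  finally show "game A1 A2 t b n k \<psi> \<le> ?W" .
  show "(\<Sum>x\<leftarrow>branches A1 (inp n) (tensor d (copies (2 * m n) t (proj (pairv (m n) (\<not> b) \<psi> (\<phi> k)))) (proj \<psi>)).
        \<Sum>y\<leftarrow>branches A2 ((fst x)(0 := k)) (snd x).
          if top_bit (fst x 0) = b \<and> top_bit (fst y 0) \<noteq> b then weight d n (fst y 1) (snd y) else 0)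
      = game A1 A2 t b n k \<psi>" if "2 * m n * t + n + 2 * m n + N1 + n + N2 < d"
  proof -
    have d: "?d0 \<le> d" using that by simp
    let ?T = "\<lambda>(s, \<rho>). (s :: store, tensor d \<rho> (proj \<psi>))"
    have L1: "branches A1 (inp n) (tensor d \<rho> (proj \<psi>)) = map ?T ?L1"
      by (rule exec_branches_eq[OF exec_local(3)[OF E1 len0 _ _ pure[OF d]]]) (use d in auto)
    have L2: "branches A2 ((fst x)(0 := k)) (tensor d (snd x) (proj \<psi>)) = map ?T (?L2 x)" if "x \<in> set ?L1" for x
      by (rule exec_branches_eq[OF exec_local(3)[OF E2[OF that] len1[OF that] _ _ pure1[OF d that]]]) (use d in auto)
    have w: "weight d n \<sigma> (tensor d (snd y) (proj \<psi>)) = Re (qtrace (snd y)) * overlap n \<sigma> \<psi>"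
      if "x \<in> set ?L1" "y \<in> set (?L2 x)" for x y \<sigma>
    proof -
      have "pure_op d (snd y)" by (rule pure2[OF d that])
      then obtain u where u: "snd y = proj u" "supp d u" unfolding pure_op_def by blast
      have "proj \<psi> = tensor (m n) (proj \<psi>) (proj ket_zero)"
        by (simp add: tensorv_ket_zero[OF \<psi>(1)] flip: proj_tensorv)
      then show ?thesis
        using weight_tensor[OF u(2) \<psi>(1) supp_ket_zero] u(1) nsq_ket_zero by (simp add: nsq_def)
    qed
    show ?thesis
      unfolding game_def inp \<rho>_def[symmetric] L1
      by (simp add: comp_def case_prod_unfold L2 w cong: map_cong if_cong)
  qed
qed

lemma game_average:
  fixes A1 A2 :: com and t :: "nat poly"
  assumes sec: "\<And>(t :: nat poly) A advice. nonuniform_qpt A advice \<Longrightarrow> \<exists>negl. negligible negl \<and>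
      (\<forall>n. \<exists>\<mu>. haar_measure (m n) \<mu> \<and>
        \<bar>(\<Sum>k | length k = n. accept_prob A [unary n, advice n] (copies (m n) (poly t n) (proj (\<phi> k)))) / 2 ^ n
          - (LINT \<psi>|\<mu>. accept_prob A [unary n, advice n] (copies (m n) (poly t n) (proj \<psi>)))\<bar> \<le> negl n)"
    and H: "regs_below H A1" "regs_below H A2"
    and A1: "poly_time A1 {[unary n, unary (2 * m n)] | n. True}"
    and A2: "\<exists>p :: nat poly. \<forall>n \<sigma> \<rho>. \<forall>(s, \<tau>)\<in>set (branches A1 (input [unary n, unary (2 * m n)]) \<rho>).
      halts_within (poly p (n + length \<sigma>)) A2 (s(0 := \<sigma>))"
  shows "\<exists>negl. negligible negl \<and> (\<forall>n. (\<Sum>k0 | length k0 = n. \<Sum>k1 | length k1 = n.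
    game A1 A2 (poly t n) b n k0 (\<phi> k1)) / 4 ^ n \<le> negl n + 2 ^ n / 2 ^ m n)"
proof -
  define T where "T = poly t"
  define Q where "Q n k0 = (\<Sum>k1 | length k1 = n. game A1 A2 (T n) b n k0 (\<phi> k1))" for n k0
  obtain p1 :: "nat poly" where "\<forall>xs\<in>{[unary n, unary (2 * m n)] | n. True}.
      halts_within (poly p1 (\<Sum>x\<leftarrow>xs. length x)) A1 (input xs)"
    using A1 unfolding poly_time_def by blast
  then have N1: "halts_within (poly p1 (n + 2 * m n)) A1 (input [unary n, unary (2 * m n)])" for n
    by (auto dest: spec[of _ "[unary n, unary (2 * m n)]"])
  obtain p2 :: "nat poly" where p2: "\<And>n \<sigma> \<rho> s \<tau>. (s, \<tau>) \<in> set (branches A1 (input [unary n, unary (2 * m n)]) \<rho>) \<Longrightarrow>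
      halts_within (poly p2 (n + length \<sigma>)) A2 (s(0 := \<sigma>))"
    using A2 by blast
  \<comment> \<open>The advice has to settle on one revealed key for each \<open>n\<close>; a
    maximiser of \<open>Q n\<close> dominates the average over all of them.\<close>
  have "\<exists>k. length k = n \<and> (\<forall>k0. length k0 = n \<longrightarrow> Q n k0 \<le> Q n k)" for n
  proof -
    let ?K = "{k :: bool list. length k = n}"
    have "?K \<noteq> {}" using Ex_list_of_length by blast
    then have "Max (Q n ` ?K) \<in> Q n ` ?K" using finite_keys by (intro Max_in) auto
    then obtain k where "k \<in> ?K" "Q n k = Max (Q n ` ?K)" by auto
    then show ?thesis using finite_keys[of n] by (intro exI[of _ k]) auto
  qed
  then obtain key where key: "\<And>n. length (key n) = n" "\<And>n k0. length k0 = n \<Longrightarrow> Q n k0 \<le> Q n (key n)"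
    by metis
  have N2: "halts_within (poly p2 (n + n)) A2 (s(0 := key n))"
    if "(s, \<tau>) \<in> set (branches A1 (input [unary n, unary (2 * m n)]) \<rho>)" for n s \<tau> \<rho>
    using p2[OF that, of "key n"] key(1) by simp
  \<comment> \<open>All that \<open>A1\<close> and \<open>A2\<close> can address, plus 1 for the
    strict inequality that \<open>game_tensor\<close> asks for.\<close>
  define d where "d n = n + 2 * m n + poly p1 (n + 2 * m n) + n + poly p2 (n + n) + 1" for n
  define D where "D n = d n + 2 * m n * T n" for n
  define bound where "bound n = (3 * (m n * Suc (T n)) + T n * length (U (key n))) * (2 * (d n + 2 * m n * T n + m n) + 3)" for n
  have "\<exists>hs. length (gate_codes hs) \<le> bound n \<and>
    (\<forall>\<psi>. supp (m n) \<psi> \<longrightarrow> fold gate_op hs (copies (m n) (Suc (T n)) (proj \<psi>)) =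
       tensor (D n) (copies (2 * m n) (T n) (proj (pairv (m n) (\<not> b) \<psi> (\<phi> (key n))))) (proj \<psi>))" for n
    using ex_rearranging_gates[of "U (key n)" "m n" "T n" "d n" b] gates_below[of "key n"] key(1)
    by (simp add: bound_def D_def circuit_output_def del: copies.simps)
  then obtain hs where hs: "\<And>n. length (gate_codes (hs n)) \<le> bound n"
    "\<And>n \<psi>. supp (m n) \<psi> \<Longrightarrow> fold gate_op (hs n) (copies (m n) (Suc (T n)) (proj \<psi>)) =
       tensor (D n) (copies (2 * m n) (T n) (proj (pairv (m n) (\<not> b) \<psi> (\<phi> (key n))))) (proj \<psi>)"
    by metis
  define advice where "advice n = attack_advice (2 * m n) (D n) (key n) (hs n)" for n
  let ?A = "attack_com b H G A1 A2"
  have pm: "pbd UNIV (\<lambda>n. n) m" and pU: "pbd UNIV (\<lambda>n. n) (\<lambda>n. length (gate_codes (U (key n))))"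
    using pbd_circuit[of UNIV "\<lambda>n. n" key] pbd_sz[of UNIV "\<lambda>n. n"] by (simp_all add: key(1))
  have pn: "pbd UNIV (\<lambda>n. n) (\<lambda>n. n)" by (rule pbd_sz)
  have pT: "pbd UNIV (\<lambda>n. n) T" unfolding T_def by (intro pbd_intros pn)
  have pd: "pbd UNIV (\<lambda>n. n) d" unfolding d_def by (intro pbd_intros pm pn)
  have pD: "pbd UNIV (\<lambda>n. n) D" unfolding D_def by (intro pbd_intros pd pm pT)
  have plU: "pbd UNIV (\<lambda>n. n) (\<lambda>n. length (U (key n)))"
    by (rule pbd_le[OF pU length_le_gate_codes])
  have pbound: "pbd UNIV (\<lambda>n. n) bound" unfolding bound_def by (intro pbd_intros pm pT plU pd)
  have "pbd UNIV (\<lambda>n. n) (\<lambda>n. length (advice n))"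
  proof (rule pbd_le)
    show "pbd UNIV (\<lambda>n. n) (\<lambda>n. 2 * m n + D n + 2 * n + bound n + 3)"
      by (intro pbd_intros pm pD pn pbound)
    show "length (advice n) \<le> 2 * m n + D n + 2 * n + bound n + 3" for n
      using hs(1)[of n] by (simp add: advice_def attack_advice_def length_encode_bits key(1))
  qed
  then obtain q where q: "\<forall>n. length (advice n) \<le> poly q n" unfolding pbd_def by auto
  have acc: "paccepts UNIV (\<lambda>n. \<Sum>x\<leftarrow>[unary n, advice n]. length x) ?A (\<lambda>n. input [unary n, advice n]) \<rho>
    (\<lambda>n. \<Sum>x\<leftarrow>branches A1 (input [unary n, unary (2 * m n)]) (fold gate_op (hs n) (\<rho> n)).
       \<Sum>y\<leftarrow>branches A2 ((fst x)(0 := key n)) (snd x).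
         if top_bit (fst x 0) = b \<and> top_bit (fst y 0) \<noteq> b then weight (D n) n (fst y 1) (snd y) else 0)" for \<rho>
    unfolding advice_def
  proof (rule paccepts_attack[OF H(1) N1 _ H(2) _ N2])
    show "pbd UNIV (\<lambda>n. n) (\<lambda>n. poly p1 (n + 2 * m n))" by (intro pbd_intros pn pm)
    show "pbd UNIV (\<lambda>n. n) (\<lambda>n. poly p2 (n + n))" by (intro pbd_intros pn)
  qed
  have "poly_time ?A {[unary n, advice n] | n. True}"
    by (rule paccepts_poly_time[OF acc[of "\<lambda>_. proj ket_zero"]]) auto
  then have "nonuniform_qpt ?A advice"
    unfolding nonuniform_qpt_def using q by blast
  from sec[OF this, of "t + 1"] obtain negl where negl: "negligible negl"
    "\<And>n. \<exists>\<mu>. haar_measure (m n) \<mu> \<and>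
        \<bar>(\<Sum>k | length k = n. accept_prob ?A [unary n, advice n] (copies (m n) (Suc (T n)) (proj (\<phi> k)))) / 2 ^ n
          - (LINT \<psi>|\<mu>. accept_prob ?A [unary n, advice n] (copies (m n) (Suc (T n)) (proj \<psi>)))\<bar> \<le> negl n"
    by (auto simp: T_def simp del: copies.simps)
  \<comment> \<open>This holds for every unit vector, so it serves the pseudorandom states and the
    Haar random state alike.\<close>
  have eq: "accept_prob ?A [unary n, advice n] (copies (m n) (Suc (T n)) (proj \<psi>)) = game A1 A2 (T n) b n (key n) \<psi>"
    if \<psi>: "supp (m n) \<psi>" "nsq \<psi> = 1" for n \<psi>
  proof -
    have "2 * m n * T n + n + 2 * m n + poly p1 (n + 2 * m n) + n + poly p2 (n + n) < D n"
      by (simp add: D_def d_def)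
    from game_tensor[OF N1 N2 key(1) \<psi> this, where b = b] show ?thesis
      using paccepts_accept_prob[OF acc[of "\<lambda>n. copies (m n) (Suc (T n)) (proj \<psi>)"], of n] hs(2)[OF \<psi>(1)]
      by (simp del: copies.simps)
  qed
  have "(\<Sum>k0 | length k0 = n. \<Sum>k1 | length k1 = n. game A1 A2 (poly t n) b n k0 (\<phi> k1)) / 4 ^ n
      \<le> negl n + 2 ^ n / 2 ^ m n" for n
  proof -
    obtain \<mu> where \<mu>: "haar_measure (m n) \<mu>" and
      close: "\<bar>(\<Sum>k | length k = n. accept_prob ?A [unary n, advice n] (copies (m n) (Suc (T n)) (proj (\<phi> k)))) / 2 ^ n
          - (LINT \<psi>|\<mu>. accept_prob ?A [unary n, advice n] (copies (m n) (Suc (T n)) (proj \<psi>)))\<bar> \<le> negl n"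
      using negl(2)[of n] by blast
    let ?f = "\<lambda>\<psi>. accept_prob ?A [unary n, advice n] (copies (m n) (Suc (T n)) (proj \<psi>))"
    let ?g = "\<lambda>\<psi>. \<Sum>k | length k = n. (cmod (fold gate_vec (inverse_circuit (U k)) \<psi> 0))\<^sup>2"
    have below: "\<forall>g\<in>set (inverse_circuit (U k)). addrs_below (m n) g" if "length k = n" for k
      using addrs_below_inverse_circuit[OF gates_below[of k]] that by simp
    \<comment> \<open>The rule asks for integrability and nonnegativity of the majorant alone: if
      the smaller integrand is not integrable, its Bochner integral is 0.\<close>
    have "(LINT \<psi>|\<mu>. ?f \<psi>) \<le> (LINT \<psi>|\<mu>. ?g \<psi>)"
    proof (rule integral_mono_AE')
      show "integrable \<mu> ?g"
        by (intro Bochner_Integration.integrable_sum haar_circuit_integrable[OF \<mu>]) (use below in auto)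
      show "AE \<psi> in \<mu>. ?f \<psi> \<le> ?g \<psi>"
        using haar_supp[OF \<mu>]
      proof eventually_elim
        case (elim \<psi>)
        have "game A1 A2 (T n) b n (key n) \<psi> \<le> (\<Sum>k | length k = n. overlap n k \<psi>)"
          by (rule game_le[OF N1 N2 key(1)]) (use elim in auto)
        also have "\<dots> = ?g \<psi>" by (rule sum.cong) (auto simp: overlap_def)
        finally show ?case using eq elim by simp
      qed
      show "AE \<psi> in \<mu>. 0 \<le> ?g \<psi>" by (intro AE_I2 sum_nonneg) simp
    qed
    also have "\<dots> = (\<Sum>k | length k = n. LINT \<psi>|\<mu>. (cmod (fold gate_vec (inverse_circuit (U k)) \<psi> 0))\<^sup>2)"
      by (intro Bochner_Integration.integral_sum haar_circuit_integrable[OF \<mu>]) (use below in auto)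
    also have "\<dots> = (\<Sum>k | length (k :: bool list) = n. 1 / 2 ^ m n)"
      by (rule sum.cong) (auto simp: haar_circuit_zero[OF \<mu> below])
    also have "\<dots> = 2 ^ n / 2 ^ m n" by (simp add: card_keys)
    finally have haar: "(LINT \<psi>|\<mu>. ?f \<psi>) \<le> 2 ^ n / 2 ^ m n" .
    have sum: "(\<Sum>k | length k = n. ?f (\<phi> k)) = Q n (key n)"
      unfolding Q_def by (rule sum.cong) (auto simp: eq supp_state nsq_state simp del: copies.simps)
    have *: "Q n (key n) / 2 ^ n \<le> negl n + 2 ^ n / 2 ^ m n"
      using close haar unfolding sum by linarith
    \<comment> \<open>There are \<open>2 ^ n\<close> revealed keys, so passing to the best one
      cancels one of the two factors \<open>2 ^ n\<close> in \<open>4 ^ n\<close>; the other belongs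
      to the average over the hidden key.\<close>
    have "(\<Sum>k0 | length k0 = n. Q n k0) \<le> (\<Sum>k0 | length (k0 :: bool list) = n. Q n (key n))"
      by (rule sum_mono) (use key(2) in auto)
    also have "\<dots> = 2 ^ n * Q n (key n)" by (simp add: card_keys)
    finally have "(\<Sum>k0 | length k0 = n. Q n k0) / 4 ^ n \<le> 2 ^ n * Q n (key n) / 4 ^ n"
      by (simp add: divide_right_mono)
    also have "2 ^ n * Q n (key n) / 4 ^ n = Q n (key n) / 2 ^ n"
    proof -
      have "(4 :: real) ^ n = 2 ^ n * 2 ^ n" by (simp flip: power_mult_distrib)
      then show ?thesis by simp
    qed
    finally show ?thesis using * unfolding Q_def T_def by linarith
  qed
  then show ?thesis using negl(1) by blast
qed

end

section \<open>Negligible functions\<close>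

lemma negligible_add:
  assumes "negligible f" "negligible g"
  shows "negligible (\<lambda>n. f n + g n)"
  unfolding negligible_def
proof (intro allI impI)
  fix c :: real assume c: "c > 0"
  \<comment> \<open>Asking for one power more leaves a factor \<open>n\<close>, which absorbs the 2
    as soon as \<open>n\<close> is at least 2.\<close>
  have "eventually (\<lambda>n. f n < real n powr - (c + 1)) sequentially" "eventually (\<lambda>n. g n < real n powr - (c + 1)) sequentially"
    using assms c unfolding negligible_def by (auto dest!: spec[of _ "c + 1"])
  moreover have "eventually (\<lambda>n. 2 \<le> n) sequentially" by (rule eventually_ge_at_top)
  ultimately show "eventually (\<lambda>n. f n + g n < real n powr - c) sequentially"
  proof eventually_elim
    case (elim n)
    have "real n powr - c = real n * real n powr - (c + 1)"
      using elim(3) powr_add[of "real n" 1 "- (c + 1)"] by simp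
    moreover have "2 * real n powr - (c + 1) \<le> real n * real n powr - (c + 1)"
      using elim(3) by (intro mult_right_mono) auto
    ultimately show ?case using elim(1,2) by linarith
  qed
qed

lemma negligible_exp:
  assumes "c > 1" "\<forall>n. real (m n) \<ge> c * real n"
  shows "negligible (\<lambda>n. 2 ^ n / 2 ^ m n)"
  unfolding negligible_def
proof (intro allI impI)
  fix e :: real assume e: "e > 0"
  \<comment> \<open>\<open>m n - n\<close> is at least \<open>a * n\<close>, so the quotient decays
    at least as fast as 2 to the power \<open>- a * n\<close>.\<close>
  define a where "a = c - 1"
  have a: "a > 0" using assms(1) by (simp add: a_def)
  have "eventually (\<lambda>n. 2 powr (- a * real n) < real n powr - e) sequentially"
    using a e by real_asymp
  then show "eventually (\<lambda>n. 2 ^ n / 2 ^ m n < real n powr - e) sequentially"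
  proof eventually_elim
    case (elim n)
    have "(2 :: real) ^ n / 2 ^ m n = 2 powr (real n - real (m n))"
      by (simp add: powr_diff powr_realpow)
    also have "\<dots> \<le> 2 powr (- a * real n)"
      using assms(2)[rule_format, of n] by (intro powr_mono) (auto simp: a_def algebra_simps)
    finally show ?case using elim by linarith
  qed
qed

theorem theorem1p2:
  fixes StateGen :: com and m :: "nat \<Rightarrow> nat" and c :: real
  assumes "prsg StateGen m"
    and "c > 1"
    and "\<forall>n. real (m n) \<ge> c * real n"
  shows "\<exists>S. efficient_scheme S \<and> perfectly_correct S \<and> one_time_secure S"
proof -
  obtain U where gen: "circuit_generator StateGen m U" and
    sec: "\<And>(t :: nat poly) A advice. nonuniform_qpt A advice \<Longrightarrow> \<exists>negl. negligible negl \<and>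
      (\<forall>n. \<exists>\<mu>. haar_measure (m n) \<mu> \<and>
        \<bar>(\<Sum>k | length k = n. accept_prob A [unary n, advice n] (copies (m n) (poly t n) (proj (circuit_output (U k))))) / 2 ^ n
          - (LINT \<psi>|\<mu>. accept_prob A [unary n, advice n] (copies (m n) (poly t n) (proj \<psi>)))\<bar> \<le> negl n)"
    using assms(1) unfolding prsg_def by blast
  obtain H0 where H0: "regs_below H0 StateGen" using ex_regs_below by blast
  let ?H = "max 3 H0"
  interpret gen: generator StateGen m U ?H
    by unfold_locales (use gen regs_below_mono[OF H0] in auto)
  let ?S = "scheme ?H StateGen m"
  have "one_time_secure ?S"
    unfolding one_time_secure_def
  proof (intro allI impI)
    fix A1 A2 t assume adv: "qpt_adversary ?S A1 A2 t"
    have l: "pk_qubits ?S n = 2 * m n" for n by (simp add: scheme_def)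
    obtain H1 H2 where H12: "regs_below H1 A1" "regs_below H2 A2" using ex_regs_below by metis
    \<comment> \<open>The scheme is fixed before the adversary, while the reduction must keep its
      registers above those of the adversary; hence a second interpretation with a larger bound.
      Both yield the same \<open>game\<close>, which depends only on \<open>m\<close> and
      \<open>U\<close>.\<close>
    let ?H' = "max ?H (max H1 H2)"
    interpret big: generator StateGen m U ?H'
      by unfold_locales (use gen regs_below_mono[OF H0] in auto)
    have A1: "poly_time A1 {[unary n, unary (2 * m n)] | n. True}"
      using adv unfolding qpt_adversary_def l by blast
    obtain p :: "nat poly" where p: "\<And>n sk \<sigma> s \<rho>. (s, \<rho>) \<in> set (adversary_start ?S A1 t n sk) \<Longrightarrow>
        halts_within (poly p (n + length \<sigma>)) A2 (s(0 := \<sigma>))"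
      using adv unfolding qpt_adversary_def by fast
    \<comment> \<open>The time bound on \<open>A2\<close> is given for the stores that
      \<open>A1\<close> leaves when run on public keys. These stores do not depend on the quantum
      input, so the bound carries over to any \<open>\<rho>\<close>, and the key \<open>[]\<close>
      serves as an arbitrary instance.\<close>
    have A2: "halts_within (poly p (n + length \<sigma>)) A2 (s(0 := \<sigma>))"
      if s: "(s, \<tau>) \<in> set (branches A1 (input [unary n, unary (2 * m n)]) \<rho>)" for n \<sigma> \<rho> s \<tau>
    proof -
      obtain N where "halts_within N A1 (input [unary n, unary (2 * m n)])"
        using A1 unfolding poly_time_def by blast
      then have "map fst (adversary_start ?S A1 t n []) = map fst (branches A1 (input [unary n, unary (2 * m n)]) \<rho>)"
        unfolding adversary_start_def Let_def l by (rule branches_fst_indep)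
      from arg_cong[OF this, of set] have "s \<in> fst ` set (adversary_start ?S A1 t n [])"
        using s by (force simp: image_iff)
      then show ?thesis using p by fastforce
    qed
    have below: "regs_below ?H' A1" "regs_below ?H' A2"
      using H12 regs_below_mono by (meson max.cobounded1 max.cobounded2 order_trans)+
    have A2': "\<exists>p :: nat poly. \<forall>n \<sigma> \<rho>. \<forall>(s, \<tau>)\<in>set (branches A1 (input [unary n, unary (2 * m n)]) \<rho>).
      halts_within (poly p (n + length \<sigma>)) A2 (s(0 := \<sigma>))"
      using A2 by (intro exI[of _ p]) auto
    note average = big.game_average[OF sec below A1 A2', of t]
    obtain negl0 where n0: "negligible negl0" "\<And>n. (\<Sum>k0 | length k0 = n. \<Sum>k1 | length k1 = n.
        gen.game A1 A2 (poly t n) False n k0 (circuit_output (U k1))) / 4 ^ n \<le> negl0 n + 2 ^ n / 2 ^ m n"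
      using average[of False] by blast
    obtain negl1 where n1: "negligible negl1" "\<And>n. (\<Sum>k0 | length k0 = n. \<Sum>k1 | length k1 = n.
        gen.game A1 A2 (poly t n) True n k0 (circuit_output (U k1))) / 4 ^ n \<le> negl1 n + 2 ^ n / 2 ^ m n"
      using average[of True] by blast
    let ?e = "\<lambda>n. 2 ^ n / 2 ^ m n :: real"
    have "negligible (\<lambda>n. (negl0 n + ?e n) + (negl1 n + ?e n))"
      by (intro negligible_add n0(1) n1(1) negligible_exp[OF assms(2,3)])
    moreover have "forgery_prob ?S A1 A2 t n \<le> (negl0 n + ?e n) + (negl1 n + ?e n)" for n
    proof -
      \<comment> \<open>For message \<open>True\<close> the revealed key is the second one;
        exchanging the sums puts it first, as in \<open>game_average\<close>.\<close>
      have "(\<Sum>k0 | length k0 = n. \<Sum>k1 | length k1 = n. gen.game A1 A2 (poly t n) True n k1 (circuit_output (U k0)))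
          = (\<Sum>k0 | length k0 = n. \<Sum>k1 | length k1 = n. gen.game A1 A2 (poly t n) True n k0 (circuit_output (U k1)))"
        by (rule sum.swap)
      then show ?thesis
        using n0(2)[of n] n1(2)[of n] unfolding gen.forgery_prob_eq by (simp add: sum.distrib add_divide_distrib)
    qed
    ultimately show "\<exists>negl. negligible negl \<and> (\<forall>n. forgery_prob ?S A1 A2 t n \<le> negl n)" by blast
  qed
  then show ?thesis using gen.scheme_efficient gen.perfectly_correct_scheme by blast
qed

end
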